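(* Let $n\ge1$. Let $\Omega$ be the collection of all sets $S\subset\mathbb{R}^n$ that admit a representation $$S=x+2^{-k}\bigcup_{j=1}^{2^{kn}}\left([0,2\pi]^n+2\pi m_j\right)$$ for some $x\in\mathbb{R}^n$, some $k\in\mathbb{N}$ and some pairwise different vectors $m_1,\dots,m_{2^{kn}}\in\mathbb{Z}^n$. Then for every $\epsilon>0$ there is an $\epsilon$-perturbation $\Lambda$ of $\mathbb{Z}^n$ such that the exponential system $E(\Lambda)=\{e^{i\lambda\cdot x}\mathbf{1}_S(x):\lambda\in\Lambda\}$ is a Riesz basis in $L^2(S)$ for every $S\in\Omega$.
   Context: Given countable sets $\Lambda,\Lambda'\subset\mathbb{R}^n$, $\Lambda'$ is an $\epsilon$-perturbation of $\Lambda$ if, for some enumerations $\Lambda=\{\lambda(k)\}$ and $\Lambda'=\{\lambda'(k)\}$, $\sup_k|\lambda(k)-\lambda'(k)|<\epsilon$. A family of vectors in a Hilbert space is a Riesz basis if it is the image of an orthonormal basis under a linear isomorphism (bounded, with bounded inverse) of the space. *)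

theory Defs
  imports "HOL-Analysis.Analysis"
begin

text \<open>
  The Hilbert space \<open>L\<^sup>2(M)\<close> is represented by square-integrable functions, with equality
  almost everywhere playing the role of equality of vectors.
\<close>

definition L2 :: "'a measure \<Rightarrow> ('a \<Rightarrow> complex) set" where
  "L2 M = {f \<in> borel_measurable M. integrable M (\<lambda>x. (cmod (f x))\<^sup>2)}"

definition L2_inner :: "'a measure \<Rightarrow> ('a \<Rightarrow> complex) \<Rightarrow> ('a \<Rightarrow> complex) \<Rightarrow> complex" where
  "L2_inner M f g = (LINT x|M. f x * cnj (g x))"

definition L2_norm :: "'a measure \<Rightarrow> ('a \<Rightarrow> complex) \<Rightarrow> real" where
  "L2_norm M f = sqrt (LINT x|M. (cmod (f x))\<^sup>2)"

definition orthonormal_basis ::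
  "'a measure \<Rightarrow> 'k set \<Rightarrow> ('k \<Rightarrow> 'a \<Rightarrow> complex) \<Rightarrow> bool" where
  "orthonormal_basis M K e \<longleftrightarrow>
     (\<forall>k\<in>K. e k \<in> L2 M) \<and>
     (\<forall>k\<in>K. \<forall>l\<in>K. L2_inner M (e k) (e l) = (if k = l then 1 else 0)) \<and>
     (\<forall>f\<in>L2 M. \<forall>\<delta>>0. \<exists>F c. finite F \<and> F \<subseteq> K \<and>
        L2_norm M (\<lambda>x. f x - (\<Sum>k\<in>F. c k * e k x)) < \<delta>)"

text \<open>
  Linearity and the norm bound together force \<open>T\<close> to respect equality almost everywhere, so
  that \<open>T\<close> induces a bounded linear operator on the space of equivalence classes; conversely
  every such operator arises in this way.
\<close>

definition bounded_operator ::
  "'a measure \<Rightarrow> (('a \<Rightarrow> complex) \<Rightarrow> ('a \<Rightarrow> complex)) \<Rightarrow> bool" where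
  "bounded_operator M T \<longleftrightarrow>
     (\<forall>f\<in>L2 M. T f \<in> L2 M) \<and>
     (\<forall>f\<in>L2 M. \<forall>g\<in>L2 M. AE x in M. T (\<lambda>y. f y + g y) x = T f x + T g x) \<and>
     (\<forall>f\<in>L2 M. \<forall>a. AE x in M. T (\<lambda>y. a * f y) x = a * T f x) \<and>
     (\<exists>C. \<forall>f\<in>L2 M. L2_norm M (T f) \<le> C * L2_norm M f)"

definition bounded_isomorphism ::
  "'a measure \<Rightarrow> (('a \<Rightarrow> complex) \<Rightarrow> ('a \<Rightarrow> complex)) \<Rightarrow> bool" where
  "bounded_isomorphism M T \<longleftrightarrow> bounded_operator M T \<and>
     (\<exists>U. bounded_operator M U \<and>
        (\<forall>f\<in>L2 M. (AE x in M. U (T f) x = f x) \<and> (AE x in M. T (U f) x = f x)))"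

definition riesz_basis ::
  "'a measure \<Rightarrow> 'k set \<Rightarrow> ('k \<Rightarrow> 'a \<Rightarrow> complex) \<Rightarrow> bool" where
  "riesz_basis M K v \<longleftrightarrow>
     (\<forall>k\<in>K. v k \<in> L2 M) \<and>
     (\<exists>e T. orthonormal_basis M K e \<and> bounded_isomorphism M T \<and>
        (\<forall>k\<in>K. AE x in M. v k x = T (e k) x))"

definition exponential :: "(real^'n) set \<Rightarrow> real^'n \<Rightarrow> real^'n \<Rightarrow> complex" where
  "exponential S l x = exp (\<i> * complex_of_real (l \<bullet> x)) * indicator S x"

text \<open>
  An enumeration is without repetition; the index set \<open>K\<close> allows for finite sets. The supremum
  is taken in \<^typ>\<open>ennreal\<close> so that it is infinite for unbounded distances.
\<close>

definition perturbation :: "real \<Rightarrow> (real^'n) set \<Rightarrow> (real^'n) set \<Rightarrow> bool" where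
  "perturbation \<epsilon> \<Lambda> \<Lambda>' \<longleftrightarrow>
     (\<exists>(K::nat set) l l'. bij_betw l K \<Lambda> \<and> bij_betw l' K \<Lambda>' \<and>
        (SUP k\<in>K. ennreal (norm (l k - l' k))) < ennreal \<epsilon>)"

definition integer_lattice :: "(real^'n) set" where
  "integer_lattice = {v. \<forall>i. v $ i \<in> \<int>}"

definition dyadic_cube_unions :: "(real^'n) set set" where
  "dyadic_cube_unions = {S. \<exists>x (k::nat) (m :: nat \<Rightarrow> real^'n).
     (\<forall>j\<in>{1..2 ^ (k * CARD('n))}. m j \<in> integer_lattice) \<and>
     inj_on m {1..2 ^ (k * CARD('n))} \<and>
     S = (\<lambda>y. x + (1 / 2 ^ k) *\<^sub>R y) `
           (\<Union>j\<in>{1..2 ^ (k * CARD('n))}.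
              (\<lambda>y. y + (2 * pi) *\<^sub>R m j) ` {y. \<forall>i. 0 \<le> y $ i \<and> y $ i \<le> 2 * pi})}"

end

theory Submission
  imports Defs
begin

text \<open>
  The perturbed lattice is \<open>{z + \<delta> z}\<close> for a map \<open>\<delta>\<close> on \<open>\<int>\<^sup>n\<close> that is found by a category
  argument: for each of countably many sets \<open>S\<close>, the maps \<open>\<delta>\<close> that give a Riesz basis of
  \<open>L\<^sup>2(S)\<close> form an open and dense set among the uniform limits of maps that are periodic with a
  period \<open>2\<^sup>K\<close>. Countably many \<open>S\<close> are enough, because translating \<open>S\<close> only multiplies the
  exponentials by constants of modulus \<open>1\<close>, and up to translation \<open>S\<close> is given by a level \<open>k\<close>
  and a finite set of lattice points.

  Openness (\<open>good_shift_open\<close>) is the Paley--Wiener stability theorem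
  (\<open>riesz_system_exponential_stable\<close>): on a bounded set, a uniformly small change of the
  frequencies changes \<open>\<Sum> c\<^sub>k e\<^sub>k\<close> by a small multiple of the norm of the coefficients
  (\<open>riesz_system_perturb\<close>), as the Taylor series of the exponential shows.

  Density (\<open>good_shift_dense\<close>) rests on a matrix. Subdivide the cubes of \<open>S\<close> so that \<open>\<delta>\<close> is
  periodic with period \<open>N = 2\<^sup>K\<close>, where \<open>h = 2 \<pi> / N\<close> is the side of a cube. The frequencies
  of one residue class modulo \<open>N\<close> then form a translate of \<open>N \<int>\<^sup>n\<close>, so their exponentials are an
  orthogonal basis on a single cube (\<open>L2_inner_class_shift\<close>, \<open>spans_densely_cube_wave\<close>). On the
  cube with corner \<open>p\<close>, all exponentials of the class of \<open>r\<close> acquire the same additional factor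
  \<open>exp (\<i> \<tau>\<^sub>r \<bullet> p)\<close>, where \<open>\<tau>\<^sub>r = r + \<delta> r\<close>. There are as many cubes as classes, and the system
  is a Riesz basis as soon as the square matrix of these factors is invertible
  (\<open>riesz_system_cube_union\<close>). Since exponentials with distinct frequencies are linearly
  independent on every ball, arbitrarily small changes of the \<open>\<tau>\<^sub>r\<close> make it invertible
  (\<open>wave_matrix_invertible\<close>).

  A sequence of periodic maps with rapidly shrinking neighbourhoods, one step for each \<open>S\<close>, then
  converges to a map that serves all \<open>S\<close> at once (\<open>universal_good_shift\<close>).

  Until the last step, Riesz bases are described by density of the span and by two-sided
  bounds on finite linear combinations; \<open>riesz_basis_if_riesz_system\<close> turns this into an
  isomorphism that maps an orthonormal basis to the system.
\<close>

section \<open>The space of square-integrable functions\<close>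

lemma L2_measurable [measurable_dest]: "f \<in> L2 M \<Longrightarrow> f \<in> borel_measurable M"
  by (simp add: L2_def)

lemma L2_integrable: "f \<in> L2 M \<Longrightarrow> integrable M (\<lambda>x. (cmod (f x))\<^sup>2)"
  by (simp add: L2_def)

lemma L2_norm_nonneg [simp]: "0 \<le> L2_norm M f"
  by (simp add: L2_norm_def)

lemma L2_norm_power2: "(L2_norm M f)\<^sup>2 = (LINT x|M. (cmod (f x))\<^sup>2)"
  by (simp add: L2_norm_def)

lemma L2_add:
  assumes "f \<in> L2 M" "g \<in> L2 M"
  shows "(\<lambda>x. f x + g x) \<in> L2 M"
proof -
  have [measurable]: "f \<in> borel_measurable M" "g \<in> borel_measurable M"
    using assms by (auto dest: L2_measurable)
  have "integrable M (\<lambda>x. 2 * (cmod (f x))\<^sup>2 + 2 * (cmod (g x))\<^sup>2)"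
    using assms by (intro Bochner_Integration.integrable_add integrable_mult_right L2_integrable)
  then have "integrable M (\<lambda>x. (cmod (f x + g x))\<^sup>2)"
  proof (rule Bochner_Integration.integrable_bound)
    show "AE x in M. norm ((cmod (f x + g x))\<^sup>2) \<le> norm (2 * (cmod (f x))\<^sup>2 + 2 * (cmod (g x))\<^sup>2)"
    proof (rule AE_I2)
      fix x
      have "(cmod (f x + g x))\<^sup>2 \<le> (cmod (f x) + cmod (g x))\<^sup>2"
        by (simp add: norm_triangle_ineq power_mono)
      also have "\<dots> \<le> 2 * (cmod (f x))\<^sup>2 + 2 * (cmod (g x))\<^sup>2"
        using zero_le_power2[of "cmod (f x) - cmod (g x)"] by (simp add: power2_eq_square algebra_simps)
      finally show "norm ((cmod (f x + g x))\<^sup>2) \<le> norm (2 * (cmod (f x))\<^sup>2 + 2 * (cmod (g x))\<^sup>2)"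
        by simp
    qed
  qed simp
  then show ?thesis by (simp add: L2_def)
qed

lemma L2_zero: "(\<lambda>x. 0) \<in> L2 M"
  by (simp add: L2_def)

lemma L2_norm_zero [simp]: "L2_norm M (\<lambda>x. 0) = 0"
  by (simp add: L2_norm_def)

lemma L2_mult_bounded:
  assumes f: "f \<in> L2 M" and [measurable]: "u \<in> borel_measurable M"
    and u: "\<And>x. x \<in> space M \<Longrightarrow> cmod (u x) \<le> C"
  shows "(\<lambda>x. u x * f x) \<in> L2 M" and "L2_norm M (\<lambda>x. u x * f x) \<le> \<bar>C\<bar> * L2_norm M f"
proof -
  have [measurable]: "f \<in> borel_measurable M"
    using f by (auto dest: L2_measurable)
  have le: "(cmod (u x * f x))\<^sup>2 \<le> C\<^sup>2 * (cmod (f x))\<^sup>2" if "x \<in> space M" for x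
    using u[OF that] by (simp add: norm_mult power_mult_distrib mult_right_mono power_mono)
  have int: "integrable M (\<lambda>x. C\<^sup>2 * (cmod (f x))\<^sup>2)"
    using L2_integrable[OF f] by simp
  have int': "integrable M (\<lambda>x. (cmod (u x * f x))\<^sup>2)"
    by (rule Bochner_Integration.integrable_bound[OF int]) (auto intro!: AE_I2 simp: le)
  then show "(\<lambda>x. u x * f x) \<in> L2 M"
    by (simp add: L2_def)
  have "(LINT x|M. (cmod (u x * f x))\<^sup>2) \<le> (LINT x|M. C\<^sup>2 * (cmod (f x))\<^sup>2)"
    by (rule integral_mono[OF int' int]) (rule le)
  then have "L2_norm M (\<lambda>x. u x * f x) \<le> sqrt (C\<^sup>2 * (LINT x|M. (cmod (f x))\<^sup>2))"
    by (simp add: L2_norm_def)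
  also have "\<dots> = \<bar>C\<bar> * L2_norm M f"
    by (simp add: L2_norm_def real_sqrt_mult)
  finally show "L2_norm M (\<lambda>x. u x * f x) \<le> \<bar>C\<bar> * L2_norm M f" .
qed

lemma L2_scale: "f \<in> L2 M \<Longrightarrow> (\<lambda>x. a * f x) \<in> L2 M"
  by (rule L2_mult_bounded(1)) auto

lemma L2_norm_scale: "L2_norm M (\<lambda>x. a * f x) = cmod a * L2_norm M f"
  by (simp add: L2_norm_def norm_mult power_mult_distrib real_sqrt_mult)

lemma L2_diff:
  assumes "f \<in> L2 M" "g \<in> L2 M"
  shows "(\<lambda>x. f x - g x) \<in> L2 M"
  using L2_add[OF assms(1) L2_scale[OF assms(2), of "-1"]] by simp

lemma L2_sum: "(\<And>i. i \<in> I \<Longrightarrow> f i \<in> L2 M) \<Longrightarrow> (\<lambda>x. \<Sum>i\<in>I. f i x) \<in> L2 M"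
  by (induction I rule: infinite_finite_induct) (auto intro: L2_zero L2_add)

lemma L2_lincomb: "(\<And>i. i \<in> I \<Longrightarrow> f i \<in> L2 M) \<Longrightarrow> (\<lambda>x. \<Sum>i\<in>I. c i * f i x) \<in> L2 M"
  by (intro L2_sum L2_scale)

lemma L2_norm_minus_commute: "L2_norm M (\<lambda>x. f x - g x) = L2_norm M (\<lambda>x. g x - f x)"
  by (simp add: L2_norm_def norm_minus_commute)

lemma L2_norm_eq_0D:
  assumes "f \<in> L2 M" "L2_norm M f = 0"
  shows "AE x in M. f x = 0"
proof -
  have "(LINT x|M. (cmod (f x))\<^sup>2) = 0"
    using assms(2) by (simp add: L2_norm_def)
  then have "AE x in M. (cmod (f x))\<^sup>2 = 0"
    using integral_nonneg_eq_0_iff_AE[OF L2_integrable[OF assms(1)]] by simp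
  then show ?thesis by simp
qed

text \<open>
  For \<open>a, b > 0\<close> the pointwise inequality
  \<open>|f + g|\<^sup>2 \<le> (1 + b/a) |f|\<^sup>2 + (1 + a/b) |g|\<^sup>2\<close> integrates to the square of \<open>a + b\<close>
  when \<open>a\<close> and \<open>b\<close> are the norms; adding a small amount to both takes care of vanishing norms.
\<close>

lemma L2_norm_triangle:
  assumes f: "f \<in> L2 M" and g: "g \<in> L2 M"
  shows "L2_norm M (\<lambda>x. f x + g x) \<le> L2_norm M f + L2_norm M g"
proof (rule field_le_epsilon)
  fix e :: real assume "e > 0"
  define a b where "a = L2_norm M f + e / 2" and "b = L2_norm M g + e / 2"
  have a: "a > 0" "L2_norm M f \<le> a" and b: "b > 0" "L2_norm M g \<le> b"
    using \<open>e > 0\<close> by (auto simp: a_def b_def intro: add_nonneg_pos)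
  have pt: "(cmod (f x + g x))\<^sup>2 \<le> (1 + b / a) * (cmod (f x))\<^sup>2 + (1 + a / b) * (cmod (g x))\<^sup>2" for x
  proof -
    define s t where "s = cmod (f x)" and "t = cmod (g x)"
    have "(cmod (f x + g x))\<^sup>2 \<le> (s + t)\<^sup>2"
      by (simp add: s_def t_def norm_triangle_ineq power_mono)
    moreover have "(1 + b / a) * s\<^sup>2 + (1 + a / b) * t\<^sup>2 - (s + t)\<^sup>2 = (b * s - a * t)\<^sup>2 / (a * b)"
      using a b by (simp add: power2_eq_square field_simps)
    moreover have "(b * s - a * t)\<^sup>2 / (a * b) \<ge> 0"
      using a b by simp
    ultimately show ?thesis
      unfolding s_def t_def by linarith
  qed
  have "(L2_norm M (\<lambda>x. f x + g x))\<^sup>2 \<le> (1 + b / a) * (L2_norm M f)\<^sup>2 + (1 + a / b) * (L2_norm M g)\<^sup>2"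
  proof -
    have "(LINT x|M. (cmod (f x + g x))\<^sup>2)
        \<le> (LINT x|M. (1 + b / a) * (cmod (f x))\<^sup>2 + (1 + a / b) * (cmod (g x))\<^sup>2)"
      using f g by (intro integral_mono Bochner_Integration.integrable_add integrable_mult_right
          L2_integrable L2_add pt)
    also have "\<dots> = (1 + b / a) * (LINT x|M. (cmod (f x))\<^sup>2) + (1 + a / b) * (LINT x|M. (cmod (g x))\<^sup>2)"
      using f g by (subst Bochner_Integration.integral_add) (auto intro: L2_integrable)
    finally show ?thesis
      by (simp add: L2_norm_power2)
  qed
  also have "\<dots> \<le> (1 + b / a) * a\<^sup>2 + (1 + a / b) * b\<^sup>2"
    using a b by (intro add_mono mult_left_mono power_mono) auto
  also have "\<dots> = (a + b)\<^sup>2"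
    using a b by (simp add: power2_eq_square field_simps)
  finally have "L2_norm M (\<lambda>x. f x + g x) \<le> a + b"
    by (rule power2_le_imp_le) (use a b in simp)
  then show "L2_norm M (\<lambda>x. f x + g x) \<le> L2_norm M f + L2_norm M g + e"
    by (simp add: a_def b_def)
qed

lemma L2_norm_triangle_diff:
  assumes "f \<in> L2 M" "g \<in> L2 M" "h \<in> L2 M"
  shows "L2_norm M (\<lambda>x. f x - h x) \<le> L2_norm M (\<lambda>x. f x - g x) + L2_norm M (\<lambda>x. g x - h x)"
  using L2_norm_triangle[OF L2_diff[OF assms(1,2)] L2_diff[OF assms(2,3)]] by simp

lemma L2_norm_le_diff_add:
  assumes "f \<in> L2 M" "g \<in> L2 M"
  shows "L2_norm M f \<le> L2_norm M (\<lambda>x. f x - g x) + L2_norm M g"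
  using L2_norm_triangle[OF L2_diff[OF assms] assms(2)] by simp

lemma L2_norm_sum_le:
  "finite I \<Longrightarrow> (\<And>i. i \<in> I \<Longrightarrow> f i \<in> L2 M) \<Longrightarrow>
    L2_norm M (\<lambda>x. \<Sum>i\<in>I. f i x) \<le> (\<Sum>i\<in>I. L2_norm M (f i))"
proof (induction I rule: finite_induct)
  case (insert i I)
  have "L2_norm M (\<lambda>x. f i x + (\<Sum>i\<in>I. f i x)) \<le> L2_norm M (f i) + L2_norm M (\<lambda>x. \<Sum>i\<in>I. f i x)"
    by (intro L2_norm_triangle L2_sum) (auto intro: insert.prems)
  also have "\<dots> \<le> L2_norm M (f i) + (\<Sum>i\<in>I. L2_norm M (f i))"
    using insert by auto
  finally show ?case using insert by simp
qed simp

text \<open>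
  The weights \<open>2\<^sup>n\<close> make both \<open>\<Sum> 2\<^sup>n |g\<^bsub>n+1\<^esub> - g\<^bsub>n\<^esub>|\<^sup>2\<close> integrable and its finiteness at a point
  strong enough to force convergence there; this works on an arbitrary measure space. The
  limit is then close to the sequence by Fatou's lemma.
\<close>

lemma L2_complete_fast:
  assumes g: "\<And>n. g n \<in> L2 M"
    and fast: "\<And>n m. n \<le> m \<Longrightarrow> L2_norm M (\<lambda>x. g m x - g n x) \<le> C / 2 ^ n"
  obtains h where "h \<in> L2 M" "\<And>n. L2_norm M (\<lambda>x. h x - g n x) \<le> C / 2 ^ n"
proof -
  have [measurable]: "g n \<in> borel_measurable M" for n
    using g by (auto dest: L2_measurable)
  have C: "C \<ge> 0"
    using fast[of 0 0] order_trans[OF L2_norm_nonneg] by fastforce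
  define d where "d n x = (2::real) ^ n * (cmod (g (Suc n) x - g n x))\<^sup>2" for n x
  have dint: "integrable M (d n)" for n
    unfolding d_def by (intro integrable_mult_right L2_integrable L2_diff g)
  have dle: "(LINT x|M. d n x) \<le> C\<^sup>2 * (1 / 2) ^ n" for n
  proof -
    have "(LINT x|M. d n x) = 2 ^ n * (L2_norm M (\<lambda>x. g (Suc n) x - g n x))\<^sup>2"
      by (simp add: d_def L2_norm_power2)
    also have "\<dots> \<le> 2 ^ n * (C / 2 ^ n)\<^sup>2"
      by (intro mult_left_mono power_mono fast) auto
    also have "\<dots> = C\<^sup>2 * (1 / 2) ^ n"
      by (simp add: power2_eq_square field_simps)
    finally show ?thesis .
  qed
  have "(\<integral>\<^sup>+x. (\<Sum>n. ennreal (d n x)) \<partial>M) = (\<Sum>n. \<integral>\<^sup>+x. ennreal (d n x) \<partial>M)"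
    unfolding d_def by (rule nn_integral_suminf) measurable
  also have "\<dots> = (\<Sum>n. ennreal (LINT x|M. d n x))"
    by (intro arg_cong[of _ _ suminf] ext nn_integral_eq_integral dint AE_I2) (simp add: d_def)
  also have "\<dots> \<le> (\<Sum>n. ennreal (C\<^sup>2 * (1 / 2) ^ n))"
    using dle by (intro suminf_le) (auto intro: ennreal_leI)
  also have "\<dots> = ennreal (\<Sum>n. C\<^sup>2 * (1 / 2) ^ n)"
    by (intro suminf_ennreal2) (auto intro!: summable_mult summable_geometric)
  also have "\<dots> < \<infinity>" by simp
  finally have "(\<integral>\<^sup>+x. (\<Sum>n. ennreal (d n x)) \<partial>M) \<noteq> \<infinity>" by simp
  then have "AE x in M. (\<Sum>n. ennreal (d n x)) \<noteq> \<infinity>"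
    by (intro nn_integral_PInf_AE) (auto simp: d_def)
  then have conv: "AE x in M. convergent (\<lambda>n. g n x)"
  proof eventually_elim
    case (elim x)
    have dnn: "0 \<le> d n x" for n by (simp add: d_def)
    have sd: "summable (\<lambda>n. d n x)"
      using elim by (intro summable_suminf_not_top dnn) simp
    define s where "s = (\<Sum>n. d n x)"
    have le: "cmod (g (Suc n) x - g n x) \<le> sqrt s * (sqrt (1 / 2)) ^ n" for n
    proof -
      have "d n x \<le> s"
        unfolding s_def using sum_le_suminf[OF sd, of "{n}"] dnn by simp
      then have "(cmod (g (Suc n) x - g n x))\<^sup>2 \<le> s * (1 / 2) ^ n"
        by (simp add: d_def field_simps)
      then have "sqrt ((cmod (g (Suc n) x - g n x))\<^sup>2) \<le> sqrt (s * (1 / 2) ^ n)"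
        by (rule real_sqrt_le_mono)
      then show ?thesis
        by (simp add: real_sqrt_mult real_sqrt_power real_sqrt_divide)
    qed
    have "summable (\<lambda>n. sqrt s * (sqrt (1 / 2)) ^ n)"
      by (intro summable_mult summable_geometric) simp
    then have "summable (\<lambda>n. g (Suc n) x - g n x)"
      by (rule summable_norm_cancel[OF summable_comparison_test'[where N = 0]]) (simp add: le)
    then have "convergent (\<lambda>n. (\<Sum>i<n. g (Suc i) x - g i x) + g 0 x)"
      by (intro convergent_add convergent_const) (simp add: summable_iff_convergent)
    then show "convergent (\<lambda>n. g n x)"
      by (simp add: sum_lessThan_telescope[of "\<lambda>i. g i x"])
  qed
  define h where "h x = lim (\<lambda>n. g n x)" for x
  have h_meas [measurable]: "h \<in> borel_measurable M"
    unfolding h_def by (rule borel_measurable_lim_metric) simp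
  have lims: "AE x in M. (\<lambda>n. g n x) \<longlonglongrightarrow> h x"
    using conv by eventually_elim (simp add: h_def convergent_LIMSEQ_iff)
  have fatou: "(\<integral>\<^sup>+x. ennreal ((cmod (h x - g n x))\<^sup>2) \<partial>M) \<le> ennreal ((C / 2 ^ n)\<^sup>2)" for n
  proof -
    have "(\<integral>\<^sup>+x. ennreal ((cmod (h x - g n x))\<^sup>2) \<partial>M)
        = (\<integral>\<^sup>+x. liminf (\<lambda>m. ennreal ((cmod (g m x - g n x))\<^sup>2)) \<partial>M)"
    proof (rule nn_integral_cong_AE, use lims in eventually_elim)
      case (elim x)
      have "(\<lambda>m. ennreal ((cmod (g m x - g n x))\<^sup>2)) \<longlonglongrightarrow> ennreal ((cmod (h x - g n x))\<^sup>2)"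
        by (intro tendsto_intros tendsto_ennrealI elim)
      then show ?case
        using lim_imp_Liminf[OF sequentially_bot] by metis
    qed
    also have "\<dots> \<le> liminf (\<lambda>m. \<integral>\<^sup>+x. ennreal ((cmod (g m x - g n x))\<^sup>2) \<partial>M)"
      by (rule nn_integral_liminf) simp
    also have "\<dots> \<le> ennreal ((C / 2 ^ n)\<^sup>2)"
    proof (rule Liminf_le)
      show "\<forall>\<^sub>F m in sequentially. (\<integral>\<^sup>+x. ennreal ((cmod (g m x - g n x))\<^sup>2) \<partial>M) \<le> ennreal ((C / 2 ^ n)\<^sup>2)"
        using eventually_ge_at_top[of n]
      proof eventually_elim
        case (elim m)
        have "(\<integral>\<^sup>+x. ennreal ((cmod (g m x - g n x))\<^sup>2) \<partial>M) = ennreal ((L2_norm M (\<lambda>x. g m x - g n x))\<^sup>2)"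
          unfolding L2_norm_power2 by (intro nn_integral_eq_integral L2_integrable L2_diff g) auto
        also have "\<dots> \<le> ennreal ((C / 2 ^ n)\<^sup>2)"
          by (intro ennreal_leI power_mono fast elim) auto
        finally show ?case .
      qed
    qed simp
    finally show ?thesis .
  qed
  have diff: "(\<lambda>x. h x - g n x) \<in> L2 M" for n
    unfolding L2_def using le_less_trans[OF fatou[of n]] by (auto intro!: integrableI_bounded simp: norm_power)
  have "h \<in> L2 M"
    using L2_add[OF diff[of 0] g[of 0]] by simp
  moreover have "L2_norm M (\<lambda>x. h x - g n x) \<le> C / 2 ^ n" for n
  proof -
    have "ennreal ((L2_norm M (\<lambda>x. h x - g n x))\<^sup>2) \<le> ennreal ((C / 2 ^ n)\<^sup>2)"
      using fatou[of n] unfolding L2_norm_power2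
      by (subst nn_integral_eq_integral[symmetric]) (auto intro: L2_integrable diff)
    then have "(L2_norm M (\<lambda>x. h x - g n x))\<^sup>2 \<le> (C / 2 ^ n)\<^sup>2" by simp
    then show ?thesis by (rule power2_le_imp_le) (use C in simp)
  qed
  ultimately show ?thesis using that by blast
qed

section \<open>Riesz systems\<close>

abbreviation lincomb :: "'k set \<Rightarrow> ('k \<Rightarrow> complex) \<Rightarrow> ('k \<Rightarrow> 'a \<Rightarrow> complex) \<Rightarrow> 'a \<Rightarrow> complex" where
  "lincomb F c v \<equiv> \<lambda>x. \<Sum>k\<in>F. c k * v k x"

definition spans_densely :: "'a measure \<Rightarrow> 'k set \<Rightarrow> ('k \<Rightarrow> 'a \<Rightarrow> complex) \<Rightarrow> bool" where
  "spans_densely M K v \<longleftrightarrow> (\<forall>f\<in>L2 M. \<forall>\<delta>>0. \<exists>F c. finite F \<and> F \<subseteq> K \<and>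
     L2_norm M (\<lambda>x. f x - lincomb F c v x) < \<delta>)"

definition coeff_norm :: "'k set \<Rightarrow> ('k \<Rightarrow> complex) \<Rightarrow> real" where
  "coeff_norm F c = sqrt (\<Sum>k\<in>F. (cmod (c k))\<^sup>2)"

definition riesz_bounds ::
  "'a measure \<Rightarrow> 'k set \<Rightarrow> ('k \<Rightarrow> 'a \<Rightarrow> complex) \<Rightarrow> real \<Rightarrow> real \<Rightarrow> bool" where
  "riesz_bounds M K v A B \<longleftrightarrow> (\<forall>F c. finite F \<longrightarrow> F \<subseteq> K \<longrightarrow>
     A * coeff_norm F c \<le> L2_norm M (lincomb F c v) \<and>
     L2_norm M (lincomb F c v) \<le> B * coeff_norm F c)"

text \<open>
  Only finite linear combinations occur, so perturbations can be handled without infinite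
  expansions; completeness of \<open>L\<^sup>2\<close> enters when the isomorphism in the definition of a Riesz
  basis is produced.
\<close>

definition riesz_system ::
  "'a measure \<Rightarrow> 'k set \<Rightarrow> ('k \<Rightarrow> 'a \<Rightarrow> complex) \<Rightarrow> bool" where
  "riesz_system M K v \<longleftrightarrow> (\<forall>k\<in>K. v k \<in> L2 M) \<and> spans_densely M K v \<and>
     (\<exists>A>0. \<exists>B. riesz_bounds M K v A B)"

lemma coeff_norm_nonneg [simp]: "0 \<le> coeff_norm F c"
  by (simp add: coeff_norm_def sum_nonneg)

lemma coeff_norm_power2: "(coeff_norm F c)\<^sup>2 = (\<Sum>k\<in>F. (cmod (c k))\<^sup>2)"
  by (simp add: coeff_norm_def sum_nonneg)

lemma riesz_boundsD:
  assumes "riesz_bounds M K v A B" "finite F" "F \<subseteq> K"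
  shows "A * coeff_norm F c \<le> L2_norm M (lincomb F c v)"
    and "L2_norm M (lincomb F c v) \<le> B * coeff_norm F c"
  using assms by (auto simp: riesz_bounds_def)

lemma combine_lincombs:
  fixes c d :: "'k \<Rightarrow> complex"
  assumes "finite F" "finite G"
  shows "\<exists>b. \<forall>v. (\<Sum>k\<in>F. c k * v k) + a * (\<Sum>k\<in>G. d k * v k) = (\<Sum>k\<in>F \<union> G. b k * v k)"
proof (intro exI allI)
  fix v :: "'k \<Rightarrow> complex"
  let ?c = "\<lambda>k. if k \<in> F then c k else 0" and ?d = "\<lambda>k. if k \<in> G then d k else 0"
  have "(\<Sum>k\<in>F. c k * v k) = (\<Sum>k\<in>F \<union> G. ?c k * v k)" "(\<Sum>k\<in>G. d k * v k) = (\<Sum>k\<in>F \<union> G. ?d k * v k)"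
    using assms by (auto intro!: sum.mono_neutral_cong_left)
  then show "(\<Sum>k\<in>F. c k * v k) + a * (\<Sum>k\<in>G. d k * v k) = (\<Sum>k\<in>F \<union> G. (?c k + a * ?d k) * v k)"
    by (simp add: distrib_right sum.distrib sum_distrib_left mult.assoc)
qed

lemma spans_denselyE:
  assumes "spans_densely M K v" "f \<in> L2 M" "\<delta> > 0"
  obtains F c where "finite F" "F \<subseteq> K" "L2_norm M (\<lambda>x. f x - lincomb F c v x) < \<delta>"
  using assms unfolding spans_densely_def by meson

text \<open>
  An approximation that loses a fixed factor \<open>\<rho> < 1\<close> can be repeated on the remainder, so the
  errors decrease geometrically.
\<close>

lemma spans_densely_by_iteration:
  assumes v: "\<And>k. k \<in> K \<Longrightarrow> v k \<in> L2 M" and \<rho>: "0 \<le> \<rho>" "\<rho> < 1"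
    and step: "\<And>f \<delta>. f \<in> L2 M \<Longrightarrow> \<delta> > 0 \<Longrightarrow> \<exists>F c. finite F \<and> F \<subseteq> K \<and>
       L2_norm M (\<lambda>x. f x - lincomb F c v x) \<le> \<rho> * L2_norm M f + \<delta>"
  shows "spans_densely M K v"
  unfolding spans_densely_def
proof (intro ballI allI impI)
  fix f and \<delta> :: real assume f: "f \<in> L2 M" and "\<delta> > 0"
  define \<eta> where "\<eta> = \<delta> * (1 - \<rho>) / 2"
  have "\<eta> > 0" using \<open>\<delta> > 0\<close> \<rho> by (simp add: \<eta>_def)
  have iter: "\<exists>F c. finite F \<and> F \<subseteq> K \<and>
      L2_norm M (\<lambda>x. f x - lincomb F c v x) \<le> \<rho> ^ n * L2_norm M f + \<delta> / 2" for n
  proof (induction n)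
    case 0
    show ?case using \<open>\<delta> > 0\<close> by (intro exI[of _ "{}"]) auto
  next
    case (Suc n)
    then obtain F c where F: "finite F" "F \<subseteq> K"
      and le: "L2_norm M (\<lambda>x. f x - lincomb F c v x) \<le> \<rho> ^ n * L2_norm M f + \<delta> / 2"
      by blast
    define g where "g x = f x - lincomb F c v x" for x
    have "g \<in> L2 M"
      unfolding g_def using F v by (intro L2_diff f L2_lincomb) auto
    from step[OF this \<open>\<eta> > 0\<close>] obtain G d where G: "finite G" "G \<subseteq> K"
      and le2: "L2_norm M (\<lambda>x. g x - lincomb G d v x) \<le> \<rho> * L2_norm M g + \<eta>"
      by blast
    obtain e where "\<forall>v. (\<Sum>k\<in>F. c k * v k) + 1 * (\<Sum>k\<in>G. d k * v k) = (\<Sum>k\<in>F \<union> G. e k * v k)"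
      using combine_lincombs[OF F(1) G(1)] by blast
    then have "g x - lincomb G d v x = f x - lincomb (F \<union> G) e v x" for x
      by (simp add: g_def diff_diff_eq)
    then have "L2_norm M (\<lambda>x. f x - lincomb (F \<union> G) e v x) \<le> \<rho> * L2_norm M g + \<eta>"
      using le2 by simp
    also have "\<dots> \<le> \<rho> * (\<rho> ^ n * L2_norm M f + \<delta> / 2) + \<eta>"
      using le[folded g_def] \<rho> by (intro add_mono mult_left_mono) auto
    also have "\<dots> = \<rho> ^ Suc n * L2_norm M f + \<delta> / 2"
      by (simp add: \<eta>_def field_simps)
    finally show ?case
      using F G by (intro exI[of _ "F \<union> G"] exI[of _ e]) auto
  qed
  have "(\<lambda>n. \<rho> ^ n * L2_norm M f) \<longlonglongrightarrow> 0 * L2_norm M f"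
    using \<rho> by (intro tendsto_intros LIMSEQ_realpow_zero)
  then have "\<forall>\<^sub>F n in sequentially. \<rho> ^ n * L2_norm M f < \<delta> / 2"
    using \<open>\<delta> > 0\<close> by (intro order_tendstoD) auto
  then obtain n where "\<rho> ^ n * L2_norm M f < \<delta> / 2"
    by (auto simp: eventually_sequentially)
  with iter[of n] show "\<exists>F c. finite F \<and> F \<subseteq> K \<and> L2_norm M (\<lambda>x. f x - lincomb F c v x) < \<delta>"
    by (smt (verit) field_sum_of_halves)
qed

text \<open>
  This is the Paley--Wiener criterion. The upper and lower bounds survive by the triangle
  inequality. For density, approximate \<open>f\<close> by \<open>\<Sum> c\<^sub>k v\<^sub>k\<close>; then \<open>\<Sum> c\<^sub>k w\<^sub>k\<close> misses \<open>f\<close> by about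
  \<open>\<theta> |c| \<le> (\<theta> / A) |f|\<close>, and the iteration applies.
\<close>

lemma riesz_system_perturb:
  assumes v: "\<And>k. k \<in> K \<Longrightarrow> v k \<in> L2 M" "spans_densely M K v" "riesz_bounds M K v A B"
    and w: "\<And>k. k \<in> K \<Longrightarrow> w k \<in> L2 M"
    and \<theta>: "0 \<le> \<theta>" "\<theta> < A"
    and close: "\<And>F c. finite F \<Longrightarrow> F \<subseteq> K \<Longrightarrow>
      L2_norm M (\<lambda>x. lincomb F c w x - lincomb F c v x) \<le> \<theta> * coeff_norm F c"
  shows "riesz_system M K w"
proof -
  have vF: "(lincomb F c v) \<in> L2 M" and wF: "(lincomb F c w) \<in> L2 M"
    if "F \<subseteq> K" for F c
    using that v(1) w by (auto intro!: L2_lincomb)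
  have close': "L2_norm M (\<lambda>x. lincomb F c v x - lincomb F c w x) \<le> \<theta> * coeff_norm F c"
    if "finite F" "F \<subseteq> K" for F c
    using close[OF that] by (subst L2_norm_minus_commute)
  have bounds: "riesz_bounds M K w (A - \<theta>) (B + \<theta>)"
    unfolding riesz_bounds_def
  proof (intro allI impI conjI)
    fix F c assume F: "finite F" "F \<subseteq> K"
    note le = riesz_boundsD[OF v(3) F, of c] close[OF F, of c] close'[OF F, of c]
    show "(A - \<theta>) * coeff_norm F c \<le> L2_norm M (lincomb F c w)"
      using le L2_norm_le_diff_add[OF vF[OF F(2), of c] wF[OF F(2), of c]] by (simp add: algebra_simps)
    show "L2_norm M (lincomb F c w) \<le> (B + \<theta>) * coeff_norm F c"
      using le L2_norm_le_diff_add[OF wF[OF F(2), of c] vF[OF F(2), of c]] by (simp add: algebra_simps)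
  qed
  have "A > 0" using \<theta> by simp
  have "spans_densely M K w"
  proof (rule spans_densely_by_iteration[where \<rho> = "\<theta> / A"])
    fix f and \<delta> :: real assume f: "f \<in> L2 M" and "\<delta> > 0"
    then obtain F c where F: "finite F" "F \<subseteq> K"
      and lt: "L2_norm M (\<lambda>x. f x - lincomb F c v x) < \<delta> / 2"
      using spans_denselyE[OF v(2) f, of "\<delta> / 2"] by auto
    have "A * coeff_norm F c \<le> L2_norm M f + \<delta> / 2"
      using riesz_boundsD(1)[OF v(3) F, of c] L2_norm_le_diff_add[OF vF[OF F(2), of c] f] lt
      by (subst (asm) L2_norm_minus_commute) linarith
    then have "\<theta> / A * (A * coeff_norm F c) \<le> \<theta> / A * (L2_norm M f + \<delta> / 2)"
      using \<theta> \<open>A > 0\<close> by (intro mult_left_mono) auto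
    then have "\<theta> * coeff_norm F c \<le> \<theta> / A * L2_norm M f + \<theta> / A * (\<delta> / 2)"
      using \<open>A > 0\<close> by (simp add: algebra_simps)
    also have "\<dots> \<le> \<theta> / A * L2_norm M f + 1 * (\<delta> / 2)"
      using \<theta> \<open>\<delta> > 0\<close> by (intro add_left_mono mult_right_mono) auto
    finally have "L2_norm M (\<lambda>x. f x - lincomb F c w x) \<le> \<theta> / A * L2_norm M f + \<delta>"
      using L2_norm_triangle_diff[OF f vF[OF F(2), of c] wF[OF F(2), of c]] close'[OF F, of c] lt
      by linarith
    then show "\<exists>F c. finite F \<and> F \<subseteq> K \<and>
        L2_norm M (\<lambda>x. f x - lincomb F c w x) \<le> \<theta> / A * L2_norm M f + \<delta>"
      using F by blast
  qed (use w \<theta> in auto)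
  with bounds w \<theta> show ?thesis
    unfolding riesz_system_def by (metis diff_gt_0_iff_gt)
qed

text \<open>
  The closure in \<open>L\<^sup>2 \<times> L\<^sup>2\<close> of the graph of \<open>\<Sum> c\<^sub>k e\<^sub>k \<mapsto> \<Sum> c\<^sub>k v\<^sub>k\<close>. Working with the relation
  makes the map and its inverse symmetric: they differ by exchanging \<open>e\<close> and \<open>v\<close>.
\<close>

definition graph_closure ::
  "'a measure \<Rightarrow> 'k set \<Rightarrow> ('k \<Rightarrow> 'a \<Rightarrow> complex) \<Rightarrow> ('k \<Rightarrow> 'a \<Rightarrow> complex) \<Rightarrow>
    ('a \<Rightarrow> complex) \<Rightarrow> ('a \<Rightarrow> complex) \<Rightarrow> bool" where
  "graph_closure M K e v f g \<longleftrightarrow> f \<in> L2 M \<and> g \<in> L2 M \<and> (\<forall>\<delta>>0. \<exists>F c. finite F \<and> F \<subseteq> K \<and>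
     L2_norm M (\<lambda>x. f x - lincomb F c e x) < \<delta> \<and>
     L2_norm M (\<lambda>x. g x - lincomb F c v x) < \<delta>)"

lemma graph_closure_swap: "graph_closure M K e v f g \<Longrightarrow> graph_closure M K v e g f"
  unfolding graph_closure_def by blast

lemma graph_closureE:
  assumes "graph_closure M K e v f g" "\<delta> > 0"
  obtains F c where "finite F" "F \<subseteq> K" "L2_norm M (\<lambda>x. f x - lincomb F c e x) < \<delta>"
    "L2_norm M (\<lambda>x. g x - lincomb F c v x) < \<delta>"
  using assms unfolding graph_closure_def by meson

lemma graph_closure_basis:
  assumes "k \<in> K" "e k \<in> L2 M" "v k \<in> L2 M"
  shows "graph_closure M K e v (e k) (v k)"
  unfolding graph_closure_def using assms
  by (auto intro!: exI[of _ "{k}"] exI[of _ "\<lambda>_. 1"])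

lemma graph_closure_add:
  assumes e: "\<And>k. k \<in> K \<Longrightarrow> e k \<in> L2 M" and v: "\<And>k. k \<in> K \<Longrightarrow> v k \<in> L2 M"
    and 1: "graph_closure M K e v f g" and 2: "graph_closure M K e v f' g'"
  shows "graph_closure M K e v (\<lambda>x. f x + f' x) (\<lambda>x. g x + g' x)"
proof -
  have mem: "f \<in> L2 M" "g \<in> L2 M" "f' \<in> L2 M" "g' \<in> L2 M"
    using 1 2 by (auto simp: graph_closure_def)
  have "\<exists>F c. finite F \<and> F \<subseteq> K \<and>
     L2_norm M (\<lambda>x. (f x + f' x) - lincomb F c e x) < \<delta> \<and>
     L2_norm M (\<lambda>x. (g x + g' x) - lincomb F c v x) < \<delta>" if "\<delta> > 0" for \<delta>
  proof -
    have "\<delta> / 2 > 0" using that by simp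
    obtain F c where F: "finite F" "F \<subseteq> K"
      and lF: "L2_norm M (\<lambda>x. f x - lincomb F c e x) < \<delta> / 2"
        "L2_norm M (\<lambda>x. g x - lincomb F c v x) < \<delta> / 2"
      using graph_closureE[OF 1 \<open>\<delta> / 2 > 0\<close>] by blast
    obtain G d where G: "finite G" "G \<subseteq> K"
      and lG: "L2_norm M (\<lambda>x. f' x - lincomb G d e x) < \<delta> / 2"
        "L2_norm M (\<lambda>x. g' x - lincomb G d v x) < \<delta> / 2"
      using graph_closureE[OF 2 \<open>\<delta> / 2 > 0\<close>] by blast
    obtain b where "\<forall>u. (\<Sum>k\<in>F. c k * u k) + 1 * (\<Sum>k\<in>G. d k * u k) = (\<Sum>k\<in>F \<union> G. b k * u k)"
      using combine_lincombs[OF F(1) G(1)] by blast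
    then have sum: "(\<Sum>k\<in>F. c k * u k) + (\<Sum>k\<in>G. d k * u k) = (\<Sum>k\<in>F \<union> G. b k * u k)" for u
      by simp
    have le: "L2_norm M (\<lambda>x. (p x + p' x) - lincomb (F \<union> G) b u x) < \<delta>"
      if p: "p \<in> L2 M" "p' \<in> L2 M" and u: "\<And>k. k \<in> K \<Longrightarrow> u k \<in> L2 M"
        and l: "L2_norm M (\<lambda>x. p x - lincomb F c u x) < \<delta> / 2"
          "L2_norm M (\<lambda>x. p' x - lincomb G d u x) < \<delta> / 2" for p p' u
    proof -
      have "L2_norm M (\<lambda>x. (p x - lincomb F c u x) + (p' x - lincomb G d u x))
          \<le> L2_norm M (\<lambda>x. p x - lincomb F c u x) + L2_norm M (\<lambda>x. p' x - lincomb G d u x)"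
        using F G u by (intro L2_norm_triangle L2_diff p L2_lincomb) auto
      then show ?thesis
        using l by (simp add: sum[symmetric] algebra_simps)
    qed
    show ?thesis
      using F G le[OF mem(1,3) e lF(1) lG(1)] le[OF mem(2,4) v lF(2) lG(2)]
      by (intro exI[of _ "F \<union> G"] exI[of _ b]) auto
  qed
  then show ?thesis
    unfolding graph_closure_def using mem by (auto intro: L2_add)
qed

lemma graph_closure_scale:
  assumes 1: "graph_closure M K e v f g"
  shows "graph_closure M K e v (\<lambda>x. a * f x) (\<lambda>x. a * g x)"
proof -
  have "\<exists>F c. finite F \<and> F \<subseteq> K \<and>
     L2_norm M (\<lambda>x. a * f x - lincomb F c e x) < \<delta> \<and>
     L2_norm M (\<lambda>x. a * g x - lincomb F c v x) < \<delta>" if "\<delta> > 0" for \<delta>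
  proof -
    have pos: "\<delta> / (cmod a + 1) > 0" using that by (simp add: add_nonneg_pos)
    obtain F c where F: "finite F" "F \<subseteq> K"
      and lF: "L2_norm M (\<lambda>x. f x - lincomb F c e x) < \<delta> / (cmod a + 1)"
        "L2_norm M (\<lambda>x. g x - lincomb F c v x) < \<delta> / (cmod a + 1)"
      using graph_closureE[OF 1 pos] by blast
    have le: "L2_norm M (\<lambda>x. a * p x - (\<Sum>k\<in>F. (a * c k) * u k x)) < \<delta>"
      if "L2_norm M (\<lambda>x. p x - lincomb F c u x) < \<delta> / (cmod a + 1)" for p u
    proof -
      have "L2_norm M (\<lambda>x. a * p x - (\<Sum>k\<in>F. (a * c k) * u k x))
          = cmod a * L2_norm M (\<lambda>x. p x - lincomb F c u x)"
        by (subst L2_norm_scale[symmetric]) (simp add: right_diff_distrib sum_distrib_left mult.assoc)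
      also have "\<dots> \<le> cmod a * (\<delta> / (cmod a + 1))"
        using that by (intro mult_left_mono) auto
      also have "\<dots> < \<delta>"
        using \<open>\<delta> > 0\<close> by (simp add: divide_simps add_nonneg_pos mult.commute)
      finally show ?thesis .
    qed
    show ?thesis
      using F le[OF lF(1)] le[OF lF(2)] by (intro exI[of _ F] exI[of _ "\<lambda>k. a * c k"]) auto
  qed
  then show ?thesis
    using 1 unfolding graph_closure_def by (auto intro: L2_scale)
qed

lemma graph_closure_bounded:
  assumes e: "\<And>k. k \<in> K \<Longrightarrow> e k \<in> L2 M" and v: "\<And>k. k \<in> K \<Longrightarrow> v k \<in> L2 M"
    and "C \<ge> 0"
    and dom: "\<And>F c. finite F \<Longrightarrow> F \<subseteq> K \<Longrightarrow>
      L2_norm M (lincomb F c v) \<le> C * L2_norm M (lincomb F c e)"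
    and 1: "graph_closure M K e v f g"
  shows "L2_norm M g \<le> C * L2_norm M f"
proof (rule field_le_epsilon)
  fix \<delta> :: real assume "\<delta> > 0"
  have mem: "f \<in> L2 M" "g \<in> L2 M"
    using 1 by (auto simp: graph_closure_def)
  have "\<delta> / (C + 1) > 0" using \<open>\<delta> > 0\<close> \<open>C \<ge> 0\<close> by simp
  then obtain F c where F: "finite F" "F \<subseteq> K"
    and lF: "L2_norm M (\<lambda>x. f x - lincomb F c e x) < \<delta> / (C + 1)"
      "L2_norm M (\<lambda>x. g x - lincomb F c v x) < \<delta> / (C + 1)"
    using graph_closureE[OF 1] by blast
  have mF: "(lincomb F c e) \<in> L2 M" "(lincomb F c v) \<in> L2 M"
    using F e v by (auto intro!: L2_lincomb)
  have "L2_norm M (lincomb F c e) \<le> L2_norm M f + \<delta> / (C + 1)"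
    using L2_norm_le_diff_add[OF mF(1) mem(1)] lF(1) by (subst (asm) L2_norm_minus_commute) linarith
  then have "C * L2_norm M (lincomb F c e) \<le> C * (L2_norm M f + \<delta> / (C + 1))"
    using \<open>C \<ge> 0\<close> by (rule mult_left_mono)
  then have "L2_norm M g \<le> \<delta> / (C + 1) + C * (L2_norm M f + \<delta> / (C + 1))"
    using L2_norm_le_diff_add[OF mem(2) mF(2)] lF(2) dom[OF F, of c] by linarith
  also have "\<dots> = C * L2_norm M f + (C + 1) * (\<delta> / (C + 1))"
    by (simp only: algebra_simps)
  also have "\<dots> = C * L2_norm M f + \<delta>"
    using \<open>C \<ge> 0\<close> by simp
  finally show "L2_norm M g \<le> C * L2_norm M f + \<delta>" .
qed

text \<open>
  The difference of two values belongs to the argument \<open>0\<close>, hence has norm \<open>0\<close> by boundedness.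
\<close>

lemma graph_closure_unique:
  assumes e: "\<And>k. k \<in> K \<Longrightarrow> e k \<in> L2 M" and v: "\<And>k. k \<in> K \<Longrightarrow> v k \<in> L2 M"
    and C: "C \<ge> 0"
    and dom: "\<And>F c. finite F \<Longrightarrow> F \<subseteq> K \<Longrightarrow>
      L2_norm M (lincomb F c v) \<le> C * L2_norm M (lincomb F c e)"
    and 1: "graph_closure M K e v f g" and 2: "graph_closure M K e v f g'"
  shows "AE x in M. g x = g' x"
proof -
  have "graph_closure M K e v (\<lambda>x. f x + (- 1) * f x) (\<lambda>x. g x + (- 1) * g' x)"
    by (intro graph_closure_add e v 1 graph_closure_scale 2)
  then have gc: "graph_closure M K e v (\<lambda>x. 0) (\<lambda>x. g x - g' x)" by simp
  then have "L2_norm M (\<lambda>x. g x - g' x) \<le> C * L2_norm M (\<lambda>x. 0)"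
    by (rule graph_closure_bounded[rotated 4]) (use e v C dom in auto)
  then have "L2_norm M (\<lambda>x. g x - g' x) = 0"
    using order_antisym[OF _ L2_norm_nonneg] by simp
  moreover have "(\<lambda>x. g x - g' x) \<in> L2 M"
    using gc by (auto simp: graph_closure_def)
  ultimately have "AE x in M. g x - g' x = 0"
    by (rule L2_norm_eq_0D[rotated])
  then show ?thesis by simp
qed

text \<open>
  This is where completeness of \<open>L\<^sup>2\<close> enters: if \<open>\<Sum> c e\<close> approximates \<open>f\<close> rapidly, then the same
  coefficients give a Cauchy sequence \<open>\<Sum> c v\<close>.
\<close>

lemma graph_closure_total:
  assumes e: "\<And>k. k \<in> K \<Longrightarrow> e k \<in> L2 M" and v: "\<And>k. k \<in> K \<Longrightarrow> v k \<in> L2 M"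
    and C: "C \<ge> 0"
    and dom: "\<And>F c. finite F \<Longrightarrow> F \<subseteq> K \<Longrightarrow>
      L2_norm M (lincomb F c v) \<le> C * L2_norm M (lincomb F c e)"
    and dense: "spans_densely M K e" and f: "f \<in> L2 M"
  shows "\<exists>g. graph_closure M K e v f g"
proof -
  have "\<exists>F c. finite F \<and> F \<subseteq> K \<and> L2_norm M (\<lambda>x. f x - lincomb F c e x) < 1 / 2 ^ n" for n :: nat
    using dense f unfolding spans_densely_def by (metis divide_pos_pos zero_less_numeral zero_less_one zero_less_power)
  then obtain F c where F: "\<And>n::nat. finite (F n)" "\<And>n. F n \<subseteq> K"
    and lF: "\<And>n. L2_norm M (\<lambda>x. f x - lincomb (F n) (c n) e x) < 1 / 2 ^ n"
    by metis
  have eF: "(lincomb (F n) (c n) e) \<in> L2 M" for n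
    using F e by (auto intro!: L2_lincomb)
  have vF: "(lincomb (F n) (c n) v) \<in> L2 M" for n
    using F v by (auto intro!: L2_lincomb)
  have cauchy: "L2_norm M (\<lambda>x. lincomb (F m) (c m) v x - lincomb (F n) (c n) v x) \<le> (2 * C) / 2 ^ n"
    if "n \<le> m" for n m
  proof -
    have fin: "finite (F m \<union> F n)" using F by simp
    obtain b where "\<forall>u. (\<Sum>k\<in>F m. c m k * u k) + (- 1) * (\<Sum>k\<in>F n. c n k * u k) = (\<Sum>k\<in>F m \<union> F n. b k * u k)"
      using combine_lincombs[OF F(1) F(1)] by blast
    then have sum: "(\<Sum>k\<in>F m. c m k * u k) - (\<Sum>k\<in>F n. c n k * u k) = (\<Sum>k\<in>F m \<union> F n. b k * u k)" for u
      by simp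
    have "L2_norm M (\<lambda>x. lincomb (F m) (c m) v x - lincomb (F n) (c n) v x)
        \<le> C * L2_norm M (\<lambda>x. lincomb (F m) (c m) e x - lincomb (F n) (c n) e x)"
      unfolding sum using F by (intro dom fin) auto
    also have "\<dots> \<le> C * (1 / 2 ^ m + 1 / 2 ^ n)"
    proof (intro mult_left_mono C)
      show "L2_norm M (\<lambda>x. lincomb (F m) (c m) e x - lincomb (F n) (c n) e x) \<le> 1 / 2 ^ m + 1 / 2 ^ n"
        using L2_norm_triangle_diff[OF eF[of m] f eF[of n]] lF[of m] lF[of n]
        by (subst (asm) (2) L2_norm_minus_commute) linarith
    qed
    also have "\<dots> \<le> C * (1 / 2 ^ n + 1 / 2 ^ n)"
      using that by (intro mult_left_mono C add_mono divide_left_mono) auto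
    finally show ?thesis by (simp add: mult.commute)
  qed
  obtain g where g: "g \<in> L2 M"
    and lg: "\<And>n. L2_norm M (\<lambda>x. g x - lincomb (F n) (c n) v x) \<le> (2 * C) / 2 ^ n"
    using L2_complete_fast[where g = "\<lambda>n x. \<Sum>k\<in>F n. c n k * v k x", OF vF cauchy] by blast
  have "\<exists>F c. finite F \<and> F \<subseteq> K \<and> L2_norm M (\<lambda>x. f x - lincomb F c e x) < \<delta> \<and>
     L2_norm M (\<lambda>x. g x - lincomb F c v x) < \<delta>" if "\<delta> > 0" for \<delta>
  proof -
    have "(\<lambda>n. (2 * C + 1) * (1 / 2) ^ n) \<longlonglongrightarrow> (2 * C + 1) * 0"
      by (intro tendsto_intros LIMSEQ_realpow_zero) auto
    then have "\<forall>\<^sub>F n in sequentially. (2 * C + 1) * (1 / 2) ^ n < \<delta>"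
      using that by (intro order_tendstoD) auto
    then obtain n where n: "(2 * C + 1) * (1 / 2) ^ n < \<delta>"
      by (auto simp: eventually_sequentially)
    have "(2 * C) / 2 ^ n < \<delta>" "1 / 2 ^ n < \<delta>"
    proof -
      have "(2 * C) / 2 ^ n + 1 / 2 ^ n < \<delta>"
        using n by (simp add: field_simps)
      moreover have "(2 * C) / 2 ^ n \<ge> 0" "1 / 2 ^ n > (0::real)" using C by auto
      ultimately show "(2 * C) / 2 ^ n < \<delta>" "1 / 2 ^ n < \<delta>" by linarith+
    qed
    then show ?thesis
      using F[of n] lF[of n] lg[of n] by (intro exI[of _ "F n"] exI[of _ "c n"]) auto
  qed
  then show ?thesis
    using f g unfolding graph_closure_def by blast
qed

lemma bounded_operator_of_graph_closure:
  assumes e: "\<And>k. k \<in> K \<Longrightarrow> e k \<in> L2 M" and v: "\<And>k. k \<in> K \<Longrightarrow> v k \<in> L2 M"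
    and C: "C \<ge> 0"
    and dom: "\<And>F c. finite F \<Longrightarrow> F \<subseteq> K \<Longrightarrow>
      L2_norm M (lincomb F c v) \<le> C * L2_norm M (lincomb F c e)"
    and T: "\<And>f. f \<in> L2 M \<Longrightarrow> graph_closure M K e v f (T f)"
  shows "bounded_operator M T"
proof -
  note uniq = graph_closure_unique[OF e v C dom]
  have "T f \<in> L2 M" if "f \<in> L2 M" for f
    using T[OF that] by (simp add: graph_closure_def)
  moreover have "AE x in M. T (\<lambda>y. f y + g y) x = T f x + T g x" if "f \<in> L2 M" "g \<in> L2 M" for f g
    using that by (intro uniq[OF _ _ _ _ T[OF L2_add] graph_closure_add] T e v)
  moreover have "AE x in M. T (\<lambda>y. a * f y) x = a * T f x" if "f \<in> L2 M" for f a
    using that by (intro uniq[OF _ _ _ _ T[OF L2_scale] graph_closure_scale] T e v)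
  moreover have "L2_norm M (T f) \<le> C * L2_norm M f" if "f \<in> L2 M" for f
    by (rule graph_closure_bounded[OF e v C dom T[OF that]])
  ultimately show ?thesis
    unfolding bounded_operator_def by blast
qed

text \<open>
  The isomorphism sends \<open>\<Sum> c\<^sub>k e\<^sub>k\<close> to \<open>\<Sum> c\<^sub>k v\<^sub>k\<close>; the closure of this relation is the graph of
  a bounded operator in either direction.
\<close>

lemma riesz_basis_if_riesz_system:
  assumes onb: "orthonormal_basis M K e" and e_bounds: "riesz_system M K e"
    and v: "riesz_system M K v"
  shows "riesz_basis M K v"
proof -
  have dom: "\<exists>C\<ge>0. \<forall>F c. finite F \<longrightarrow> F \<subseteq> K \<longrightarrow>
      L2_norm M (lincomb F c w) \<le> C * L2_norm M (lincomb F c u)"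
    if u: "riesz_system M K u" and w: "riesz_system M K w" for u w
  proof -
    obtain A B where A: "A > 0" and u: "riesz_bounds M K u A B"
      using u by (auto simp: riesz_system_def)
    obtain A' B' where A': "A' > 0" and w: "riesz_bounds M K w A' B'"
      using w by (auto simp: riesz_system_def)
    have "L2_norm M (lincomb F c w) \<le> \<bar>B'\<bar> / A * L2_norm M (lincomb F c u)"
      if F: "finite F" "F \<subseteq> K" for F c
    proof -
      have "L2_norm M (lincomb F c w) \<le> B' * coeff_norm F c"
        by (rule riesz_boundsD(2)[OF w F])
      also have "\<dots> \<le> \<bar>B'\<bar> * coeff_norm F c"
        by (intro mult_right_mono) auto
      also have "\<dots> = \<bar>B'\<bar> / A * (A * coeff_norm F c)"
        using A by simp
      also have "\<dots> \<le> \<bar>B'\<bar> / A * L2_norm M (lincomb F c u)"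
        using A by (intro mult_left_mono riesz_boundsD(1)[OF u F]) auto
      finally show ?thesis .
    qed
    then show ?thesis
      using A by (intro exI[of _ "\<bar>B'\<bar> / A"]) auto
  qed
  have eL: "\<And>k. k \<in> K \<Longrightarrow> e k \<in> L2 M" and vL: "\<And>k. k \<in> K \<Longrightarrow> v k \<in> L2 M"
    and ed: "spans_densely M K e" and vd: "spans_densely M K v"
    using e_bounds v by (auto simp: riesz_system_def)
  obtain C where C: "C \<ge> 0" and Cd: "\<And>F c. finite F \<Longrightarrow> F \<subseteq> K \<Longrightarrow>
      L2_norm M (lincomb F c v) \<le> C * L2_norm M (lincomb F c e)"
    using dom[OF e_bounds v] by blast
  obtain D where D: "D \<ge> 0" and Dd: "\<And>F c. finite F \<Longrightarrow> F \<subseteq> K \<Longrightarrow>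
      L2_norm M (lincomb F c e) \<le> D * L2_norm M (lincomb F c v)"
    using dom[OF v e_bounds] by blast
  define T where "T f = (SOME g. graph_closure M K e v f g)" for f
  define U where "U g = (SOME f. graph_closure M K v e g f)" for g
  have T: "graph_closure M K e v f (T f)" if "f \<in> L2 M" for f
    using graph_closure_total[OF eL vL C Cd ed that] unfolding T_def by (rule someI_ex)
  have U: "graph_closure M K v e g (U g)" if "g \<in> L2 M" for g
    using graph_closure_total[OF vL eL D Dd vd that] unfolding U_def by (rule someI_ex)
  note uniqT = graph_closure_unique[OF eL vL C Cd] and uniqU = graph_closure_unique[OF vL eL D Dd]
  have bT: "bounded_operator M T"
    by (rule bounded_operator_of_graph_closure[OF eL vL C Cd T])
  have bU: "bounded_operator M U"
    by (rule bounded_operator_of_graph_closure[OF vL eL D Dd U])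
  have "AE x in M. U (T f) x = f x" if "f \<in> L2 M" for f
  proof -
    have "T f \<in> L2 M" using T[OF that] by (simp add: graph_closure_def)
    from uniqU[OF _ _ _ _ U[OF this] graph_closure_swap[OF T[OF that]]] show ?thesis by simp
  qed
  moreover have "AE x in M. T (U f) x = f x" if "f \<in> L2 M" for f
  proof -
    have "U f \<in> L2 M" using U[OF that] by (simp add: graph_closure_def)
    from uniqT[OF _ _ _ _ T[OF this] graph_closure_swap[OF U[OF that]]] show ?thesis by simp
  qed
  ultimately have "bounded_isomorphism M T"
    unfolding bounded_isomorphism_def using bT bU by blast
  moreover have "AE x in M. v k x = T (e k) x" if "k \<in> K" for k
    using that by (intro uniqT[OF _ _ _ _ graph_closure_basis T]) (auto intro: eL vL)
  ultimately show ?thesis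
    unfolding riesz_basis_def using onb vL by blast
qed

section \<open>Stability of exponential systems\<close>

lemma coeff_norm_mult_le:
  assumes "\<And>k. k \<in> F \<Longrightarrow> cmod (a k) \<le> \<eta>" "0 \<le> \<eta>"
  shows "coeff_norm F (\<lambda>k. c k * a k) \<le> \<eta> * coeff_norm F c"
proof (rule power2_le_imp_le)
  have "(\<Sum>k\<in>F. (cmod (c k * a k))\<^sup>2) \<le> (\<Sum>k\<in>F. \<eta>\<^sup>2 * (cmod (c k))\<^sup>2)"
    using assms by (intro sum_mono)
      (simp add: norm_mult power_mult_distrib mult.commute mult_right_mono power_mono)
  then show "(coeff_norm F (\<lambda>k. c k * a k))\<^sup>2 \<le> (\<eta> * coeff_norm F c)\<^sup>2"
    by (simp add: coeff_norm_power2 power_mult_distrib sum_distrib_left)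
qed (use assms in simp)

text \<open>
  Each factor \<open>d\<^sub>k \<bullet> x\<close> is a sum of products of a bounded function of \<open>x\<close> and a bounded
  sequence in \<open>k\<close>; the former is pulled out of the sum and the latter absorbed in the coefficients.
\<close>

lemma L2_norm_moment_le:
  fixes S :: "(real^'n) set" and d :: "'k \<Rightarrow> real^'n"
  assumes v: "\<And>k. k \<in> K \<Longrightarrow> v k \<in> L2 (lebesgue_on S)"
    and B: "\<And>F c. finite F \<Longrightarrow> F \<subseteq> K \<Longrightarrow>
      L2_norm (lebesgue_on S) (lincomb F c v) \<le> B * coeff_norm F c" "B \<ge> 0"
    and R: "\<And>x. x \<in> S \<Longrightarrow> norm x \<le> R" "R \<ge> 0"
    and d: "\<And>k. k \<in> K \<Longrightarrow> norm (d k) \<le> \<eta>" "\<eta> \<ge> 0"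
    and F: "finite F" "F \<subseteq> K"
  shows "L2_norm (lebesgue_on S) (\<lambda>x. \<Sum>k\<in>F. (c k * of_real (d k \<bullet> x) ^ p) * v k x)
    \<le> B * (real CARD('n) * R * \<eta>) ^ p * coeff_norm F c"
proof (induction p arbitrary: c)
  case 0
  then show ?case using B(1)[OF F, of c] by simp
next
  case (Suc p)
  define G where "G i x = (\<Sum>k\<in>F. ((c k * of_real (d k $ i)) * of_real (d k \<bullet> x) ^ p) * v k x)" for i x
  have meas [measurable]: "(\<lambda>x. of_real (a \<bullet> x) :: complex) \<in> borel_measurable (lebesgue_on S)"
    for a :: "real^'n"
    by (intro measurable_restrict_space1 measurable_completion) simp
  have G: "G i \<in> L2 (lebesgue_on S)" for i
    unfolding G_def
  proof (rule L2_sum)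
    fix k assume "k \<in> F"
    show "(\<lambda>x. ((c k * of_real (d k $ i)) * of_real (d k \<bullet> x) ^ p) * v k x) \<in> L2 (lebesgue_on S)"
    proof (rule L2_mult_bounded(1))
      show "v k \<in> L2 (lebesgue_on S)" using v F \<open>k \<in> F\<close> by auto
      fix x assume "x \<in> space (lebesgue_on S)"
      then have "\<bar>d k \<bullet> x\<bar> \<le> norm (d k) * R"
        using R(1)[of x] by (intro order_trans[OF Cauchy_Schwarz_ineq2] mult_left_mono) auto
      then show "cmod (c k * of_real (d k $ i) * of_real (d k \<bullet> x) ^ p)
          \<le> cmod (c k) * \<bar>d k $ i\<bar> * (norm (d k) * R) ^ p"
        by (simp add: norm_mult norm_power mult_left_mono power_mono)
    qed simp
  qed
  have xi: "(\<lambda>x. of_real (x $ i) :: complex) \<in> borel_measurable (lebesgue_on S)" for i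
    using meas[of "axis i 1"] by (simp add: inner_axis' )
  have eq: "(\<Sum>k\<in>F. (c k * of_real (d k \<bullet> x) ^ Suc p) * v k x) = (\<Sum>i\<in>UNIV. of_real (x $ i) * G i x)" for x
  proof -
    have "(\<Sum>i\<in>UNIV. of_real (x $ i) * G i x)
        = (\<Sum>k\<in>F. \<Sum>i\<in>UNIV. of_real (x $ i) * (((c k * of_real (d k $ i)) * of_real (d k \<bullet> x) ^ p) * v k x))"
      unfolding G_def sum_distrib_left by (rule sum.swap)
    also have "\<dots> = (\<Sum>k\<in>F. (c k * of_real (d k \<bullet> x) ^ Suc p) * v k x)"
    proof (rule sum.cong[OF refl])
      fix k
      have "complex_of_real (d k \<bullet> x) = (\<Sum>i\<in>UNIV. of_real (x $ i) * of_real (d k $ i))"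
        by (simp add: inner_vec_def mult.commute)
      then show "(\<Sum>i\<in>UNIV. of_real (x $ i) * (((c k * of_real (d k $ i)) * of_real (d k \<bullet> x) ^ p) * v k x))
          = (c k * of_real (d k \<bullet> x) ^ Suc p) * v k x"
        unfolding power_Suc by (simp only: sum_distrib_left sum_distrib_right ac_simps)
    qed
    finally show ?thesis by simp
  qed
  have "L2_norm (lebesgue_on S) (\<lambda>x. of_real (x $ i) * G i x)
      \<le> R * (B * (real CARD('n) * R * \<eta>) ^ p * (\<eta> * coeff_norm F c))" for i
  proof -
    have "L2_norm (lebesgue_on S) (\<lambda>x. of_real (x $ i) * G i x) \<le> \<bar>R\<bar> * L2_norm (lebesgue_on S) (G i)"
      using R(1) by (intro L2_mult_bounded(2) G xi) (auto intro: order_trans[OF component_le_norm_cart])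
    also have "L2_norm (lebesgue_on S) (G i)
        \<le> B * (real CARD('n) * R * \<eta>) ^ p * coeff_norm F (\<lambda>k. c k * of_real (d k $ i))"
      unfolding G_def by (rule Suc)
    also have "\<dots> \<le> B * (real CARD('n) * R * \<eta>) ^ p * (\<eta> * coeff_norm F c)"
      using B R d F by (intro mult_left_mono coeff_norm_mult_le)
        (auto intro!: order_trans[OF component_le_norm_cart d(1)])
    finally show ?thesis using R(2) by (simp add: mult_left_mono)
  qed
  then have "(\<Sum>i\<in>(UNIV::'n set). L2_norm (lebesgue_on S) (\<lambda>x. of_real (x $ i) * G i x))
      \<le> (\<Sum>i\<in>(UNIV::'n set). R * (B * (real CARD('n) * R * \<eta>) ^ p * (\<eta> * coeff_norm F c)))"
    by (intro sum_mono)
  also have "\<dots> = B * (real CARD('n) * R * \<eta>) ^ Suc p * coeff_norm F c"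
    by (simp add: ac_simps)
  finally have le: "(\<Sum>i\<in>UNIV. L2_norm (lebesgue_on S) (\<lambda>x. of_real (x $ i) * G i x))
    \<le> B * (real CARD('n) * R * \<eta>) ^ Suc p * coeff_norm F c" .
  have "(\<lambda>x. of_real (x $ i) * G i x) \<in> L2 (lebesgue_on S)" for i
    by (rule L2_mult_bounded(1)[OF G xi, where C = R])
      (use order_trans[OF component_le_norm_cart R(1)] in auto)
  then show ?case
    unfolding eq by (rule order_trans[OF L2_norm_sum_le[OF finite] le])
qed

text \<open>
  Expand \<open>exp (\<i> d\<^sub>k \<bullet> x) - 1\<close> into its Taylor series and bound the term of order \<open>p\<close> by the previous
  lemma; the bounds add up to \<open>B (exp (n R \<eta>) - 1)\<close>. For a fixed finite set of indices the remainder
  tends to \<open>0\<close> uniformly on the bounded set \<open>S\<close>.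
\<close>

lemma L2_norm_modulation_le:
  fixes S :: "(real^'n) set" and d :: "'k \<Rightarrow> real^'n"
  assumes v: "\<And>k. k \<in> K \<Longrightarrow> v k \<in> L2 (lebesgue_on S)"
    and B: "\<And>F c. finite F \<Longrightarrow> F \<subseteq> K \<Longrightarrow>
      L2_norm (lebesgue_on S) (lincomb F c v) \<le> B * coeff_norm F c" "B \<ge> 0"
    and R: "\<And>x. x \<in> S \<Longrightarrow> norm x \<le> R" "R \<ge> 0"
    and d: "\<And>k. k \<in> K \<Longrightarrow> norm (d k) \<le> \<eta>" "\<eta> \<ge> 0"
    and F: "finite F" "F \<subseteq> K"
  shows "L2_norm (lebesgue_on S)
      (\<lambda>x. (\<Sum>k\<in>F. c k * (exp (\<i> * of_real (d k \<bullet> x)) * v k x)) - lincomb F c v x)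
    \<le> B * (exp (real CARD('n) * R * \<eta>) - 1) * coeff_norm F c"
proof -
  let ?M = "lebesgue_on S"
  define T where "T = R * \<eta>"
  define E where "E P t = (\<Sum>p\<le>P. (\<i> * of_real t) ^ p / fact p)" for P :: nat and t :: real
  have meas [measurable]: "(\<lambda>x. of_real (a \<bullet> x) :: complex) \<in> borel_measurable (lebesgue_on S)"
    for a :: "real^'n"
    by (intro measurable_restrict_space1 measurable_completion) simp
  have T: "\<bar>d k \<bullet> x\<bar> \<le> T" if "k \<in> K" "x \<in> S" for k x
    unfolding T_def using d R that
    by (intro order_trans[OF Cauchy_Schwarz_ineq2]) (metis mult.commute mult_mono norm_ge_zero)
  have T0: "T \<ge> 0" using R d by (simp add: T_def)
  have mom: "(\<lambda>x. \<Sum>k\<in>F. (c k * of_real (d k \<bullet> x) ^ p) * v k x) \<in> L2 ?M" for p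
  proof (rule L2_sum)
    fix k assume "k \<in> F"
    then have k: "k \<in> K" using F by auto
    show "(\<lambda>x. (c k * of_real (d k \<bullet> x) ^ p) * v k x) \<in> L2 ?M"
      by (rule L2_mult_bounded(1)[OF v[OF k], where C = "cmod (c k) * T ^ p"])
        (auto simp: norm_mult norm_power intro!: mult_left_mono power_mono T k)
  qed
  have main: "L2_norm ?M (\<lambda>x. \<Sum>k\<in>F. c k * ((E P (d k \<bullet> x) - 1) * v k x))
      \<le> B * (exp (real CARD('n) * R * \<eta>) - 1) * coeff_norm F c" for P
  proof -
    have E1: "E P t - 1 = (\<Sum>p\<in>{1..P}. \<i> ^ p / fact p * of_real t ^ p)" for t
    proof -
      have "{..P} = insert 0 {1..P}" by auto
      then show ?thesis by (simp add: E_def power_mult_distrib)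
    qed
    have "(\<Sum>k\<in>F. c k * ((E P (d k \<bullet> x) - 1) * v k x))
        = (\<Sum>p\<in>{1..P}. \<i> ^ p / fact p * (\<Sum>k\<in>F. (c k * of_real (d k \<bullet> x) ^ p) * v k x))" for x
      unfolding E1 by (simp add: sum_distrib_left sum_distrib_right, subst sum.swap) (simp add: ac_simps)
    then have "L2_norm ?M (\<lambda>x. \<Sum>k\<in>F. c k * ((E P (d k \<bullet> x) - 1) * v k x))
        = L2_norm ?M (\<lambda>x. \<Sum>p\<in>{1..P}. \<i> ^ p / fact p * (\<Sum>k\<in>F. (c k * of_real (d k \<bullet> x) ^ p) * v k x))"
      by simp
    also have "\<dots> \<le> (\<Sum>p\<in>{1..P}. L2_norm ?M (\<lambda>x. \<i> ^ p / fact p * (\<Sum>k\<in>F. (c k * of_real (d k \<bullet> x) ^ p) * v k x)))"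
      by (intro L2_norm_sum_le L2_scale mom) simp
    also have "\<dots> \<le> (\<Sum>p\<in>{1..P}. 1 / fact p * (B * (real CARD('n) * R * \<eta>) ^ p * coeff_norm F c))"
    proof (rule sum_mono)
      fix p
      have "L2_norm ?M (\<lambda>x. \<Sum>k\<in>F. (c k * of_real (d k \<bullet> x) ^ p) * v k x)
          \<le> B * (real CARD('n) * R * \<eta>) ^ p * coeff_norm F c"
        by (rule L2_norm_moment_le[OF v B R d F])
      then show "L2_norm ?M (\<lambda>x. \<i> ^ p / fact p * (\<Sum>k\<in>F. (c k * of_real (d k \<bullet> x) ^ p) * v k x))
          \<le> 1 / fact p * (B * (real CARD('n) * R * \<eta>) ^ p * coeff_norm F c)"
        unfolding L2_norm_scale by (simp add: norm_divide norm_power divide_right_mono)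
    qed
    also have "\<dots> = B * coeff_norm F c * (\<Sum>p\<in>{1..P}. (real CARD('n) * R * \<eta>) ^ p / fact p)"
      by (simp add: sum_distrib_left ac_simps)
    also have "\<dots> \<le> B * coeff_norm F c * (exp (real CARD('n) * R * \<eta>) - 1)"
    proof (rule mult_left_mono)
      let ?y = "real CARD('n) * R * \<eta>"
      have "(\<Sum>p\<in>insert 0 {1..P}. ?y ^ p / fact p) \<le> (\<Sum>p. ?y ^ p / fact p)"
        using R d summable_exp[of ?y]
        by (intro sum_le_suminf) (auto simp: divide_inverse mult.commute)
      also have "\<dots> = exp ?y"
        by (simp add: exp_def divide_inverse mult.commute)
      finally show "(\<Sum>p\<in>{1..P}. ?y ^ p / fact p) \<le> exp ?y - 1" by simp
    qed (use B in simp)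
    finally show ?thesis by (simp add: ac_simps)
  qed
  \<comment> \<open>Bounds the remainder of the series after order \<open>P\<close>, uniformly for arguments of modulus at most \<open>T\<close>.\<close>
  define r where "r P = T ^ Suc P / fact P" for P
  have r: "cmod (exp (\<i> * of_real t) - E P t) \<le> r P" if "\<bar>t\<bar> \<le> T" for P t
  proof -
    have "cmod (exp (\<i> * of_real t) - E P t) \<le> exp \<bar>Re (\<i> * of_real t)\<bar> * (cmod (\<i> * of_real t)) ^ Suc P / fact P"
      unfolding E_def by (rule Taylor_exp)
    also have "\<dots> = \<bar>t\<bar> ^ Suc P / fact P" by (simp add: norm_mult)
    also have "\<dots> \<le> r P"
      unfolding r_def using that by (intro divide_right_mono power_mono) auto
    finally show ?thesis .
  qed
  have "(\<lambda>P. T * (T ^ P / fact P)) \<longlonglongrightarrow> T * 0"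
    using summable_LIMSEQ_zero[OF summable_exp[of T]] by (intro tendsto_intros) (simp add: divide_inverse mult.commute)
  then have r0: "r \<longlonglongrightarrow> 0" by (simp add: r_def[abs_def])
  have vL: "(\<lambda>x. c k * ((exp (\<i> * of_real (d k \<bullet> x)) - E P (d k \<bullet> x)) * v k x)) \<in> L2 ?M"
    and vLe: "L2_norm ?M (\<lambda>x. c k * ((exp (\<i> * of_real (d k \<bullet> x)) - E P (d k \<bullet> x)) * v k x))
       \<le> r P * (cmod (c k) * L2_norm ?M (v k))" if "k \<in> F" for k P
  proof -
    have k: "k \<in> K" using that F by auto
    have m: "(\<lambda>x. exp (\<i> * of_real (d k \<bullet> x)) - E P (d k \<bullet> x)) \<in> borel_measurable ?M"
      unfolding E_def by measurable
    have b: "cmod (exp (\<i> * of_real (d k \<bullet> x)) - E P (d k \<bullet> x)) \<le> r P" if "x \<in> space ?M" for x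
      using that by (intro r T k) simp
    show "(\<lambda>x. c k * ((exp (\<i> * of_real (d k \<bullet> x)) - E P (d k \<bullet> x)) * v k x)) \<in> L2 ?M"
      by (intro L2_scale L2_mult_bounded(1)[OF v[OF k] m b])
    have "\<bar>r P\<bar> = r P" using T0 by (simp add: r_def)
    then show "L2_norm ?M (\<lambda>x. c k * ((exp (\<i> * of_real (d k \<bullet> x)) - E P (d k \<bullet> x)) * v k x))
       \<le> r P * (cmod (c k) * L2_norm ?M (v k))"
      using mult_left_mono[OF L2_mult_bounded(2)[OF v[OF k] m b], of "cmod (c k)"]
      unfolding L2_norm_scale by (simp add: ac_simps)
  qed
  have vL': "(\<lambda>x. \<Sum>k\<in>F. c k * ((E P (d k \<bullet> x) - 1) * v k x)) \<in> L2 ?M" for P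
  proof (rule L2_sum)
    fix k assume "k \<in> F"
    then have k: "k \<in> K" using F by auto
    show "(\<lambda>x. c k * ((E P (d k \<bullet> x) - 1) * v k x)) \<in> L2 ?M"
    proof (intro L2_scale L2_mult_bounded(1)[OF v[OF k]])
      show "(\<lambda>x. E P (d k \<bullet> x) - 1) \<in> borel_measurable ?M"
        unfolding E_def by measurable
      fix x assume "x \<in> space ?M"
      then have "cmod (exp (\<i> * of_real (d k \<bullet> x)) - E P (d k \<bullet> x)) \<le> r P"
        by (intro r T k) simp
      moreover have "cmod (E P (d k \<bullet> x) - 1)
          \<le> cmod (exp (\<i> * of_real (d k \<bullet> x)) - E P (d k \<bullet> x)) + cmod (exp (\<i> * of_real (d k \<bullet> x))) + cmod 1"
        by norm
      ultimately show "cmod (E P (d k \<bullet> x) - 1) \<le> r P + 2" by simp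
    qed
  qed
  have "L2_norm ?M (\<lambda>x. (\<Sum>k\<in>F. c k * (exp (\<i> * of_real (d k \<bullet> x)) * v k x)) - lincomb F c v x)
      \<le> r P * (\<Sum>k\<in>F. cmod (c k) * L2_norm ?M (v k)) + B * (exp (real CARD('n) * R * \<eta>) - 1) * coeff_norm F c" for P
  proof -
    have "(\<Sum>k\<in>F. c k * (exp (\<i> * of_real (d k \<bullet> x)) * v k x)) - lincomb F c v x
       = (\<Sum>k\<in>F. c k * ((exp (\<i> * of_real (d k \<bullet> x)) - E P (d k \<bullet> x)) * v k x))
         + (\<Sum>k\<in>F. c k * ((E P (d k \<bullet> x) - 1) * v k x))" for x
      unfolding sum_subtractf[symmetric] sum.distrib[symmetric]
      by (intro sum.cong refl) (simp add: algebra_simps)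
    then have "L2_norm ?M (\<lambda>x. (\<Sum>k\<in>F. c k * (exp (\<i> * of_real (d k \<bullet> x)) * v k x)) - lincomb F c v x)
      \<le> L2_norm ?M (\<lambda>x. \<Sum>k\<in>F. c k * ((exp (\<i> * of_real (d k \<bullet> x)) - E P (d k \<bullet> x)) * v k x))
        + L2_norm ?M (\<lambda>x. \<Sum>k\<in>F. c k * ((E P (d k \<bullet> x) - 1) * v k x))"
      by (simp only:) (intro L2_norm_triangle L2_sum vL vL')
    also have "L2_norm ?M (\<lambda>x. \<Sum>k\<in>F. c k * ((exp (\<i> * of_real (d k \<bullet> x)) - E P (d k \<bullet> x)) * v k x))
        \<le> (\<Sum>k\<in>F. r P * (cmod (c k) * L2_norm ?M (v k)))"
      using F by (intro order_trans[OF L2_norm_sum_le] sum_mono vL vLe) auto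
    finally show ?thesis
      using main[of P] by (simp add: sum_distrib_left)
  qed
  moreover have "(\<lambda>P. r P * (\<Sum>k\<in>F. cmod (c k) * L2_norm ?M (v k)) + B * (exp (real CARD('n) * R * \<eta>) - 1) * coeff_norm F c)
      \<longlonglongrightarrow> 0 * (\<Sum>k\<in>F. cmod (c k) * L2_norm ?M (v k)) + B * (exp (real CARD('n) * R * \<eta>) - 1) * coeff_norm F c"
    by (intro tendsto_intros r0)
  ultimately show ?thesis
    using LIMSEQ_le_const[of _ _ "L2_norm ?M (\<lambda>x. (\<Sum>k\<in>F. c k * (exp (\<i> * of_real (d k \<bullet> x)) * v k x)) - lincomb F c v x)"]
    by fastforce
qed

lemma riesz_system_exponential_stable:
  fixes S :: "(real^'n) set" and l :: "'k \<Rightarrow> real^'n"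
  assumes S: "bounded S" and v: "riesz_system (lebesgue_on S) K (\<lambda>k. exponential S (l k))"
  shows "\<exists>\<eta>>0. \<forall>l'. (\<forall>k\<in>K. norm (l' k - l k) \<le> \<eta>) \<longrightarrow>
    riesz_system (lebesgue_on S) K (\<lambda>k. exponential S (l' k))"
proof -
  let ?M = "lebesgue_on S"
  obtain A B where A: "A > 0" and bounds: "riesz_bounds ?M K (\<lambda>k. exponential S (l k)) A B"
    and vL: "\<And>k. k \<in> K \<Longrightarrow> exponential S (l k) \<in> L2 ?M"
    and dense: "spans_densely ?M K (\<lambda>k. exponential S (l k))"
    using v by (auto simp: riesz_system_def)
  obtain R where R: "R > 0" "\<And>x. x \<in> S \<Longrightarrow> norm x \<le> R"
    using S by (auto simp: bounded_pos)
  define B' where "B' = \<bar>B\<bar> + 1"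
  have B': "B' > 0" by (simp add: B'_def)
  have bd: "L2_norm ?M (\<lambda>x. \<Sum>k\<in>F. c k * exponential S (l k) x) \<le> B' * coeff_norm F c"
    if "finite F" "F \<subseteq> K" for F c
    using riesz_boundsD(2)[OF bounds that, of c]
    by (rule order_trans) (auto simp: B'_def intro!: mult_right_mono)
  \<comment> \<open>This choice makes the perturbation bound equal to half of the lower Riesz bound.\<close>
  define \<eta> where "\<eta> = ln (1 + A / (2 * B')) / (real CARD('n) * R)"
  have "A / (2 * B') > 0" using A B' by simp
  then have "ln (1 + A / (2 * B')) > 0" by (intro ln_gt_zero) linarith
  then have \<eta>: "\<eta> > 0"
    unfolding \<eta>_def using R by (intro divide_pos_pos mult_pos_pos) auto
  have "B' * (exp (real CARD('n) * R * \<eta>) - 1) = A / 2"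
    using A B' R by (simp add: \<eta>_def add_pos_pos field_simps)
  note half = this
  have "riesz_system ?M K (\<lambda>k. exponential S (l' k))" if l': "\<forall>k\<in>K. norm (l' k - l k) \<le> \<eta>" for l'
  proof (rule riesz_system_perturb[OF vL dense bounds, where \<theta> = "A / 2"])
    have eq: "exponential S (l' k) x = exp (\<i> * of_real ((l' k - l k) \<bullet> x)) * exponential S (l k) x" for k x
      by (simp add: exponential_def exp_add[symmetric] mult_exp_exp inner_diff_left algebra_simps)
    show "exponential S (l' k) \<in> L2 ?M" if "k \<in> K" for k
      unfolding eq
      by (rule L2_mult_bounded(1)[OF vL[OF that], where C = 1])
        (auto intro!: measurable_restrict_space1 measurable_completion)
    show "L2_norm ?M (\<lambda>x. (\<Sum>k\<in>F. c k * exponential S (l' k) x) - (\<Sum>k\<in>F. c k * exponential S (l k) x))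
        \<le> A / 2 * coeff_norm F c" if F: "finite F" "F \<subseteq> K" for F c
      unfolding eq half[symmetric]
      by (rule L2_norm_modulation_le[OF vL bd _ R(2) _ _ _ F]) (use B' R \<eta> l' in auto)
  qed (use A in auto)
  with \<eta> show ?thesis by blast
qed

section \<open>Integration over a cube and closed spans\<close>

text \<open>
  The cubes are taken open so that cubes with separated corners are disjoint and wrapping
  the cube around the torus is injective; the faces are null sets.
\<close>

definition open_cube :: "real \<Rightarrow> (real^'n) set" where
  "open_cube h = {y. \<forall>i. 0 < y $ i \<and> y $ i < h}"

lemma open_cube_eq_box: "open_cube h = box 0 (\<chi> i. h)"
  by (auto simp: open_cube_def mem_box_cart)

lemma lmeasurable_open_cube [simp]: "open_cube h \<in> lmeasurable"
  by (simp add: open_cube_eq_box)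

lemma sets_open_cube [simp]: "open_cube h \<in> sets lebesgue"
  by (simp add: fmeasurableD)

lemma finite_measure_open_cube: "finite_measure (lebesgue_on (open_cube h))"
  by (rule finite_measure_lebesgue_on) simp

lemma integral_exp_interval:
  fixes a h :: real
  assumes "h > 0" and "a * h = 2 * pi * of_int m"
  shows "(LINT t|lborel. indicator {0<..<h} t *\<^sub>R exp (\<i> * complex_of_real (a * t)))
    = (if a = 0 then complex_of_real h else 0)"
    and "integrable lborel (\<lambda>t. indicator {0<..<h} t *\<^sub>R exp (\<i> * complex_of_real (a * t)))"
proof -
  let ?f = "\<lambda>t. exp (\<i> * complex_of_real (a * t))"
  have cont: "continuous_on X ?f" for X
    by (intro continuous_intros)
  have ae: "AE t in lborel. indicator {0..h} t *\<^sub>R ?f t = indicator {0<..<h} t *\<^sub>R ?f t"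
    using AE_lborel_singleton[of 0] AE_lborel_singleton[of h]
    by eventually_elim (auto simp: indicator_def)
  have meas: "(\<lambda>t. indicator A t *\<^sub>R ?f t) \<in> borel_measurable lborel" if "A \<in> sets borel" for A
    using that by measurable
  have int: "integrable lborel (\<lambda>t. indicator {0..h} t *\<^sub>R ?f t)"
    using borel_integrable_compact[of "{0..h}" ?f] cont by (simp add: mult.commute)
  show "integrable lborel (\<lambda>t. indicator {0<..<h} t *\<^sub>R ?f t)"
    using int ae meas by (subst integrable_cong_AE[symmetric, where f = "\<lambda>t. indicator {0..h} t *\<^sub>R ?f t"]) auto
  have "(LINT t|lborel. indicator {0<..<h} t *\<^sub>R ?f t) = (LINT t|lborel. indicator {0..h} t *\<^sub>R ?f t)"
    using ae meas by (intro integral_cong_AE) (auto elim: AE_mp)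
  also have "\<dots> = (if a = 0 then complex_of_real h else 0)"
  proof (cases "a = 0")
    case True
    then show ?thesis using assms(1) by (simp add: scaleR_conv_of_real)
  next
    case False
    let ?F = "\<lambda>t. ?f t / (\<i> * of_real a)"
    have "(LINT t|lborel. indicator {0..h} t *\<^sub>R ?f t) = ?F h - ?F 0"
    proof (rule integral_FTC_atLeastAtMost)
      fix t
      have "((\<lambda>z. exp (\<i> * (of_real a * z)) / (\<i> * of_real a)) has_field_derivative ?f t) (at (of_real t))"
        using False by (auto intro!: derivative_eq_intros simp: field_simps)
      from has_vector_derivative_real_field[OF this, of "{0..h}"]
      show "(?F has_vector_derivative ?f t) (at t within {0..h})"
        by (simp add: o_def)
    qed (use assms(1) cont in auto)
    also have "?f h = 1"
      using assms(2) by (simp add: exp_eq_1)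
    finally show ?thesis using False by simp
  qed
  finally show "(LINT t|lborel. indicator {0<..<h} t *\<^sub>R ?f t) = (if a = 0 then complex_of_real h else 0)" .
qed

text \<open>
  Lebesgue measure is a product measure and the integrand is a product of functions of one
  coordinate each, so one coordinate with \<open>w\<^sub>i \<noteq> 0\<close> makes the integral vanish.
\<close>

lemma integral_exp_open_cube:
  fixes w :: "real^'n"
  assumes "h > 0" and w: "\<And>i. \<exists>m::int. w $ i * h = 2 * pi * of_int m"
  shows "(LINT y|lebesgue_on (open_cube h). exp (\<i> * complex_of_real (w \<bullet> y)))
    = (if w = 0 then complex_of_real h ^ CARD('n) else 0)"
proof -
  interpret product_sigma_finite "\<lambda>_. lborel :: real measure" ..
  define f where "f b t = indicator {0<..<h} t *\<^sub>R exp (\<i> * complex_of_real ((w \<bullet> b) * t))" for b :: "real^'n" and t :: real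
  have wb: "\<exists>m::int. (w \<bullet> b) * h = 2 * pi * of_int m" if b: "b \<in> Basis" for b
  proof -
    obtain i where "b = axis i 1" using b by (auto simp: Basis_vec_def Basis_real_def)
    then show ?thesis using w[of i] by (simp add: inner_axis)
  qed
  have prod: "indicator (open_cube h) y *\<^sub>R exp (\<i> * complex_of_real (w \<bullet> y)) = (\<Prod>b\<in>Basis. f b (y \<bullet> b))" for y
  proof -
    have "indicator (open_cube h) y = (\<Prod>b\<in>(Basis::(real^'n) set). indicator {0<..<h} (y \<bullet> b) :: real)"
    proof (cases "y \<in> open_cube h")
      case True
      then have "\<forall>b\<in>(Basis::(real^'n) set). indicator {0<..<h} (y \<bullet> b) = (1::real)"
        by (auto simp: open_cube_def Basis_vec_def Basis_real_def inner_axis)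
      then show ?thesis using True by simp
    next
      case False
      then obtain i where "y \<bullet> axis i 1 \<notin> {0<..<h}"
        by (auto simp: open_cube_def inner_axis)
      then have "(\<Prod>b\<in>(Basis::(real^'n) set). indicator {0<..<h} (y \<bullet> b) :: real) = 0"
        by (intro prod_zero bexI[of _ "axis i 1"]) auto
      then show ?thesis using False by simp
    qed
    moreover have "exp (\<i> * complex_of_real (w \<bullet> y)) = (\<Prod>b\<in>(Basis::(real^'n) set). exp (\<i> * complex_of_real ((w \<bullet> b) * (y \<bullet> b))))"
      by (subst euclidean_inner) (simp add: exp_sum sum_distrib_left)
    ultimately show ?thesis
      unfolding f_def by (simp add: scaleR_conv_of_real prod.distrib)
  qed
  have meas: "f b \<in> borel_measurable borel" for b
    unfolding f_def by measurable
  have lb: "(lborel :: (real^'n) measure) = distr (\<Pi>\<^sub>M b\<in>Basis. lborel) borel (\<lambda>f. \<Sum>b\<in>Basis. f b *\<^sub>R b)"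
    by (subst lborel_def) (simp add: lborel_eq_real)
  have "(LINT y|lebesgue_on (open_cube h). exp (\<i> * complex_of_real (w \<bullet> y)))
      = (LINT y|lebesgue. (\<Prod>b\<in>Basis. f b (y \<bullet> b)))"
    by (subst integral_restrict_space) (simp_all add: prod)
  also have "\<dots> = (LINT y|lborel. (\<Prod>b\<in>Basis. f b (y \<bullet> b)))"
    by (intro integral_completion borel_measurable_prod measurable_compose[OF _ meas]) simp
  also have "\<dots> = (LINT g|(\<Pi>\<^sub>M b\<in>Basis. lborel). (\<Prod>b\<in>Basis. f b ((\<Sum>b\<in>Basis. g b *\<^sub>R b) \<bullet> b)))"
    by (subst lb, subst integral_distr)
      (auto intro!: borel_measurable_prod measurable_compose[OF _ meas] borel_measurable_sum borel_measurable_scaleR)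
  also have "\<dots> = (LINT g|(\<Pi>\<^sub>M b\<in>(Basis::(real^'n) set). lborel). (\<Prod>b\<in>Basis. f b (g b)))"
    by (intro Bochner_Integration.integral_cong refl prod.cong) simp
  also have "\<dots> = (\<Prod>b\<in>Basis. integral\<^sup>L lborel (f b))"
  proof (intro product_integral_prod)
    fix b :: "real^'n" assume "b \<in> Basis"
    then obtain m :: int where "(w \<bullet> b) * h = 2 * pi * of_int m" using wb by blast
    from integral_exp_interval(2)[OF assms(1) this]
    show "integrable lborel (f b)" unfolding f_def .
  qed simp
  also have "\<dots> = (\<Prod>b\<in>(Basis::(real^'n) set). if w \<bullet> b = 0 then complex_of_real h else 0)"
  proof (rule prod.cong[OF refl])
    fix b :: "real^'n" assume "b \<in> Basis"
    then obtain m :: int where "(w \<bullet> b) * h = 2 * pi * of_int m" using wb by blast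
    from integral_exp_interval(1)[OF assms(1) this]
    show "integral\<^sup>L lborel (f b) = (if w \<bullet> b = 0 then complex_of_real h else 0)"
      unfolding f_def .
  qed
  also have "\<dots> = (if w = 0 then complex_of_real h ^ CARD('n) else 0)"
  proof (cases "w = 0")
    case False
    then obtain b where "b \<in> Basis" "w \<bullet> b \<noteq> 0"
      using euclidean_all_zero_iff by blast
    then show ?thesis using False by auto
  qed simp
  finally show ?thesis .
qed

text \<open>
  Taking both systems equal in the closed graph gives membership in the closed linear span, so
  that closure under linear operations is inherited.
\<close>

definition closed_span :: "'a measure \<Rightarrow> 'k set \<Rightarrow> ('k \<Rightarrow> 'a \<Rightarrow> complex) \<Rightarrow> ('a \<Rightarrow> complex) \<Rightarrow> bool" where
  "closed_span M K v f \<longleftrightarrow> graph_closure M K v v f f"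

lemma spans_densely_iff_closed_span:
  "spans_densely M K v \<longleftrightarrow> (\<forall>f\<in>L2 M. closed_span M K v f)"
  by (auto simp: spans_densely_def closed_span_def graph_closure_def)

lemma closed_span_L2: "closed_span M K v f \<Longrightarrow> f \<in> L2 M"
  by (simp add: closed_span_def graph_closure_def)

lemma closed_span_add:
  assumes "\<And>k. k \<in> K \<Longrightarrow> v k \<in> L2 M" "closed_span M K v f" "closed_span M K v g"
  shows "closed_span M K v (\<lambda>x. f x + g x)"
  using assms(2,3) unfolding closed_span_def
  by (intro graph_closure_add) (simp_all add: assms(1))

lemma closed_span_scale: "closed_span M K v f \<Longrightarrow> closed_span M K v (\<lambda>x. a * f x)"
  unfolding closed_span_def by (rule graph_closure_scale)

lemma closed_span_sum:
  assumes "\<And>k. k \<in> K \<Longrightarrow> v k \<in> L2 M" "finite I" "\<And>i. i \<in> I \<Longrightarrow> closed_span M K v (f i)"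
  shows "closed_span M K v (\<lambda>x. \<Sum>i\<in>I. f i x)"
  using assms(2,3)
proof (induction I rule: finite_induct)
  case empty
  show ?case by (auto simp: closed_span_def graph_closure_def L2_zero intro!: exI[of _ "{}"])
next
  case (insert i I)
  show ?case
    unfolding sum.insert[OF insert(1,2)]
    by (intro closed_span_add[OF assms(1)] insert.IH insert.prems) auto
qed

lemma closed_span_limit:
  assumes v: "\<And>k. k \<in> K \<Longrightarrow> v k \<in> L2 M" and f: "f \<in> L2 M"
    and lim: "\<And>\<delta>. \<delta> > 0 \<Longrightarrow> \<exists>g. closed_span M K v g \<and> L2_norm M (\<lambda>x. f x - g x) < \<delta>"
  shows "closed_span M K v f"
  unfolding closed_span_def graph_closure_def
proof (intro conjI f allI impI)
  fix \<delta> :: real assume "\<delta> > 0"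
  then have "\<delta> / 2 > 0" by simp
  from lim[OF this] obtain g where g: "closed_span M K v g" "L2_norm M (\<lambda>x. f x - g x) < \<delta> / 2"
    by blast
  obtain F c where F: "finite F" "F \<subseteq> K" "L2_norm M (\<lambda>x. g x - lincomb F c v x) < \<delta> / 2"
    using g(1) \<open>\<delta> / 2 > 0\<close> unfolding closed_span_def by (rule graph_closureE)
  have "(lincomb F c v) \<in> L2 M"
    using F v by (intro L2_lincomb) auto
  from L2_norm_triangle_diff[OF f closed_span_L2[OF g(1)] this]
  have "L2_norm M (\<lambda>x. f x - lincomb F c v x) < \<delta>"
    using g(2) F(3) by linarith
  then show "\<exists>F c. finite F \<and> F \<subseteq> K \<and> L2_norm M (\<lambda>x. f x - lincomb F c v x) < \<delta> \<and>
      L2_norm M (\<lambda>x. f x - lincomb F c v x) < \<delta>"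
    using F by blast
qed

lemma closed_span_dominated_limit:
  assumes v: "\<And>k. k \<in> K \<Longrightarrow> v k \<in> L2 M" and f: "f \<in> L2 M"
    and s: "\<And>i. closed_span M K v (s i)"
    and lim: "\<And>x. x \<in> space M \<Longrightarrow> (\<lambda>i. s i x) \<longlonglongrightarrow> f x"
    and bound: "\<And>i x. x \<in> space M \<Longrightarrow> (cmod (f x - s i x))\<^sup>2 \<le> g x" and g: "integrable M g"
  shows "closed_span M K v f"
proof (rule closed_span_limit[OF v f])
  fix \<delta> :: real assume "\<delta> > 0"
  have [measurable]: "f \<in> borel_measurable M" "s i \<in> borel_measurable M" for i
    using f s by (auto dest: L2_measurable closed_span_L2)
  have "(\<lambda>i. LINT x|M. (cmod (f x - s i x))\<^sup>2) \<longlonglongrightarrow> (LINT x|M. 0)"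
  proof (rule integral_dominated_convergence[OF _ _ g])
    show "AE x in M. (\<lambda>i. (cmod (f x - s i x))\<^sup>2) \<longlonglongrightarrow> 0"
    proof (rule AE_I2)
      fix x assume "x \<in> space M"
      then have "(\<lambda>i. (cmod (f x - s i x))\<^sup>2) \<longlonglongrightarrow> (cmod (f x - f x))\<^sup>2"
        by (intro tendsto_intros lim)
      then show "(\<lambda>i. (cmod (f x - s i x))\<^sup>2) \<longlonglongrightarrow> 0" by simp
    qed
    show "AE x in M. norm ((cmod (f x - s i x))\<^sup>2) \<le> g x" for i
      using bound by (intro AE_I2) simp
  qed auto
  then have "(\<lambda>i. sqrt (LINT x|M. (cmod (f x - s i x))\<^sup>2)) \<longlonglongrightarrow> sqrt 0"
    by (intro tendsto_real_sqrt) simp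
  then have "\<forall>\<^sub>F i in sequentially. L2_norm M (\<lambda>x. f x - s i x) < \<delta>"
    unfolding L2_norm_def using \<open>\<delta> > 0\<close> by (intro order_tendstoD) auto
  then obtain i where "L2_norm M (\<lambda>x. f x - s i x) < \<delta>"
    by (auto simp: eventually_sequentially)
  then show "\<exists>g. closed_span M K v g \<and> L2_norm M (\<lambda>x. f x - g x) < \<delta>"
    using s by blast
qed

lemma L2_bounded:
  assumes "finite_measure M" and [measurable]: "f \<in> borel_measurable M"
    and "\<And>x. x \<in> space M \<Longrightarrow> cmod (f x) \<le> C"
  shows "f \<in> L2 M"
proof -
  interpret finite_measure M by fact
  have "(\<lambda>x. 1) \<in> L2 M" by (simp add: L2_def)
  from L2_mult_bounded(1)[OF this assms(2,3)] show ?thesis by simp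
qed

text \<open>
  A square-integrable function is a dominated pointwise limit of simple functions.
\<close>

lemma spans_densely_if_indicators:
  assumes v: "\<And>k. k \<in> K \<Longrightarrow> v k \<in> L2 M"
    and ind: "\<And>A. A \<in> sets M \<Longrightarrow> closed_span M K v (indicator A)"
  shows "spans_densely M K v"
  unfolding spans_densely_iff_closed_span
proof
  fix f assume f: "f \<in> L2 M"
  then have [measurable]: "f \<in> borel_measurable M" by (rule L2_measurable)
  obtain s where s: "\<And>i. simple_function M (s i)"
    and lim: "\<And>x. x \<in> space M \<Longrightarrow> (\<lambda>i. s i x) \<longlonglongrightarrow> f x"
    and le: "\<And>i x. x \<in> space M \<Longrightarrow> norm (s i x) \<le> 2 * norm (f x)"
    using borel_measurable_implies_sequence_metric[of f M 0]
    by (simp add: dist_norm) blast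
  have cs: "closed_span M K v (s i)" for i
  proof -
    have cst: "closed_span M K v (\<lambda>x. \<Sum>y\<in>s i ` space M. y * indicator (s i -` {y} \<inter> space M) x)"
    proof (rule closed_span_sum[OF v])
      show "finite (s i ` space M)" using s[of i] by (rule simple_functionD)
      show "closed_span M K v (\<lambda>x. y * indicator (s i -` {y} \<inter> space M) x)" for y
        by (rule closed_span_scale, rule ind, rule simple_functionD(2)[OF s])
    qed
    have eq: "s i x = (\<Sum>y\<in>s i ` space M. y * indicator (s i -` {y} \<inter> space M) x)"
      if "x \<in> space M" for x
    proof -
      have "(\<Sum>y\<in>s i ` space M. y * indicator (s i -` {y} \<inter> space M) x)
          = (\<Sum>y\<in>s i ` space M. if y = s i x then y else 0)"
        using that by (intro sum.cong) (auto simp: indicator_def)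
      also have "\<dots> = s i x"
        using s[of i] that by (simp add: sum.delta simple_functionD)
      finally show ?thesis by simp
    qed
    show ?thesis
    proof (rule closed_span_limit[OF v])
      have [measurable]: "s i \<in> borel_measurable M"
        using s[of i] by (rule borel_measurable_simple_function)
      have "integrable M (\<lambda>x. 4 * (cmod (f x))\<^sup>2)"
        using L2_integrable[OF f] by simp
      then have "integrable M (\<lambda>x. (cmod (s i x))\<^sup>2)"
        by (rule Bochner_Integration.integrable_bound)
          (use power_mono[OF le[of _ i], of _ 2] in \<open>auto intro!: AE_I2 simp: power_mult_distrib\<close>)
      then show "s i \<in> L2 M" by (simp add: L2_def)
      fix \<delta> :: real assume "\<delta> > 0"
      let ?t = "\<lambda>x. \<Sum>y\<in>s i ` space M. y * indicator (s i -` {y} \<inter> space M) x"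
      have zero: "s i x - ?t x = 0" if "x \<in> space M" for x
        unfolding eq[OF that, symmetric] by simp
      have "L2_norm M (\<lambda>x. s i x - ?t x) = L2_norm M (\<lambda>x. 0)"
        unfolding L2_norm_def
        by (intro arg_cong[of _ _ sqrt] Bochner_Integration.integral_cong refl) (simp only: zero)
      then show "\<exists>g. closed_span M K v g \<and> L2_norm M (\<lambda>x. s i x - g x) < \<delta>"
        using \<open>\<delta> > 0\<close> cst by (intro exI[of _ ?t] conjI) simp_all
    qed
  qed
  show "closed_span M K v f"
  proof (rule closed_span_dominated_limit[OF v f cs lim])
    fix i x assume "x \<in> space M"
    have "cmod (f x - s i x) \<le> 3 * cmod (f x)"
      using norm_triangle_ineq4[of "f x" "s i x"] le[OF \<open>x \<in> space M\<close>, of i] by linarith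
    then have "(cmod (f x - s i x))\<^sup>2 \<le> (3 * cmod (f x))\<^sup>2"
      by (rule power_mono) simp
    then show "(cmod (f x - s i x))\<^sup>2 \<le> 9 * (cmod (f x))\<^sup>2"
      by (simp add: power_mult_distrib)
  qed (use L2_integrable[OF f] in auto)
qed

section \<open>Completeness of the Fourier system on a cube\<close>

lemma zero_integer_lattice [simp]: "0 \<in> integer_lattice"
  by (simp add: integer_lattice_def)

lemma add_integer_lattice: "z \<in> integer_lattice \<Longrightarrow> w \<in> integer_lattice \<Longrightarrow> z + w \<in> integer_lattice"
  by (simp add: integer_lattice_def)

lemma axis_integer_lattice: "a \<in> \<int> \<Longrightarrow> axis i a \<in> integer_lattice"
  by (simp add: integer_lattice_def axis_def)

definition cube_wave :: "real \<Rightarrow> real^'n \<Rightarrow> real^'n \<Rightarrow> complex" where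
  "cube_wave h z y = exp (\<i> * complex_of_real (2 * pi / h * (z \<bullet> y)))"

lemma cube_wave_add: "cube_wave h (z + w) y = cube_wave h z y * cube_wave h w y"
  by (simp add: cube_wave_def inner_add_left distrib_left exp_add)

lemma measurable_cube_wave [measurable]: "cube_wave h z \<in> borel_measurable (lebesgue_on S)"
  unfolding cube_wave_def
  by (intro measurable_restrict_space1 measurable_completion) simp

lemma norm_cube_wave [simp]: "cmod (cube_wave h z y) = 1"
  by (simp add: cube_wave_def)

lemma L2_cube_wave: "cube_wave h z \<in> L2 (lebesgue_on (open_cube h'))"
  by (rule L2_bounded[OF finite_measure_open_cube, where C = 1]) auto

inductive trig_polynomial :: "real \<Rightarrow> (real^'n \<Rightarrow> complex) \<Rightarrow> bool" for h where
  monomial: "z \<in> integer_lattice \<Longrightarrow> trig_polynomial h (\<lambda>y. c * cube_wave h z y)"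
| add: "trig_polynomial h f \<Longrightarrow> trig_polynomial h g \<Longrightarrow> trig_polynomial h (\<lambda>y. f y + g y)"

lemma trig_polynomial_const: "trig_polynomial h (\<lambda>y. c)"
  using trig_polynomial.monomial[of 0 h c] by (simp add: cube_wave_def)

lemma trig_polynomial_mult:
  assumes "trig_polynomial h f" "trig_polynomial h g"
  shows "trig_polynomial h (\<lambda>y. f y * g y)"
  using assms(1)
proof induction
  case (monomial z c)
  show ?case using assms(2)
  proof induction
    case (monomial w d)
    show ?case
      using trig_polynomial.monomial[of "z + w" h "c * d"] monomial.hyps \<open>z \<in> integer_lattice\<close>
      by (simp add: add_integer_lattice cube_wave_add mult.assoc mult.left_commute)
  next
    case (add f g)
    then show ?case using trig_polynomial.add[OF add.IH] by (simp add: distrib_left)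
  qed
next
  case (add f' g')
  then show ?case using trig_polynomial.add[OF add.IH] by (simp add: distrib_right)
qed

lemma trig_polynomial_sum:
  assumes "finite I" "\<And>i. i \<in> I \<Longrightarrow> trig_polynomial h (f i)"
  shows "trig_polynomial h (\<lambda>y. \<Sum>i\<in>I. f i y)"
  using assms
proof (induction I rule: finite_induct)
  case empty
  show ?case by (simp add: trig_polynomial_const)
next
  case (insert i I)
  show ?case
    unfolding sum.insert[OF insert(1,2)]
    by (intro trig_polynomial.add insert.IH insert.prems) auto
qed

lemma closed_span_trig_polynomial:
  assumes "trig_polynomial h f"
  shows "closed_span (lebesgue_on (open_cube h')) integer_lattice (cube_wave h) f"
  using assms
proof induction
  case (monomial z c)
  then show ?case
    by (intro closed_span_scale) (simp add: closed_span_def graph_closure_basis L2_cube_wave)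
next
  case (add f g)
  then show ?case by (intro closed_span_add L2_cube_wave)
qed

text \<open>
  The wrapping of the cube around the torus turns trigonometric polynomials into polynomials
  in the real and imaginary parts of the coordinates, to which the Stone--Weierstrass theorem
  applies.
\<close>

definition torus_map :: "real \<Rightarrow> real^'n \<Rightarrow> complex^'n" where
  "torus_map h y = (\<chi> i. exp (\<i> * complex_of_real (2 * pi / h * y $ i)))"

lemma continuous_on_torus_map: "continuous_on X (torus_map h)"
  unfolding torus_map_def by (intro continuous_intros)

lemma inj_on_torus_map:
  assumes "h > 0"
  shows "inj_on (torus_map h) (open_cube h)"
proof (rule inj_onI)
  fix x y :: "real^'n"
  assume x: "x \<in> open_cube h" and y: "y \<in> open_cube h" and eq: "torus_map h x = torus_map h y"
  have "x $ i = y $ i" for i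
  proof -
    have "exp (\<i> * complex_of_real (2 * pi / h * x $ i)) = exp (\<i> * complex_of_real (2 * pi / h * y $ i))"
      using arg_cong[OF eq, of "\<lambda>v. v $ i"] by (simp add: torus_map_def)
    then obtain n :: int where "\<i> * complex_of_real (2 * pi / h * x $ i)
        = \<i> * complex_of_real (2 * pi / h * y $ i) + (of_int (2 * n) * pi) * \<i>"
      unfolding exp_eq by blast
    then have "Im (\<i> * complex_of_real (2 * pi / h * x $ i))
        = Im (\<i> * complex_of_real (2 * pi / h * y $ i) + (of_int (2 * n) * pi) * \<i>)"
      by (rule arg_cong)
    then have "2 * pi / h * x $ i = 2 * pi / h * y $ i + 2 * of_int n * pi"
      by simp
    then have "2 * pi * (x $ i - y $ i) = 2 * pi * (h * of_int n)"
      using assms by (simp add: field_simps)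
    then have n: "x $ i - y $ i = h * of_int n"
      by simp
    have "\<bar>x $ i - y $ i\<bar> < h"
      using x y unfolding open_cube_def by (smt (verit) mem_Collect_eq)
    then have "h * \<bar>of_int n :: real\<bar> < h * 1"
      using assms unfolding n by (simp add: abs_mult)
    then have "\<bar>of_int n :: real\<bar> < 1"
      using assms by simp
    then have "n = 0" by linarith
    then show ?thesis using n by simp
  qed
  then show "x = y" by (simp add: vec_eq_iff)
qed

lemma trig_polynomial_torus_coordinate:
  fixes b :: "complex^'n"
  assumes "b \<in> Basis"
  shows "trig_polynomial h (\<lambda>y. complex_of_real (torus_map h y \<bullet> b))"
proof -
  obtain i u where b: "b = axis i u" "u \<in> (Basis :: complex set)"
    using assms by (auto simp: Basis_vec_def)
  have w: "cube_wave h (axis i a) y = exp (\<i> * complex_of_real (2 * pi / h * (a * y $ i)))" for a and y :: "real^'n"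
    by (simp add: cube_wave_def inner_axis')
  have p: "trig_polynomial h (\<lambda>y. c * cube_wave h (axis i 1) y + d * cube_wave h (axis i (-1)) y)" for c d
    by (intro trig_polynomial.intros axis_integer_lattice) auto
  from b(2) consider "u = 1" | "u = \<i>" by (auto simp: Basis_complex_def)
  then show ?thesis
  proof cases
    case 1
    have "complex_of_real (torus_map h y \<bullet> b)
        = (1 / 2) * cube_wave h (axis i 1) y + (1 / 2) * cube_wave h (axis i (-1)) y" for y :: "real^'n"
    proof -
      have "torus_map h y \<bullet> b = Re (exp (\<i> * complex_of_real (2 * pi / h * y $ i)))"
        using 1 b(1) by (simp add: torus_map_def inner_axis inner_complex_def)
      also have "\<dots> = cos (2 * pi / h * y $ i)"
        by (simp only: cis_conv_exp[symmetric] cis.simps)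
      finally have "complex_of_real (torus_map h y \<bullet> b) = cos (complex_of_real (2 * pi / h * y $ i))"
        by (simp only: cos_of_real)
      then show ?thesis by (simp add: cos_exp_eq w add_divide_distrib)
    qed
    then show ?thesis using p[of "1/2" "1/2"] by simp
  next
    case 2
    have "complex_of_real (torus_map h y \<bullet> b)
        = (1 / (2 * \<i>)) * cube_wave h (axis i 1) y + (- 1 / (2 * \<i>)) * cube_wave h (axis i (-1)) y" for y :: "real^'n"
    proof -
      have "torus_map h y \<bullet> b = Im (exp (\<i> * complex_of_real (2 * pi / h * y $ i)))"
        using 2 b(1) by (simp add: torus_map_def inner_axis inner_complex_def)
      also have "\<dots> = sin (2 * pi / h * y $ i)"
        by (simp only: cis_conv_exp[symmetric] cis.simps)
      finally have "complex_of_real (torus_map h y \<bullet> b) = sin (complex_of_real (2 * pi / h * y $ i))"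
        by (simp only: sin_of_real)
      then show ?thesis by (simp add: sin_exp_eq w diff_divide_distrib right_diff_distrib)
    qed
    then show ?thesis using p[of "1 / (2 * \<i>)" "- 1 / (2 * \<i>)"] by simp
  qed
qed

lemma trig_polynomial_real_polynomial:
  fixes p :: "complex^'n \<Rightarrow> real"
  assumes "real_polynomial_function p"
  shows "trig_polynomial h (\<lambda>y. complex_of_real (p (torus_map h y)))"
  using assms
proof induction
  case (linear f)
  then interpret bounded_linear f .
  have "complex_of_real (f (torus_map h y))
      = (\<Sum>b\<in>Basis. complex_of_real (f b) * complex_of_real (torus_map h y \<bullet> b))" for y :: "real^'n"
  proof -
    have "f (torus_map h y) = f (\<Sum>b\<in>Basis. (torus_map h y \<bullet> b) *\<^sub>R b)"
      by (simp add: euclidean_representation)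
    also have "\<dots> = (\<Sum>b\<in>Basis. f b * (torus_map h y \<bullet> b))"
      by (simp add: sum scaleR mult.commute)
    finally show ?thesis by simp
  qed
  then show ?case
    by (simp only:) (intro trig_polynomial_sum trig_polynomial_mult trig_polynomial_const
        trig_polynomial_torus_coordinate finite_Basis)
next
  case (const c)
  show ?case by (rule trig_polynomial_const)
next
  case (add f g)
  then show ?case using trig_polynomial.add[OF add.IH] by simp
next
  case (mult f g)
  then show ?case using trig_polynomial_mult[OF mult.IH] by simp
qed

text \<open>
  By the Stone--Weierstrass theorem on the compact image of the closed cube, the function is a
  uniform limit of trigonometric polynomials.
\<close>

lemma closed_span_continuous_torus:
  fixes g :: "complex^'n \<Rightarrow> real"
  assumes g: "continuous_on UNIV g"
  shows "closed_span (lebesgue_on (open_cube h)) integer_lattice (cube_wave h)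
    (\<lambda>y. complex_of_real (g (torus_map h y)))"
proof -
  let ?M = "lebesgue_on (open_cube h :: (real^'n) set)"
  define T where "T = torus_map h ` cbox (0 :: real^'n) (\<chi> i. h)"
  have T: "compact T"
    unfolding T_def by (intro compact_continuous_image continuous_on_torus_map compact_cbox)
  have sub: "torus_map h y \<in> T" if "y \<in> open_cube h" for y :: "real^'n"
    using that by (auto simp: T_def open_cube_def mem_box_cart less_imp_le)
  have gT: "continuous_on T g" by (rule continuous_on_subset[OF g]) simp
  then have "bounded (g ` T)"
    using T by (intro compact_imp_bounded compact_continuous_image)
  then obtain C where C: "\<And>w. w \<in> T \<Longrightarrow> \<bar>g w\<bar> \<le> C"
    by (auto simp: bounded_iff)
  have "continuous_on UNIV (\<lambda>y::real^'n. g (torus_map h y))"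
    by (rule continuous_on_compose2[OF g continuous_on_torus_map]) simp
  then have "(\<lambda>y::real^'n. g (torus_map h y)) \<in> borel_measurable borel"
    by (rule borel_measurable_continuous_onI)
  then have m: "(\<lambda>y::real^'n. complex_of_real (g (torus_map h y))) \<in> borel_measurable ?M"
    by (intro measurable_restrict_space1 measurable_completion) simp
  have "\<exists>p. real_polynomial_function p \<and> (\<forall>w\<in>T. \<bar>g w - p w\<bar> < inverse (real (Suc i)))" for i :: nat
  proof -
    have "inverse (real (Suc i)) > 0" by simp
    from Stone_Weierstrass_real_polynomial_function[OF T gT this] show ?thesis by metis
  qed
  then obtain p where p: "\<And>i. real_polynomial_function (p i)"
    "\<And>i w. w \<in> T \<Longrightarrow> \<bar>g w - p i w\<bar> < inverse (real (Suc i))" for i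
    by metis
  have err: "cmod (complex_of_real (g (torus_map h y)) - complex_of_real (p i (torus_map h y))) \<le> inverse (real (Suc i))"
    if "y \<in> open_cube h" for y i
    using p(2)[OF sub[OF that], of i] by (simp only: of_real_diff[symmetric] norm_of_real less_imp_le)
  show ?thesis
  proof (rule closed_span_dominated_limit[where g = "\<lambda>_. 1"])
    show "(\<lambda>y. complex_of_real (g (torus_map h y))) \<in> L2 ?M"
      by (rule L2_bounded[OF finite_measure_open_cube m, where C = C]) (auto intro: C sub)
    show "closed_span ?M integer_lattice (cube_wave h) (\<lambda>y. complex_of_real (p i (torus_map h y)))" for i
      by (intro closed_span_trig_polynomial trig_polynomial_real_polynomial p)
    show "(\<lambda>i. complex_of_real (p i (torus_map h y))) \<longlonglongrightarrow> complex_of_real (g (torus_map h y))"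
      if "y \<in> space ?M" for y
    proof (rule LIM_zero_cancel, rule tendsto_norm_zero_cancel, rule Lim_null_comparison)
      show "\<forall>\<^sub>F i in sequentially. norm (norm (complex_of_real (p i (torus_map h y)) - complex_of_real (g (torus_map h y))))
          \<le> inverse (real (Suc i))"
        using err[of y] that by (subst norm_minus_commute) simp
    qed (rule LIMSEQ_inverse_real_of_nat)
    show "(cmod (complex_of_real (g (torus_map h y)) - complex_of_real (p i (torus_map h y))))\<^sup>2 \<le> 1"
      if "y \<in> space ?M" for i y
    proof -
      have "inverse (real (Suc i)) \<le> 1" by (simp add: inverse_le_1_iff)
      then show ?thesis
        using order_trans[OF err[of y i]] that by (intro power_le_one) auto
    qed
    show "integrable ?M (\<lambda>_. 1 :: real)"
      using finite_measure.integrable_const[OF finite_measure_open_cube] .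
  qed (rule L2_cube_wave)
qed

text \<open>
  Let \<open>D\<close> be the image of \<open>C\<close> on the torus. The tent functions \<open>max 0 (1 - i dist(\<cdot>, D))\<close>
  decrease to the indicator of the closed set \<open>D\<close>, which pulls back to that of \<open>C\<close> because the
  wrapping map is injective on the open cube.
\<close>

lemma closed_span_indicator_compact:
  fixes C :: "(real^'n) set"
  assumes h: "h > 0" and C: "compact C" "C \<subseteq> open_cube h"
  shows "closed_span (lebesgue_on (open_cube h)) integer_lattice (cube_wave h) (indicator C)"
proof (cases "C = {}")
  case True
  then have "indicator C = (\<lambda>y::real^'n. 0 :: complex)" by auto
  then show ?thesis
    using closed_span_trig_polynomial[OF trig_polynomial_const[of h 0]] by metis
next
  case False
  let ?M = "lebesgue_on (open_cube h :: (real^'n) set)"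
  define D where "D = torus_map h ` C"
  have D: "closed D" "D \<noteq> {}"
    unfolding D_def using C False
    by (auto intro!: compact_imp_closed compact_continuous_image continuous_on_torus_map)
  define s where "s i w = max 0 (1 - real i * infdist w D)" for i w
  have s01: "0 \<le> s i w" "s i w \<le> 1" for i w
    by (auto simp: s_def infdist_nonneg)
  have Cm: "C \<in> sets lebesgue" using C by (auto intro: lmeasurable_compact fmeasurableD)
  have im: "(indicator C :: _ \<Rightarrow> complex) \<in> borel_measurable ?M"
    using Cm by (intro measurable_restrict_space1 borel_measurable_indicator)
  show ?thesis
  proof (rule closed_span_dominated_limit[where g = "\<lambda>_. 1"])
    show "indicator C \<in> L2 ?M"
      by (rule L2_bounded[OF finite_measure_open_cube im, where C = 1]) (simp add: indicator_def)
    show "closed_span ?M integer_lattice (cube_wave h) (\<lambda>y. complex_of_real (s i (torus_map h y)))" for i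
      unfolding s_def by (intro closed_span_continuous_torus continuous_intros continuous_on_infdist)
    show "(\<lambda>i. complex_of_real (s i (torus_map h y))) \<longlonglongrightarrow> indicator C y"
      if "y \<in> space ?M" for y
    proof (cases "y \<in> C")
      case True
      then have "infdist (torus_map h y) D = 0"
        by (simp add: D_def)
      then show ?thesis using True by (simp add: s_def)
    next
      case False
      have "torus_map h y \<notin> D"
        using False that C(2) inj_on_torus_map[OF h] unfolding D_def
        by (auto dest: inj_onD)
      then have pos: "infdist (torus_map h y) D > 0"
        using D by (simp add: infdist_pos_not_in_closed)
      obtain N where N: "1 < real N * infdist (torus_map h y) D"
        using reals_Archimedean3[OF pos] by blast
      have "s i (torus_map h y) = 0" if "i \<ge> N" for i
      proof -
        have "real N * infdist (torus_map h y) D \<le> real i * infdist (torus_map h y) D"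
          using that pos by (intro mult_right_mono) auto
        then show ?thesis using N by (simp add: s_def)
      qed
      then have "\<forall>\<^sub>F i in sequentially. complex_of_real (s i (torus_map h y)) = indicator C y"
        using False by (auto simp: eventually_sequentially)
      then show ?thesis by (rule tendsto_eventually)
    qed
    show "(cmod (indicator C y - complex_of_real (s i (torus_map h y))))\<^sup>2 \<le> 1"
      if "y \<in> space ?M" for i y
    proof (rule power_le_one)
      have "\<bar>indicator C y - s i (torus_map h y)\<bar> \<le> 1"
        using s01[of i "torus_map h y"] by (auto simp: indicator_def)
      then show "cmod (indicator C y - complex_of_real (s i (torus_map h y))) \<le> 1"
        by (metis of_real_indicator of_real_diff norm_of_real)
    qed simp
    show "integrable ?M (\<lambda>_. 1 :: real)"
      using finite_measure.integrable_const[OF finite_measure_open_cube] .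
  qed (rule L2_cube_wave)
qed

text \<open>
  Inner regularity of Lebesgue measure approximates the set by a compact subset.
\<close>

lemma closed_span_indicator:
  fixes A :: "(real^'n) set"
  assumes h: "h > 0" and A: "A \<in> sets (lebesgue_on (open_cube h))"
  shows "closed_span (lebesgue_on (open_cube h)) integer_lattice (cube_wave h) (indicator A)"
proof (rule closed_span_limit)
  let ?M = "lebesgue_on (open_cube h :: (real^'n) set)"
  have Asub: "A \<subseteq> open_cube h"
    using sets.sets_into_space[OF A] by simp
  have Am: "A \<in> sets lebesgue"
    using A sets_restrict_space_iff[of "open_cube h" lebesgue A] by simp
  have im: "(indicator A :: _ \<Rightarrow> complex) \<in> borel_measurable ?M"
    using Am by (intro measurable_restrict_space1 borel_measurable_indicator)
  show "indicator A \<in> L2 ?M"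
    by (rule L2_bounded[OF finite_measure_open_cube im, where C = 1]) (simp add: indicator_def)
  fix \<delta> :: real assume "\<delta> > 0"
  then have "\<delta>\<^sup>2 > 0" by simp
  obtain C where C: "closed C" "C \<subseteq> A"
    "A - C \<in> lmeasurable" "emeasure lebesgue (A - C) < ennreal (\<delta>\<^sup>2)"
    by (rule sets_lebesgue_inner_closed[OF Am \<open>\<delta>\<^sup>2 > 0\<close>])
  have "bounded (open_cube h :: (real^'n) set)"
    unfolding open_cube_eq_box by (rule bounded_box)
  then have "compact C"
    using C Asub by (meson bounded_subset compact_eq_bounded_closed order_trans)
  then have "closed_span ?M integer_lattice (cube_wave h) (indicator C)"
    using C Asub by (intro closed_span_indicator_compact h) auto
  moreover have "L2_norm ?M (\<lambda>y. indicator A y - indicator C y) < \<delta>"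
  proof -
    have "(LINT y|?M. (cmod (indicator A y - indicator C y))\<^sup>2) = (LINT y|?M. indicator (A - C) y)"
      using C(2) by (intro Bochner_Integration.integral_cong) (auto simp: indicator_def)
    also have "\<dots> = measure ?M (A - C)"
      using Asub by (simp add: Int_absorb1 subset_iff Int_absorb2 Diff_subset)
    also have "\<dots> = measure lebesgue (A - C)"
      using Asub by (intro measure_restrict_space) auto
    also have "\<dots> < \<delta>\<^sup>2"
      using C(3,4) \<open>\<delta>\<^sup>2 > 0\<close> by (simp add: emeasure_eq_measure2 ennreal_less_iff)
    finally show ?thesis
      unfolding L2_norm_def using \<open>\<delta> > 0\<close> by (simp add: real_less_lsqrt)
  qed
  ultimately show "\<exists>g. closed_span ?M integer_lattice (cube_wave h) g \<and> L2_norm ?M (\<lambda>y. indicator A y - g y) < \<delta>"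
    by blast
qed (rule L2_cube_wave)

lemma spans_densely_cube_wave:
  "h > 0 \<Longrightarrow> spans_densely (lebesgue_on (open_cube h)) integer_lattice (cube_wave h)"
  by (intro spans_densely_if_indicators L2_cube_wave closed_span_indicator)

section \<open>Finite unions of cubes\<close>

lemma integral_translation:
  fixes f :: "real^'n \<Rightarrow> 'b::{banach, second_countable_topology}"
  assumes f: "f \<in> borel_measurable lebesgue"
  shows "(\<lambda>y. f (p + y)) \<in> borel_measurable lebesgue"
    and "integrable lebesgue (\<lambda>y. f (p + y)) \<longleftrightarrow> integrable lebesgue f"
    and "(LINT y|lebesgue. f (p + y)) = (LINT x|lebesgue. f x)"
proof -
  have T: "(\<lambda>x::real^'n. p + (\<Sum>j\<in>Basis. (1 * (x \<bullet> j)) *\<^sub>R j)) = (+) p"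
    by (simp add: euclidean_representation)
  have m: "(+) p \<in> lebesgue \<rightarrow>\<^sub>M lebesgue"
    using lebesgue_affine_measurable[of "\<lambda>_. 1" p] unfolding T by simp
  have d: "distr lebesgue lebesgue ((+) p) = lebesgue"
    using lebesgue_affine_euclidean[of "\<lambda>_. 1" p] unfolding T by (simp add: density_1)
  show "(\<lambda>y. f (p + y)) \<in> borel_measurable lebesgue"
    using measurable_compose[OF m f] .
  show "integrable lebesgue (\<lambda>y. f (p + y)) \<longleftrightarrow> integrable lebesgue f"
    using integrable_distr_eq[OF m f] unfolding d by simp
  show "(LINT y|lebesgue. f (p + y)) = (LINT x|lebesgue. f x)"
    using integral_distr[OF m f] unfolding d by simp
qed

text \<open>
  The elements of \<open>P\<close> are the lower corners of cubes of side \<open>h\<close>; separated corners make the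
  open cubes disjoint.
\<close>

definition cube_tiles :: "real \<Rightarrow> (real^'n) set \<Rightarrow> bool" where
  "cube_tiles h P \<longleftrightarrow> h > 0 \<and> finite P \<and> (\<forall>p\<in>P. \<forall>q\<in>P. p \<noteq> q \<longrightarrow> (\<exists>i. h \<le> \<bar>p $ i - q $ i\<bar>))"

definition cube_union :: "real \<Rightarrow> (real^'n) set \<Rightarrow> (real^'n) set" where
  "cube_union h P = (\<Union>p\<in>P. {x. \<forall>i. p $ i \<le> x $ i \<and> x $ i \<le> p $ i + h})"

lemma cube_union_eq_cbox: "cube_union h P = (\<Union>p\<in>P. cbox p (p + (\<chi> i. h)))"
  by (auto simp: cube_union_def mem_box_cart)

lemma lmeasurable_cube_union: "finite P \<Longrightarrow> cube_union h P \<in> lmeasurable"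
  unfolding cube_union_eq_cbox by (intro fmeasurable.finite_UN) auto

lemma sets_cube_union: "finite P \<Longrightarrow> cube_union h P \<in> sets lebesgue"
  by (intro fmeasurableD lmeasurable_cube_union)

lemma bounded_cube_union: "finite P \<Longrightarrow> bounded (cube_union h P)"
  unfolding cube_union_eq_cbox by (intro bounded_UN) auto

lemma open_cube_in_cube_union: "p \<in> P \<Longrightarrow> y \<in> open_cube h \<Longrightarrow> p + y \<in> cube_union h P"
  unfolding cube_union_def by (rule UN_I) (auto simp: open_cube_def less_imp_le)

text \<open>
  Away from the finitely many hyperplanes that contain the faces, a point of the union lies in
  exactly one of the open cubes.
\<close>

lemma AE_indicator_cube_union:
  fixes P :: "(real^'n) set"
  assumes "cube_tiles h P"
  shows "AE x in lebesgue. indicator (cube_union h P) x = (\<Sum>p\<in>P. indicator (open_cube h) (x - p) :: real)"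
proof -
  have P: "finite P" "h > 0" and sep: "\<And>p q. p \<in> P \<Longrightarrow> q \<in> P \<Longrightarrow> p \<noteq> q \<Longrightarrow> \<exists>i. h \<le> \<bar>p $ i - q $ i\<bar>"
    using assms by (auto simp: cube_tiles_def)
  define N where "N = (\<Union>p\<in>P. \<Union>i. {x::real^'n. x $ i = p $ i} \<union> {x. x $ i = p $ i + h})"
  have "negligible {x::real^'n. x $ i = a}" for i a
    using negligible_standard_hyperplane[of "axis i 1 :: real^'n" a] by (simp add: inner_axis axis_in_Basis_iff)
  then have "negligible N"
    unfolding N_def using P(1)
    by (auto intro!: negligible_Union negligible_Un)
  then have "N \<in> null_sets lebesgue" by (simp add: negligible_iff_null_sets)
  then have "AE x in lebesgue. x \<notin> N" by (rule AE_not_in)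
  then show ?thesis
  proof eventually_elim
    case (elim x)
    show ?case
    proof (cases "x \<in> cube_union h P")
      case True
      then obtain p where p: "p \<in> P" "\<And>i. p $ i \<le> x $ i" "\<And>i. x $ i \<le> p $ i + h"
        by (auto simp: cube_union_def)
      have in_p: "x - p \<in> open_cube h"
        using p elim unfolding open_cube_def N_def
        by (auto simp: less_le algebra_simps)
      have notin: "x - q \<notin> open_cube h" if q: "q \<in> P" "q \<noteq> p" for q
      proof
        assume "x - q \<in> open_cube h"
        obtain i where i: "h \<le> \<bar>q $ i - p $ i\<bar>" using sep[OF q(1) p(1) q(2)] by blast
        have "0 < (x - q) $ i" "(x - q) $ i < h" "0 < (x - p) $ i" "(x - p) $ i < h"
          using in_p \<open>x - q \<in> open_cube h\<close> by (auto simp: open_cube_def)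
        then show False using i by auto
      qed
      have "(\<Sum>q\<in>P. indicator (open_cube h) (x - q) :: real) = (\<Sum>q\<in>P. if q = p then 1 else 0)"
        using in_p notin by (intro sum.cong) auto
      then show ?thesis using True P p(1) by simp
    next
      case False
      then have "x - p \<notin> open_cube h" if "p \<in> P" for p
        using open_cube_in_cube_union[OF that, of "x - p" h] by auto
      then show ?thesis using False by simp
    qed
  qed
qed

lemma measurable_on_cube:
  fixes f :: "real^'n \<Rightarrow> 'b::{banach, second_countable_topology}"
  assumes P: "cube_tiles h P" "p \<in> P" and f: "f \<in> borel_measurable (lebesgue_on (cube_union h P))"
  shows "(\<lambda>y. f (p + y)) \<in> borel_measurable (lebesgue_on (open_cube h))"
proof -
  have fin: "finite P" using P by (simp add: cube_tiles_def)
  let ?f = "\<lambda>x. indicator (cube_union h P) x *\<^sub>R f x"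
  have "?f \<in> borel_measurable lebesgue"
    using f borel_measurable_restrict_space_iff[of "cube_union h P" lebesgue f] sets_cube_union[OF fin, of h]
    by simp
  then have "(\<lambda>y. ?f (p + y)) \<in> borel_measurable lebesgue"
    by (rule integral_translation(1))
  then have "(\<lambda>y. ?f (p + y)) \<in> borel_measurable (lebesgue_on (open_cube h))"
    by (rule measurable_restrict_space1)
  then show ?thesis
    by (rule measurable_cong[THEN iffD1, rotated]) (simp add: open_cube_in_cube_union[OF P(2)])
qed

lemma integral_cube_union:
  fixes f :: "real^'n \<Rightarrow> 'b::{banach, second_countable_topology}"
  assumes P: "cube_tiles h P" and f: "integrable (lebesgue_on (cube_union h P)) f"
  shows "p \<in> P \<Longrightarrow> integrable (lebesgue_on (open_cube h)) (\<lambda>y. f (p + y))"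
    and "(LINT x|lebesgue_on (cube_union h P). f x)
       = (\<Sum>p\<in>P. LINT y|lebesgue_on (open_cube h). f (p + y))"
proof -
  let ?S = "cube_union h P" and ?Q = "open_cube h :: (real^'n) set"
  have fin: "finite P" using P by (simp add: cube_tiles_def)
  have S: "?S \<in> sets lebesgue" by (rule sets_cube_union[OF fin])
  define f' where "f' x = indicator ?S x *\<^sub>R f x" for x
  have f': "integrable lebesgue f'"
    using f integrable_restrict_space[of ?S lebesgue f] S by (simp add: f'_def[abs_def])
  then have f'm: "f' \<in> borel_measurable lebesgue" by simp
  have eq: "indicator ?Q y *\<^sub>R f (p + y) = indicator ?Q y *\<^sub>R f' (p + y)" if "p \<in> P" for p y
    using open_cube_in_cube_union[OF that, of y h] by (auto simp: f'_def indicator_def)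
  have int: "integrable lebesgue (\<lambda>y. indicator ?Q y *\<^sub>R f' (p + y))" for p
    using f' integral_translation(2)[OF f'm] by (intro integrable_mult_indicator) auto
  then show "integrable (lebesgue_on ?Q) (\<lambda>y. f (p + y))" if "p \<in> P" for p
    using that by (simp add: integrable_restrict_space eq)
  have gm: "(\<lambda>x. indicator ?Q (x - p) *\<^sub>R f' x) \<in> borel_measurable lebesgue" for p
    using integral_translation(1)[of "\<lambda>y. indicator ?Q y *\<^sub>R f' (p + y)" "- p"] int[of p] by simp
  have gi: "integrable lebesgue (\<lambda>x. indicator ?Q (x - p) *\<^sub>R f' x)" for p
    using integral_translation(2)[OF gm[of p], of p] int[of p] by simp
  have "(LINT x|lebesgue_on ?S. f x) = (LINT x|lebesgue. f' x)"
    using S by (simp add: integral_restrict_space f'_def[abs_def])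
  also have "\<dots> = (LINT x|lebesgue. (\<Sum>p\<in>P. indicator ?Q (x - p) *\<^sub>R f' x))"
  proof (rule integral_cong_AE[OF f'm])
    show "AE x in lebesgue. f' x = (\<Sum>p\<in>P. indicator ?Q (x - p) *\<^sub>R f' x)"
      using AE_indicator_cube_union[OF P]
    proof eventually_elim
      case (elim x)
      have "f' x = indicator ?S x *\<^sub>R f' x" by (simp add: f'_def indicator_def)
      then show ?case unfolding elim scaleR_sum_left[symmetric] by simp
    qed
  qed (intro borel_measurable_sum gm)
  also have "\<dots> = (\<Sum>p\<in>P. (LINT x|lebesgue. indicator ?Q (x - p) *\<^sub>R f' x))"
    by (intro Bochner_Integration.integral_sum gi)
  also have "\<dots> = (\<Sum>p\<in>P. (LINT y|lebesgue. indicator ?Q y *\<^sub>R f' (p + y)))"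
    using integral_translation(3)[OF gm] by (intro sum.cong refl) (metis (no_types, lifting) add_diff_cancel_left' Bochner_Integration.integral_cong)
  also have "\<dots> = (\<Sum>p\<in>P. (LINT y|lebesgue_on ?Q. f (p + y)))"
    by (intro sum.cong refl) (simp add: integral_restrict_space eq)
  finally show "(LINT x|lebesgue_on ?S. f x) = (\<Sum>p\<in>P. (LINT y|lebesgue_on ?Q. f (p + y)))" .
qed

lemma L2_cube_union:
  assumes P: "cube_tiles h P" and f: "f \<in> L2 (lebesgue_on (cube_union h P))"
  shows "p \<in> P \<Longrightarrow> (\<lambda>y. f (p + y)) \<in> L2 (lebesgue_on (open_cube h))"
    and "(L2_norm (lebesgue_on (cube_union h P)) f)\<^sup>2
       = (\<Sum>p\<in>P. (L2_norm (lebesgue_on (open_cube h)) (\<lambda>y. f (p + y)))\<^sup>2)"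
  using integral_cube_union[OF P L2_integrable[OF f]] measurable_on_cube[OF P _ L2_measurable[OF f]]
  by (simp_all add: L2_norm_power2 L2_def)

lemma integrable_L2_inner:
  assumes "f \<in> L2 M" "g \<in> L2 M"
  shows "integrable M (\<lambda>x. f x * cnj (g x))"
proof -
  have [measurable]: "f \<in> borel_measurable M" "g \<in> borel_measurable M"
    using assms by (auto dest: L2_measurable)
  have "cnj \<in> borel_measurable borel"
    by (intro borel_measurable_continuous_onI continuous_intros)
  then have [measurable]: "(\<lambda>x. cnj (g x)) \<in> borel_measurable M"
    by (rule measurable_compose[rotated]) simp
  have "integrable M (\<lambda>x. (cmod (f x))\<^sup>2 + (cmod (g x))\<^sup>2)"
    using assms by (intro Bochner_Integration.integrable_add L2_integrable)
  then show ?thesis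
  proof (rule Bochner_Integration.integrable_bound)
    show "AE x in M. norm (f x * cnj (g x)) \<le> norm ((cmod (f x))\<^sup>2 + (cmod (g x))\<^sup>2)"
    proof (rule AE_I2)
      fix x
      have "cmod (f x) * cmod (g x) \<le> (cmod (f x))\<^sup>2 + (cmod (g x))\<^sup>2"
        using zero_le_power2[of "cmod (f x) - cmod (g x)"] zero_le_power2[of "cmod (f x) + cmod (g x)"]
        unfolding power2_diff power2_sum by linarith
      then show "norm (f x * cnj (g x)) \<le> norm ((cmod (f x))\<^sup>2 + (cmod (g x))\<^sup>2)"
        by (simp add: norm_mult)
    qed
  qed simp
qed

lemma L2_norm_orthogonal_sum:
  assumes F: "finite F" and g: "\<And>k. k \<in> F \<Longrightarrow> g k \<in> L2 M"
    and orth: "\<And>k l. k \<in> F \<Longrightarrow> l \<in> F \<Longrightarrow> L2_inner M (g k) (g l) = (if k = l then complex_of_real \<kappa> else 0)"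
  shows "(L2_norm M (lincomb F c g))\<^sup>2 = \<kappa> * (coeff_norm F c)\<^sup>2"
proof -
  have sq: "complex_of_real ((cmod (\<Sum>k\<in>F. c k * g k x))\<^sup>2)
      = (\<Sum>k\<in>F. \<Sum>l\<in>F. (c k * cnj (c l)) * (g k x * cnj (g l x)))" for x
    by (simp add: complex_norm_square sum_product cnj_sum ac_simps del: of_real_power)
  have "complex_of_real ((L2_norm M (lincomb F c g))\<^sup>2)
      = (LINT x|M. complex_of_real ((cmod (\<Sum>k\<in>F. c k * g k x))\<^sup>2))"
    by (simp only: L2_norm_power2 integral_complex_of_real)
  also have "\<dots> = (\<Sum>k\<in>F. \<Sum>l\<in>F. (c k * cnj (c l)) * L2_inner M (g k) (g l))"
    unfolding sq L2_inner_def
    by (subst Bochner_Integration.integral_sum, intro Bochner_Integration.integrable_sum integrable_mult_right integrable_L2_inner g, assumption, assumption)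
      (intro sum.cong refl, subst Bochner_Integration.integral_sum, intro integrable_mult_right integrable_L2_inner g, simp_all)
  also have "\<dots> = (\<Sum>k\<in>F. \<Sum>l\<in>F. if l = k then (c k * cnj (c l)) * complex_of_real \<kappa> else 0)"
    by (intro sum.cong refl) (auto simp: orth)
  also have "\<dots> = (\<Sum>k\<in>F. complex_of_real (\<kappa> * (cmod (c k))\<^sup>2))"
    using F by (intro sum.cong refl) (simp add: complex_norm_square del: of_real_power)
  also have "\<dots> = complex_of_real (\<kappa> * (coeff_norm F c)\<^sup>2)"
    by (simp only: of_real_sum[symmetric] coeff_norm_power2 sum_distrib_left)
  finally show ?thesis
    by (simp only: of_real_eq_iff)
qed

section \<open>Reduction to one cube and a matrix\<close>

lemma L2_norm_lincomb_le:
  assumes "finite I" "\<And>i. i \<in> I \<Longrightarrow> f i \<in> L2 M" "\<And>i. i \<in> I \<Longrightarrow> L2_norm M (f i) \<le> D"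
    and "D \<ge> 0" "(\<Sum>i\<in>I. cmod (a i)) \<le> C"
  shows "L2_norm M (\<lambda>x. \<Sum>i\<in>I. a i * f i x) \<le> C * D"
proof -
  have "L2_norm M (\<lambda>x. \<Sum>i\<in>I. a i * f i x) \<le> (\<Sum>i\<in>I. L2_norm M (\<lambda>x. a i * f i x))"
    using assms by (intro L2_norm_sum_le L2_scale) auto
  also have "\<dots> \<le> (\<Sum>i\<in>I. cmod (a i) * D)"
    unfolding L2_norm_scale using assms by (intro sum_mono mult_left_mono) auto
  also have "\<dots> \<le> C * D"
    unfolding sum_distrib_right[symmetric] using assms by (intro mult_right_mono) auto
  finally show ?thesis .
qed

definition inverse_matrices :: "'r set \<Rightarrow> 'p set \<Rightarrow> ('r \<Rightarrow> 'p \<Rightarrow> complex) \<Rightarrow> ('p \<Rightarrow> 'r \<Rightarrow> complex) \<Rightarrow> bool" where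
  "inverse_matrices R P m w \<longleftrightarrow>
    (\<forall>r\<in>R. \<forall>s\<in>R. (\<Sum>p\<in>P. m r p * w p s) = (if r = s then 1 else 0)) \<and>
    (\<forall>p\<in>P. \<forall>q\<in>P. (\<Sum>r\<in>R. w q r * m r p) = (if p = q then 1 else 0))"

text \<open>
  Group a finite combination of the \<open>b\<^sub>k\<close> by the value \<open>r = \<rho> k\<close>. On the cube at \<open>p\<close> it becomes
  \<open>\<Sum>\<^sub>r m r p G\<^sub>r\<close>, where \<open>G\<^sub>r\<close> is a combination of the orthogonal system of class \<open>r\<close> and does
  not depend on \<open>p\<close>. Thus the family of restrictions to the cubes is the image of the family
  \<open>(G\<^sub>r)\<close> under a constant matrix. The matrix bounds it from above, its inverse bounds it from
  below, and to approximate \<open>f\<close> one applies the inverse to the restrictions of \<open>f\<close> and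
  approximates the results class by class.
\<close>

lemma riesz_system_cube_union:
  fixes b g :: "'k \<Rightarrow> real^'n \<Rightarrow> complex" and \<rho> :: "'k \<Rightarrow> 'r" and m :: "'r \<Rightarrow> real^'n \<Rightarrow> complex"
  assumes P: "cube_tiles h P" and R: "finite R" "\<rho> ` Z \<subseteq> R" and \<kappa>: "\<kappa> > 0"
    and g: "\<And>k. k \<in> Z \<Longrightarrow> g k \<in> L2 (lebesgue_on (open_cube h))"
    and orth: "\<And>k l. k \<in> Z \<Longrightarrow> l \<in> Z \<Longrightarrow> \<rho> k = \<rho> l \<Longrightarrow>
      L2_inner (lebesgue_on (open_cube h)) (g k) (g l) = (if k = l then complex_of_real \<kappa> else 0)"
    and dense: "\<And>r. r \<in> R \<Longrightarrow> spans_densely (lebesgue_on (open_cube h)) {k\<in>Z. \<rho> k = r} g"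
    and inv: "inverse_matrices R P m w"
    and b: "\<And>k. k \<in> Z \<Longrightarrow> b k \<in> L2 (lebesgue_on (cube_union h P))"
    and bg: "\<And>k p y. k \<in> Z \<Longrightarrow> p \<in> P \<Longrightarrow> y \<in> open_cube h \<Longrightarrow> b k (p + y) = m (\<rho> k) p * g k y"
  shows "riesz_system (lebesgue_on (cube_union h P)) Z b"
proof -
  let ?S = "lebesgue_on (cube_union h P)" and ?Q = "lebesgue_on (open_cube h :: (real^'n) set)"
  have finP: "finite P" using P by (simp add: cube_tiles_def)
  have left_inv: "(\<Sum>p\<in>P. m r p * w p s) = (if r = s then 1 else 0)" if "r \<in> R" "s \<in> R" for r s
    using inv that by (simp add: inverse_matrices_def)
  have right_inv: "(\<Sum>r\<in>R. w q r * m r p) = (if p = q then 1 else 0)" if "p \<in> P" "q \<in> P" for p q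
    using inv that by (simp add: inverse_matrices_def)
  define G where "G F c r y = (\<Sum>k\<in>{k\<in>F. \<rho> k = r}. c k * g k y)" for F c r y
  have GL: "G F c r \<in> L2 ?Q" if "F \<subseteq> Z" for F c r
    unfolding G_def using that g by (intro L2_lincomb) auto
  have Gnorm: "(L2_norm ?Q (G F c r))\<^sup>2 = \<kappa> * (coeff_norm {k\<in>F. \<rho> k = r} c)\<^sup>2"
    if "finite F" "F \<subseteq> Z" for F c r
    unfolding G_def
  proof (rule L2_norm_orthogonal_sum)
    fix k l assume "k \<in> {k\<in>F. \<rho> k = r}" "l \<in> {k\<in>F. \<rho> k = r}"
    then show "L2_inner ?Q (g k) (g l) = (if k = l then complex_of_real \<kappa> else 0)"
      using that by (intro orth) auto
  qed (use that g in auto)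
  have on_cube: "lincomb F c b (p + y) = (\<Sum>r\<in>R. m r p * G F c r y)"
    if "finite F" "F \<subseteq> Z" "p \<in> P" "y \<in> open_cube h" for F c p y
  proof -
    have "(\<Sum>r\<in>R. m r p * G F c r y) = (\<Sum>r\<in>R. \<Sum>k\<in>{k\<in>F. \<rho> k = r}. c k * b k (p + y))"
      unfolding G_def sum_distrib_left using that
      by (intro sum.cong refl) (auto simp: bg subset_iff)
    also have "\<dots> = lincomb F c b (p + y)"
      using that R by (intro sum.group) auto
    finally show ?thesis by simp
  qed
  define \<mu> where "\<mu> = (\<Sum>p\<in>P. \<Sum>r\<in>R. cmod (m r p))"
  define \<omega> where "\<omega> = (\<Sum>r\<in>R. \<Sum>p\<in>P. cmod (w p r))"
  have \<mu>: "(\<Sum>r\<in>R. cmod (m r p)) \<le> \<mu>" if "p \<in> P" for p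
    unfolding \<mu>_def using that finP
    by (intro member_le_sum[where f = "\<lambda>p. \<Sum>r\<in>R. cmod (m r p)"] sum_nonneg) auto
  have \<omega>: "(\<Sum>p\<in>P. cmod (w p r)) \<le> \<omega>" if "r \<in> R" for r
    unfolding \<omega>_def using that R
    by (intro member_le_sum[where f = "\<lambda>r. \<Sum>p\<in>P. cmod (w p r)"] sum_nonneg) auto
  have \<mu>0: "\<mu> \<ge> 0" and \<omega>0: "\<omega> \<ge> 0"
    by (auto simp: \<mu>_def \<omega>_def intro!: sum_nonneg)
  have card_sq: "real n \<le> (real n + 1)\<^sup>2" for n :: nat
    by (simp add: power2_eq_square algebra_simps)
  have cong: "L2_norm ?Q u = L2_norm ?Q v" if "\<And>y. y \<in> open_cube h \<Longrightarrow> u y = v y" for u v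
    unfolding L2_norm_def using that
    by (intro arg_cong[of _ _ sqrt] Bochner_Integration.integral_cong) auto
  have piece_le: "L2_norm ?Q (\<lambda>y. f (p + y)) \<le> L2_norm ?S f" if "f \<in> L2 ?S" "p \<in> P" for f p
  proof (rule power2_le_imp_le)
    show "(L2_norm ?Q (\<lambda>y. f (p + y)))\<^sup>2 \<le> (L2_norm ?S f)\<^sup>2"
      unfolding L2_cube_union(2)[OF P that(1)] using finP that(2)
      by (intro member_le_sum[where f = "\<lambda>p. (L2_norm ?Q (\<lambda>y. f (p + y)))\<^sup>2"]) auto
  qed simp
  have le_pieces: "L2_norm ?S f \<le> (real (card P) + 1) * D"
    if f: "f \<in> L2 ?S" and D: "D \<ge> 0" "\<And>p. p \<in> P \<Longrightarrow> L2_norm ?Q (\<lambda>y. f (p + y)) \<le> D" for f D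
  proof (rule power2_le_imp_le)
    have "(L2_norm ?S f)\<^sup>2 \<le> (\<Sum>p\<in>P. D\<^sup>2)"
      unfolding L2_cube_union(2)[OF P f] using D by (intro sum_mono power_mono) auto
    also have "\<dots> \<le> (real (card P) + 1)\<^sup>2 * D\<^sup>2"
      by (simp add: mult_right_mono[OF card_sq] del: mult_le_cancel_right mult_le_cancel_right2)
    finally show "(L2_norm ?S f)\<^sup>2 \<le> ((real (card P) + 1) * D)\<^sup>2"
      by (simp add: power_mult_distrib)
  qed (use D in simp)
  have bF: "(lincomb F c b) \<in> L2 ?S" if "F \<subseteq> Z" for F c
    using that b by (intro L2_lincomb) auto

  have upper: "L2_norm ?S (lincomb F c b) \<le> ((real (card P) + 1) * (\<mu> * sqrt \<kappa>)) * coeff_norm F c"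
    if F: "finite F" "F \<subseteq> Z" for F c
  proof -
    have G_le: "L2_norm ?Q (G F c r) \<le> sqrt \<kappa> * coeff_norm F c" for r
    proof (rule power2_le_imp_le)
      have "(coeff_norm {k\<in>F. \<rho> k = r} c)\<^sup>2 \<le> (coeff_norm F c)\<^sup>2"
        unfolding coeff_norm_power2 using F by (intro sum_mono2) auto
      then show "(L2_norm ?Q (G F c r))\<^sup>2 \<le> (sqrt \<kappa> * coeff_norm F c)\<^sup>2"
        using Gnorm[OF F, of c r] \<kappa> by (simp add: power_mult_distrib mult_left_mono)
    qed (use \<kappa> in simp)
    have "L2_norm ?Q (\<lambda>y. \<Sum>k\<in>F. c k * b k (p + y)) \<le> \<mu> * (sqrt \<kappa> * coeff_norm F c)" if "p \<in> P" for p
    proof -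
      have "L2_norm ?Q (\<lambda>y. \<Sum>k\<in>F. c k * b k (p + y)) = L2_norm ?Q (\<lambda>y. \<Sum>r\<in>R. m r p * G F c r y)"
        by (intro cong on_cube F that)
      also have "\<dots> \<le> \<mu> * (sqrt \<kappa> * coeff_norm F c)"
        using G_le GL[OF F(2)] \<kappa> R \<mu>[OF that] by (intro L2_norm_lincomb_le) auto
      finally show ?thesis .
    qed
    then have "L2_norm ?S (lincomb F c b) \<le> (real (card P) + 1) * (\<mu> * (sqrt \<kappa> * coeff_norm F c))"
      using \<mu>0 \<kappa> by (intro le_pieces bF F) auto
    then show ?thesis by (simp add: mult.assoc)
  qed

  have lower: "(sqrt \<kappa> / ((real (card R) + 1) * (\<omega> + 1))) * coeff_norm F c \<le> L2_norm ?S (lincomb F c b)"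
    if F: "finite F" "F \<subseteq> Z" for F c
  proof -
    define L where "L = L2_norm ?S (lincomb F c b)"
    have L0: "L \<ge> 0" by (simp add: L_def)
    have G_le: "L2_norm ?Q (G F c r) \<le> (\<omega> + 1) * L" if r: "r \<in> R" for r
    proof -
      have "G F c r y = (\<Sum>p\<in>P. w p r * lincomb F c b (p + y))" if y: "y \<in> open_cube h" for y
      proof -
        have "(\<Sum>p\<in>P. w p r * lincomb F c b (p + y)) = (\<Sum>p\<in>P. \<Sum>s\<in>R. (m s p * w p r) * G F c s y)"
          using F y by (intro sum.cong refl) (simp add: on_cube sum_distrib_left ac_simps)
        also have "\<dots> = (\<Sum>s\<in>R. (\<Sum>p\<in>P. m s p * w p r) * G F c s y)"
          by (subst sum.swap) (simp add: sum_distrib_right)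
        also have "\<dots> = (\<Sum>s\<in>R. if s = r then G F c s y else 0)"
          using r by (intro sum.cong refl) (simp add: left_inv)
        also have "\<dots> = G F c r y" using r R by simp
        finally show ?thesis by simp
      qed
      then have "L2_norm ?Q (G F c r) = L2_norm ?Q (\<lambda>y. \<Sum>p\<in>P. w p r * lincomb F c b (p + y))"
        by (intro cong)
      also have "\<dots> \<le> (\<omega> + 1) * L"
        using finP L0 \<omega>[OF r]
        by (intro L2_norm_lincomb_le) (auto simp: L_def intro!: L2_cube_union(1)[OF P bF[OF F(2)]] piece_le bF[OF F(2)])
      finally show ?thesis .
    qed
    have "(sqrt \<kappa> * coeff_norm F c)\<^sup>2 = (\<Sum>r\<in>R. (L2_norm ?Q (G F c r))\<^sup>2)"
    proof -
      have "(\<Sum>r\<in>R. (coeff_norm {k\<in>F. \<rho> k = r} c)\<^sup>2) = (coeff_norm F c)\<^sup>2"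
        unfolding coeff_norm_power2 using F R by (intro sum.group) auto
      then show ?thesis
        using \<kappa> by (simp add: Gnorm[OF F] power_mult_distrib sum_distrib_left[symmetric])
    qed
    also have "\<dots> \<le> (\<Sum>r\<in>R. ((\<omega> + 1) * L)\<^sup>2)"
      using G_le by (intro sum_mono power_mono) auto
    also have "\<dots> \<le> (real (card R) + 1)\<^sup>2 * ((\<omega> + 1) * L)\<^sup>2"
      by (simp add: mult_right_mono[OF card_sq] del: mult_le_cancel_right mult_le_cancel_right2)
    finally have "(sqrt \<kappa> * coeff_norm F c)\<^sup>2 \<le> ((real (card R) + 1) * ((\<omega> + 1) * L))\<^sup>2"
      by (simp add: power_mult_distrib)
    then have "sqrt \<kappa> * coeff_norm F c \<le> (real (card R) + 1) * ((\<omega> + 1) * L)"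
      by (rule power2_le_imp_le) (use \<omega>0 L0 in simp)
    then show ?thesis
      using \<omega>0 unfolding L_def[symmetric] by (simp add: divide_simps add_nonneg_pos) (simp add: algebra_simps)
  qed

  have "spans_densely ?S Z b"
    unfolding spans_densely_def
  proof (intro ballI allI impI)
    fix f and \<delta> :: real assume f: "f \<in> L2 ?S" and "\<delta> > 0"
    define \<eta> where "\<eta> = \<delta> / (2 * ((real (card P) + 1) * (\<mu> + 1)))"
    have \<eta>: "\<eta> > 0"
      unfolding \<eta>_def using \<open>\<delta> > 0\<close> \<mu>0 by (intro divide_pos_pos mult_pos_pos) auto
    define u where "u r y = (\<Sum>p\<in>P. w p r * f (p + y))" for r y
    have uL: "u r \<in> L2 ?Q" for r
      unfolding u_def by (intro L2_lincomb L2_cube_union(1)[OF P f])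
    have "\<exists>Fc. finite (fst Fc) \<and> fst Fc \<subseteq> {k\<in>Z. \<rho> k = r} \<and>
        L2_norm ?Q (\<lambda>y. u r y - lincomb (fst Fc) (snd Fc) g y) < \<eta>" if r: "r \<in> R" for r
    proof -
      obtain F c where "finite F" "F \<subseteq> {k\<in>Z. \<rho> k = r}" "L2_norm ?Q (\<lambda>y. u r y - lincomb F c g y) < \<eta>"
        using spans_denselyE[OF dense[OF r] uL[of r] \<eta>] by blast
      then show ?thesis by (intro exI[of _ "(F, c)"]) simp
    qed
    then have "\<exists>Fc. \<forall>r\<in>R. finite (fst (Fc r)) \<and> fst (Fc r) \<subseteq> {k\<in>Z. \<rho> k = r} \<and>
        L2_norm ?Q (\<lambda>y. u r y - lincomb (fst (Fc r)) (snd (Fc r)) g y) < \<eta>"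
      by (intro bchoice ballI)
    then obtain Fc where Fc: "\<forall>r\<in>R. finite (fst (Fc r)) \<and> fst (Fc r) \<subseteq> {k\<in>Z. \<rho> k = r} \<and>
        L2_norm ?Q (\<lambda>y. u r y - lincomb (fst (Fc r)) (snd (Fc r)) g y) < \<eta>"
      by (rule exE)
    define F c where "F r = fst (Fc r)" and "c r = snd (Fc r)" for r
    have F: "\<And>r. r \<in> R \<Longrightarrow> finite (F r)" "\<And>r. r \<in> R \<Longrightarrow> F r \<subseteq> {k\<in>Z. \<rho> k = r}"
      and app: "\<And>r. r \<in> R \<Longrightarrow> L2_norm ?Q (\<lambda>y. u r y - lincomb (F r) (c r) g y) < \<eta>"
      using Fc by (auto simp: F_def c_def)
    define E d where "E = (\<Union>r\<in>R. F r)" and "d k = c (\<rho> k) k" for k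
    have E: "finite E" "E \<subseteq> Z" using F R by (auto simp: E_def)
    have Er: "{k\<in>E. \<rho> k = r} = F r" if "r \<in> R" for r
      using F(2) that by (auto simp: E_def)
    have GE: "G E d r y = lincomb (F r) (c r) g y" if "r \<in> R" for r y
      unfolding G_def Er[OF that] d_def using F(2)[OF that] by (intro sum.cong) auto
    have "L2_norm ?Q (\<lambda>y. f (p + y) - lincomb E d b (p + y)) \<le> (\<mu> + 1) * \<eta>" if p: "p \<in> P" for p
    proof -
      have "f (p + y) - lincomb E d b (p + y) = (\<Sum>r\<in>R. m r p * (u r y - G E d r y))"
        if y: "y \<in> open_cube h" for y
      proof -
        have "(\<Sum>r\<in>R. m r p * u r y) = (\<Sum>r\<in>R. \<Sum>q\<in>P. (w q r * m r p) * f (q + y))"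
          unfolding u_def by (simp add: sum_distrib_left ac_simps)
        also have "\<dots> = (\<Sum>q\<in>P. (\<Sum>r\<in>R. w q r * m r p) * f (q + y))"
          by (subst sum.swap) (simp add: sum_distrib_right)
        also have "\<dots> = (\<Sum>q\<in>P. if q = p then f (q + y) else 0)"
          using p by (intro sum.cong refl) (auto simp: right_inv)
        also have "\<dots> = f (p + y)" using p finP by simp
        finally show ?thesis
          using on_cube[OF E p y, of d] by (simp add: right_diff_distrib sum_subtractf)
      qed
      then have "L2_norm ?Q (\<lambda>y. f (p + y) - lincomb E d b (p + y))
          = L2_norm ?Q (\<lambda>y. \<Sum>r\<in>R. m r p * (u r y - G E d r y))"
        by (intro cong)
      also have "\<dots> \<le> (\<mu> + 1) * \<eta>"
      proof (rule L2_norm_lincomb_le[OF R(1)])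
        show "(\<lambda>y. u r y - G E d r y) \<in> L2 ?Q" for r by (intro L2_diff uL GL E)
        show "L2_norm ?Q (\<lambda>y. u r y - G E d r y) \<le> \<eta>" if "r \<in> R" for r
          using app[OF that] by (simp add: GE[OF that])
      qed (use \<eta> \<mu>[OF p] in auto)
      finally show ?thesis .
    qed
    then have "L2_norm ?S (\<lambda>x. f x - lincomb E d b x) \<le> (real (card P) + 1) * ((\<mu> + 1) * \<eta>)"
      using \<eta> \<mu>0 by (intro le_pieces L2_diff f bF E) auto
    also have "\<dots> = ((real (card P) + 1) * (\<mu> + 1)) * \<eta>"
      by (simp only: mult.assoc)
    also have "\<dots> = \<delta> / 2"
    proof -
      have "t * (\<delta> / (2 * t)) = \<delta> / 2" if "t > 0" for t
        using that by simp
      then show ?thesis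
        unfolding \<eta>_def using \<mu>0 by (meson add_nonneg_pos mult_pos_pos of_nat_0_le_iff zero_less_one)
    qed
    also have "\<dots> < \<delta>" using \<open>\<delta> > 0\<close> by simp
    finally show "\<exists>F c. finite F \<and> F \<subseteq> Z \<and> L2_norm ?S (\<lambda>x. f x - lincomb F c b x) < \<delta>"
      using E by blast
  qed
  moreover have "sqrt \<kappa> / ((real (card R) + 1) * (\<omega> + 1)) > 0"
    using \<kappa> \<omega>0 by (intro divide_pos_pos mult_pos_pos) auto
  ultimately show ?thesis
    unfolding riesz_system_def riesz_bounds_def using b upper lower by blast
qed

section \<open>Exponentials and residue classes\<close>

definition wave :: "real^'n \<Rightarrow> real^'n \<Rightarrow> complex" where
  "wave l y = exp (\<i> * complex_of_real (l \<bullet> y))"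

lemma measurable_wave [measurable]: "wave l \<in> borel_measurable (lebesgue_on S)"
  unfolding wave_def by (intro measurable_restrict_space1 measurable_completion) simp

lemma norm_wave [simp]: "cmod (wave l y) = 1"
  by (simp add: wave_def)

lemma cnj_wave_mult_wave [simp]: "cnj (wave l y) * wave l y = 1"
  by (metis complex_norm_square mult.commute norm_wave of_real_1 one_power2)

lemma cnj_wave: "cnj (wave l y) = wave (- l) y"
  by (simp add: wave_def exp_cnj)

lemma wave_add: "wave (l + k) y = wave l y * wave k y"
  by (simp add: wave_def inner_add_left distrib_left exp_add)

lemma wave_add_arg: "wave l (x + y) = wave l x * wave l y"
  by (simp add: wave_def inner_add_right distrib_left exp_add)

lemma wave_eq_1: "l \<bullet> y = 2 * pi * of_int m \<Longrightarrow> wave l y = 1"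
  by (simp add: wave_def exp_eq_1)

lemma exponential_eq_wave: "exponential S l x = wave l x * indicator S x"
  by (simp add: exponential_def wave_def)

lemma L2_exponential:
  assumes S: "S \<in> lmeasurable"
  shows "exponential S l \<in> L2 (lebesgue_on S)"
proof (rule L2_bounded[where C = 1])
  show "finite_measure (lebesgue_on S)" using S by (rule finite_measure_lebesgue_on)
  have "(indicator S :: _ \<Rightarrow> complex) \<in> borel_measurable (lebesgue_on S)"
    using S by (intro measurable_restrict_space1 borel_measurable_indicator) auto
  then show "exponential S l \<in> borel_measurable (lebesgue_on S)"
    unfolding exponential_eq_wave by measurable
qed (simp add: exponential_eq_wave norm_mult indicator_def)

text \<open>
  Multiplication by a function of modulus \<open>1\<close> is an isometry of \<open>L\<^sup>2\<close> onto itself.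
\<close>

lemma spans_densely_modulate:
  assumes e: "spans_densely M K e" and [measurable]: "u \<in> borel_measurable M"
    and u: "\<And>x. x \<in> space M \<Longrightarrow> cmod (u x) = 1" and \<phi>: "bij_betw \<phi> K K'"
    and v: "\<And>k x. k \<in> K \<Longrightarrow> x \<in> space M \<Longrightarrow> v (\<phi> k) x = u x * e k x"
  shows "spans_densely M K' v"
  unfolding spans_densely_def
proof (intro ballI allI impI)
  fix f and \<delta> :: real assume f: "f \<in> L2 M" and "\<delta> > 0"
  have "cnj \<in> borel_measurable borel"
    by (intro borel_measurable_continuous_onI continuous_intros)
  then have "(\<lambda>x. cnj (u x)) \<in> borel_measurable M"
    by (rule measurable_compose[rotated]) simp
  then have "(\<lambda>x. cnj (u x) * f x) \<in> L2 M"
    by (rule L2_mult_bounded(1)[OF f, where C = 1]) (simp add: u)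
  from spans_denselyE[OF e this \<open>\<delta> > 0\<close>] obtain F c where F: "finite F" "F \<subseteq> K"
    and lt: "L2_norm M (\<lambda>x. cnj (u x) * f x - lincomb F c e x) < \<delta>"
    by blast
  define d where "d k = c (inv_into K \<phi> k)" for k
  have inj: "inj_on \<phi> F"
    using \<phi> F(2) by (auto simp: bij_betw_def intro: inj_on_subset)
  have d: "d (\<phi> k) = c k" if "k \<in> F" for k
    using that F(2) \<phi> by (auto simp: d_def bij_betw_def)
  have "cmod (f x - lincomb (\<phi> ` F) d v x) = cmod (cnj (u x) * f x - lincomb F c e x)"
    if x: "x \<in> space M" for x
  proof -
    have uu: "u x * cnj (u x) = 1"
      using u[OF x] by (metis complex_norm_square of_real_1 one_power2)
    have "lincomb (\<phi> ` F) d v x = (\<Sum>k\<in>F. c k * (u x * e k x))"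
      unfolding sum.reindex[OF inj] o_def using F(2) x by (intro sum.cong refl) (auto simp: d v)
    then have "f x - lincomb (\<phi> ` F) d v x = (u x * cnj (u x)) * f x - (\<Sum>k\<in>F. c k * (u x * e k x))"
      by (simp only: uu mult_1)
    also have "\<dots> = u x * (cnj (u x) * f x - lincomb F c e x)"
      by (simp add: right_diff_distrib sum_distrib_left ac_simps)
    finally show ?thesis by (simp add: norm_mult u[OF x])
  qed
  then have "L2_norm M (\<lambda>x. f x - lincomb (\<phi> ` F) d v x) < \<delta>"
    using lt unfolding L2_norm_def by (simp cong: Bochner_Integration.integral_cong)
  then show "\<exists>F c. finite F \<and> F \<subseteq> K' \<and> L2_norm M (\<lambda>x. f x - lincomb F c v x) < \<delta>"
    using F \<phi> by (intro exI[of _ "\<phi> ` F"] exI[of _ d]) (auto simp: bij_betw_def)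
qed

definition residue :: "nat \<Rightarrow> real^'n \<Rightarrow> real^'n" where
  "residue N z = (\<chi> i. of_int (\<lfloor>z $ i\<rfloor> mod int N))"

definition residues :: "nat \<Rightarrow> (real^'n) set" where
  "residues N = {r \<in> integer_lattice. \<forall>i. 0 \<le> r $ i \<and> r $ i < real N}"

lemma residue_in_residues: "N > 0 \<Longrightarrow> residue N z \<in> residues N"
  by (auto simp: residue_def residues_def integer_lattice_def)
    (metis of_int_less_iff of_int_of_nat_eq of_nat_0_less_iff pos_mod_bound)

lemma residue_of_residues: "r \<in> residues N \<Longrightarrow> residue N r = r"
proof -
  assume r: "r \<in> residues N"
  have "of_int (\<lfloor>r $ i\<rfloor> mod int N) = r $ i" for i
  proof -
    have "r $ i \<in> \<int>" "0 \<le> r $ i" "r $ i < real N"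
      using r by (auto simp: residues_def integer_lattice_def)
    then obtain a :: int where a: "r $ i = of_int a" by (auto elim: Ints_cases)
    then have "0 \<le> a" "a < int N" using \<open>0 \<le> r $ i\<close> \<open>r $ i < real N\<close> by auto
    then show ?thesis by (simp add: a)
  qed
  then show ?thesis by (simp add: residue_def vec_eq_iff)
qed

lemma residue_add_multiple:
  assumes "z \<in> integer_lattice" "w \<in> integer_lattice"
  shows "residue N (z + real N *\<^sub>R w) = residue N z"
proof -
  have "\<lfloor>z $ i + real N * w $ i\<rfloor> mod int N = \<lfloor>z $ i\<rfloor> mod int N" for i
  proof -
    obtain a b :: int where "z $ i = of_int a" "w $ i = of_int b"
      using assms by (auto simp: integer_lattice_def elim!: allE[of _ i] Ints_cases)
    then have "z $ i + real N * w $ i = of_int (a + int N * b)" "z $ i = of_int a" by auto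
    then show ?thesis by (simp only: floor_of_int) simp
  qed
  then show ?thesis by (simp add: residue_def vec_eq_iff)
qed

lemma residue_decomp:
  fixes z :: "real^'n"
  assumes "z \<in> integer_lattice"
  obtains w where "w \<in> integer_lattice" "z = residue N z + real N *\<^sub>R w"
proof
  define w :: "real^'n" where "w = (\<chi> i. of_int (\<lfloor>z $ i\<rfloor> div int N))"
  show "w \<in> integer_lattice" by (simp add: w_def integer_lattice_def)
  have "z $ i = of_int (\<lfloor>z $ i\<rfloor> mod int N) + real N * of_int (\<lfloor>z $ i\<rfloor> div int N)" for i
  proof -
    obtain a :: int where a: "z $ i = of_int a"
      using assms by (auto simp: integer_lattice_def elim!: allE[of _ i] Ints_cases)
    have "a = a mod int N + int N * (a div int N)" by simp
    then have eq: "real_of_int a = of_int (a mod int N) + real N * of_int (a div int N)"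
      by (metis of_int_add of_int_mult of_int_of_nat_eq)
    show ?thesis unfolding a floor_of_int by (rule eq)
  qed
  then show "z = residue N z + real N *\<^sub>R w"
    by (simp add: w_def residue_def vec_eq_iff)
qed

lemma card_residues: "finite (residues N :: (real^'n) set)" "card (residues N :: (real^'n) set) = N ^ CARD('n)"
proof -
  let ?F = "PiE (UNIV::'n set) (\<lambda>_. {..<N})"
  have bij: "bij_betw (\<lambda>f. (\<chi> i. real (f i)) :: real^'n) ?F (residues N)"
  proof (rule bij_betwI')
    fix f g assume "f \<in> ?F" "g \<in> ?F"
    show "((\<chi> i. real (f i)) = ((\<chi> i. real (g i)) :: real^'n)) = (f = g)"
      by (auto simp: vec_eq_iff fun_eq_iff)
  next
    fix f assume "f \<in> ?F"
    then show "(\<chi> i. real (f i)) \<in> residues N"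
      by (auto simp: residues_def integer_lattice_def PiE_def Pi_def)
  next
    fix r :: "real^'n" assume r: "r \<in> residues N"
    define f where "f i = nat \<lfloor>r $ i\<rfloor>" for i
    have f: "real (f i) = r $ i \<and> f i < N" for i
    proof -
      obtain a :: int where a: "r $ i = of_int a"
        using r by (auto simp: residues_def integer_lattice_def elim!: allE[of _ i] Ints_cases)
      moreover have "0 \<le> r $ i" "r $ i < real N" using r by (auto simp: residues_def)
      ultimately show ?thesis by (simp add: f_def)
    qed
    then show "\<exists>f\<in>?F. r = (\<chi> i. real (f i))"
      by (intro bexI[of _ f]) (auto simp: vec_eq_iff)
  qed
  show "finite (residues N :: (real^'n) set)"
    using bij_betw_finite[OF bij] by (simp add: finite_PiE)
  show "card (residues N :: (real^'n) set) = N ^ CARD('n)"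
    using bij_betw_same_card[OF bij] by (simp add: card_PiE)
qed

lemma inner_integer_lattice:
  assumes "z \<in> integer_lattice" "w \<in> integer_lattice"
  obtains m :: int where "z \<bullet> w = of_int m"
proof -
  have "z \<bullet> w \<in> \<int>"
    unfolding inner_vec_def using assms by (intro Ints_sum) (simp add: integer_lattice_def)
  then show ?thesis using that by (auto elim: Ints_cases)
qed

text \<open>
  The frequencies attached to the lattice: each residue class is translated rigidly, the
  representative \<open>r\<close> being moved to \<open>\<tau> r\<close>.
\<close>

definition class_shift :: "nat \<Rightarrow> (real^'n \<Rightarrow> real^'n) \<Rightarrow> real^'n \<Rightarrow> real^'n" where
  "class_shift N \<tau> z = z - residue N z + \<tau> (residue N z)"

lemma class_shift_add_multiple:
  assumes "r \<in> residues N" "w \<in> integer_lattice"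
  shows "class_shift N \<tau> (r + real N *\<^sub>R w) = \<tau> r + real N *\<^sub>R w"
proof -
  have "residue N (r + real N *\<^sub>R w) = r"
    using assms residue_add_multiple[of r w N] by (simp add: residue_of_residues residues_def)
  then show ?thesis by (simp add: class_shift_def)
qed

text \<open>
  Two frequencies of the same class differ by an element of \<open>N \<int>\<^sup>n\<close>, and a nonzero one gives an
  exponential with integral \<open>0\<close> over a cube of side \<open>2 \<pi> / N\<close>.
\<close>

lemma L2_inner_class_shift:
  fixes k l :: "real^'n"
  assumes N: "N > 0" and h: "h = 2 * pi / real N" and kl: "k \<in> integer_lattice" "l \<in> integer_lattice"
    and same: "residue N k = residue N l"
  shows "L2_inner (lebesgue_on (open_cube h)) (wave (class_shift N \<tau> k)) (wave (class_shift N \<tau> l))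
    = (if k = l then complex_of_real (h ^ CARD('n)) else 0)"
proof -
  obtain u v where u: "u \<in> integer_lattice" "k = residue N k + real N *\<^sub>R u"
    and v: "v \<in> integer_lattice" "l = residue N l + real N *\<^sub>R v"
    using residue_decomp kl by metis
  have diff: "k - l = real N *\<^sub>R (u - v)"
    by (subst u(2), subst v(2)) (simp add: same scaleR_diff_right)
  have "wave (class_shift N \<tau> k) y * cnj (wave (class_shift N \<tau> l) y) = exp (\<i> * complex_of_real ((k - l) \<bullet> y))" for y
  proof -
    have "wave (class_shift N \<tau> k) y * cnj (wave (class_shift N \<tau> l) y)
        = wave (class_shift N \<tau> k + - class_shift N \<tau> l) y"
      by (simp only: cnj_wave wave_add)
    also have "class_shift N \<tau> k + - class_shift N \<tau> l = k - l"
      by (simp add: class_shift_def same)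
    finally show ?thesis by (simp only: wave_def)
  qed
  then have "L2_inner (lebesgue_on (open_cube h)) (wave (class_shift N \<tau> k)) (wave (class_shift N \<tau> l))
      = (LINT y|lebesgue_on (open_cube h). exp (\<i> * complex_of_real ((k - l) \<bullet> y)))"
    by (simp add: L2_inner_def)
  also have "\<dots> = (if k - l = 0 then complex_of_real h ^ CARD('n) else 0)"
  proof (rule integral_exp_open_cube)
    show "h > 0" using N by (simp add: h)
    fix i
    have "(u - v) $ i \<in> \<int>" using u v by (simp add: integer_lattice_def)
    then obtain m :: int where "(u - v) $ i = of_int m" by (auto elim: Ints_cases)
    then have "(k - l) $ i * h = 2 * pi * of_int m" using N by (simp add: diff h)
    then show "\<exists>m::int. (k - l) $ i * h = 2 * pi * of_int m" ..
  qed
  finally show ?thesis by simp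
qed

lemma spans_densely_class_shift:
  fixes \<tau> :: "real^'n \<Rightarrow> real^'n"
  assumes N: "N > 0" and h: "h = 2 * pi / real N" and r: "r \<in> residues N"
  shows "spans_densely (lebesgue_on (open_cube h)) {z\<in>integer_lattice. residue N z = r}
    (\<lambda>z. wave (class_shift N \<tau> z))"
proof (rule spans_densely_modulate)
  show "spans_densely (lebesgue_on (open_cube h)) integer_lattice (cube_wave h :: real^'n \<Rightarrow> _)"
    by (rule spans_densely_cube_wave) (use N in \<open>simp add: h\<close>)
  have rl: "r \<in> integer_lattice" using r by (simp add: residues_def)
  have Nl: "real N *\<^sub>R w \<in> integer_lattice" if "w \<in> integer_lattice" for w :: "real^'n"
    using that by (simp add: integer_lattice_def)
  show "bij_betw (\<lambda>w. r + real N *\<^sub>R w) integer_lattice {z\<in>integer_lattice. residue N z = r}"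
  proof (rule bij_betwI')
    fix w assume "w \<in> (integer_lattice :: (real^'n) set)"
    then show "r + real N *\<^sub>R w \<in> {z\<in>integer_lattice. residue N z = r}"
      using rl r Nl by (simp add: add_integer_lattice residue_add_multiple residue_of_residues)
  next
    fix z assume "z \<in> {z\<in>integer_lattice. residue N z = r}"
    then show "\<exists>w\<in>integer_lattice. z = r + real N *\<^sub>R w"
      using residue_decomp[of z N] by auto
  qed (use N in simp)
  fix w y :: "real^'n" assume w: "w \<in> integer_lattice"
  have "cube_wave h w y = wave (real N *\<^sub>R w) y"
    using N by (simp add: cube_wave_def wave_def h)
  then show "wave (class_shift N \<tau> (r + real N *\<^sub>R w)) y = wave (\<tau> r) y * cube_wave h w y"
    by (simp add: class_shift_add_multiple[OF r w] wave_add)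
qed auto

lemma cube_tiles_lattice:
  assumes "h > 0" "finite A" "A \<subseteq> integer_lattice"
  shows "cube_tiles h ((\<lambda>a. x + h *\<^sub>R a) ` A)"
  unfolding cube_tiles_def
proof (intro conjI ballI impI)
  fix p q assume "p \<in> (\<lambda>a. x + h *\<^sub>R a) ` A" "q \<in> (\<lambda>a. x + h *\<^sub>R a) ` A" "p \<noteq> q"
  then obtain a b where ab: "a \<in> A" "b \<in> A" "p = x + h *\<^sub>R a" "q = x + h *\<^sub>R b" "a \<noteq> b"
    by auto
  then obtain i where i: "a $ i \<noteq> b $ i" by (auto simp: vec_eq_iff)
  have "a \<in> integer_lattice" "b \<in> integer_lattice" using ab assms by auto
  then have "a $ i - b $ i \<in> \<int>" by (simp add: integer_lattice_def)
  then obtain m :: int where m: "a $ i - b $ i = of_int m" by (auto elim: Ints_cases)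
  then have "m \<noteq> 0" using i by auto
  then have "1 \<le> \<bar>a $ i - b $ i\<bar>" unfolding m by linarith
  then have "h * 1 \<le> h * \<bar>a $ i - b $ i\<bar>"
    using assms by (intro mult_left_mono) auto
  then have "h \<le> \<bar>p $ i - q $ i\<bar>"
    using assms by (simp add: ab abs_mult flip: right_diff_distrib)
  then show "\<exists>i. h \<le> \<bar>p $ i - q $ i\<bar>" ..
qed (use assms in auto)

text \<open>
  Elements of \<open>N \<int>\<^sup>n\<close> have exponentials equal to \<open>1\<close> at the corners \<open>p \<in> h \<int>\<^sup>n\<close>. Passing from the
  cube at the origin to the cube at \<open>p\<close> therefore multiplies an exponential by the number
  \<open>wave (\<tau> r) p\<close>, which depends only on the residue class of its index.
\<close>

lemma riesz_system_class_shift: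
  fixes A :: "(real^'n) set"
  assumes N: "N > 0" and h: "h = 2 * pi / real N" and A: "finite A" "A \<subseteq> integer_lattice"
    and P: "P = (\<lambda>a. h *\<^sub>R a) ` A"
    and inv: "inverse_matrices (residues N) P (\<lambda>r. wave (\<tau> r)) w"
  shows "riesz_system (lebesgue_on (cube_union h P)) integer_lattice
    (\<lambda>z. exponential (cube_union h P) (class_shift N \<tau> z))"
proof (rule riesz_system_cube_union[where R = "residues N" and \<rho> = "residue N" and \<kappa> = "h ^ CARD('n)"
      and g = "\<lambda>z. wave (class_shift N \<tau> z)" and m = "\<lambda>r. wave (\<tau> r)" and w = w])
  show "cube_tiles h P"
    unfolding P using cube_tiles_lattice[OF _ A, of h 0] N by (simp add: h)
  show "wave (class_shift N \<tau> z) \<in> L2 (lebesgue_on (open_cube h))" for z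
    by (rule L2_bounded[OF finite_measure_open_cube, where C = 1]) auto
  show "exponential (cube_union h P) (class_shift N \<tau> z) \<in> L2 (lebesgue_on (cube_union h P))" for z
    using A by (intro L2_exponential lmeasurable_cube_union) (simp add: P)
  fix k p y :: "real^'n"
  assume k: "k \<in> integer_lattice" and p: "p \<in> P" and y: "y \<in> open_cube h"
  obtain u where u: "u \<in> integer_lattice" "k = residue N k + real N *\<^sub>R u"
    using residue_decomp[OF k] by blast
  obtain a where a: "a \<in> A" "p = h *\<^sub>R a" using p by (auto simp: P)
  then have "a \<in> integer_lattice" using A by auto
  with u(1) obtain m where m: "u \<bullet> a = of_int m" using inner_integer_lattice by blast
  have "class_shift N \<tau> k = \<tau> (residue N k) + real N *\<^sub>R u"
    unfolding class_shift_def using u(2) by (metis add.commute add_diff_cancel_left')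
  moreover have "wave (real N *\<^sub>R u) p = 1"
    using N by (intro wave_eq_1[of _ _ m]) (simp add: a m h)
  ultimately have "wave (class_shift N \<tau> k) p = wave (\<tau> (residue N k)) p"
    by (simp add: wave_add)
  then show "exponential (cube_union h P) (class_shift N \<tau> k) (p + y)
      = wave (\<tau> (residue N k)) p * wave (class_shift N \<tau> k) y"
    using open_cube_in_cube_union[OF p y] by (simp add: exponential_eq_wave wave_add_arg)
next
  show "L2_inner (lebesgue_on (open_cube h)) (wave (class_shift N \<tau> k)) (wave (class_shift N \<tau> l))
      = (if k = l then complex_of_real (h ^ CARD('n)) else 0)"
    if "k \<in> integer_lattice" "l \<in> integer_lattice" "residue N k = residue N l" for k l :: "real^'n"
    by (rule L2_inner_class_shift[OF N h that])
  show "spans_densely (lebesgue_on (open_cube h)) {k\<in>integer_lattice. residue N k = r}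
      (\<lambda>z. wave (class_shift N \<tau> z))" if "r \<in> residues N" for r :: "real^'n"
    by (rule spans_densely_class_shift[OF N h that])
  show "0 < h ^ CARD('n)" using N by (simp add: h)
qed (use N in \<open>auto simp: card_residues residue_in_residues inv\<close>)

text \<open>
  Pair the residue classes with the cubes by a bijection \<open>\<pi>\<close> and let the class of \<open>r\<close> carry the
  normalised Fourier basis of the cube at \<open>\<pi> r\<close>. This fits the same scheme, the matrix being a
  multiple of a permutation matrix, and it indexes an orthonormal basis by the lattice.
\<close>

lemma orthonormal_basis_cube_union:
  fixes P :: "(real^'n) set"
  assumes N: "N > 0" and h: "h = 2 * pi / real N" and P: "cube_tiles h P" "card P = N ^ CARD('n)"
  shows "\<exists>e. orthonormal_basis (lebesgue_on (cube_union h P)) (integer_lattice :: (real^'n) set) e \<and>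
    riesz_system (lebesgue_on (cube_union h P)) (integer_lattice :: (real^'n) set) e"
proof -
  let ?S = "lebesgue_on (cube_union h P)" and ?Q = "lebesgue_on (open_cube h :: (real^'n) set)"
  have finP: "finite P" using P by (simp add: cube_tiles_def)
  have h0: "h > 0" using N by (simp add: h)
  have "card (residues N :: (real^'n) set) = card P"
    by (simp add: card_residues P(2))
  then obtain \<pi> where \<pi>: "bij_betw \<pi> (residues N :: (real^'n) set) P"
    using finite_same_card_bij[OF card_residues(1) finP] by blast
  define \<sigma> where "\<sigma> = complex_of_real (sqrt (h ^ CARD('n)))"
  have \<sigma>: "\<sigma> \<noteq> 0" "\<sigma> * \<sigma> = complex_of_real (h ^ CARD('n))" "cnj \<sigma> = \<sigma>"
    using h0 by (auto simp: \<sigma>_def simp flip: of_real_mult)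
  define g where "g z = wave (class_shift N (\<lambda>r. r) z)" for z :: "real^'n"
  define e where "e z x = (1 / \<sigma>) * g z (x - \<pi> (residue N z)) * indicator (open_cube h) (x - \<pi> (residue N z))" for z x
  define m where "m r p = (if p = \<pi> r then 1 / \<sigma> else 0)" for r p :: "real^'n"
  define w where "w p r = (if p = \<pi> r then \<sigma> else 0)" for p r :: "real^'n"
  have eg: "e k (p + y) = m (residue N k) p * g k y" if p: "p \<in> P" and y: "y \<in> open_cube h" for k p y
  proof (cases "p = \<pi> (residue N k)")
    case True
    then show ?thesis using y by (simp add: e_def m_def)
  next
    case False
    have "\<pi> (residue N k) \<in> P" using \<pi> residue_in_residues[OF N] by (auto simp: bij_betw_def)
    then obtain i where "h \<le> \<bar>p $ i - \<pi> (residue N k) $ i\<bar>"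
      using P(1) p False unfolding cube_tiles_def by blast
    moreover have "0 < y $ i" "y $ i < h" using y by (auto simp: open_cube_def)
    ultimately have "\<not> (0 < (p + y - \<pi> (residue N k)) $ i \<and> (p + y - \<pi> (residue N k)) $ i < h)"
      by auto
    then have "p + y - \<pi> (residue N k) \<notin> open_cube h" unfolding open_cube_def by blast
    then show ?thesis using False by (simp add: e_def m_def)
  qed
  have eL: "e k \<in> L2 ?S" for k
  proof (rule L2_bounded[where C = "cmod (1 / \<sigma>)"])
    show "finite_measure ?S" by (intro finite_measure_lebesgue_on lmeasurable_cube_union finP)
    have "open (open_cube h :: (real^'n) set)" unfolding open_cube_eq_box by (rule open_box)
    then have [measurable]: "open_cube h \<in> sets (borel :: (real^'n) measure)" by (rule borel_open)
    have "e k \<in> borel_measurable lborel"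
      unfolding e_def g_def wave_def by measurable
    then show "e k \<in> borel_measurable ?S"
      by (intro measurable_restrict_space1 measurable_completion)
  qed (auto simp: e_def g_def norm_mult norm_divide indicator_def)
  have gL: "g k \<in> L2 ?Q" for k
    unfolding g_def by (rule L2_bounded[OF finite_measure_open_cube, where C = 1]) auto
  have inv: "inverse_matrices (residues N) P m w"
    unfolding inverse_matrices_def
  proof (intro conjI ballI)
    fix r s :: "real^'n" assume r: "r \<in> residues N" and s: "s \<in> residues N"
    have "\<pi> r \<in> P" using \<pi> r by (auto simp: bij_betw_def)
    have "(\<Sum>p\<in>P. m r p * w p s) = (\<Sum>p\<in>P. if p = \<pi> r then (if \<pi> r = \<pi> s then 1 else 0) else 0)"
      using \<sigma>(1) by (intro sum.cong) (auto simp: m_def w_def)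
    also have "\<dots> = (if \<pi> r = \<pi> s then 1 else 0)"
      using finP \<open>\<pi> r \<in> P\<close> by simp
    also have "\<pi> r = \<pi> s \<longleftrightarrow> r = s"
      using \<pi> r s by (auto simp: bij_betw_def dest: inj_onD)
    finally show "(\<Sum>p\<in>P. m r p * w p s) = (if r = s then 1 else 0)" .
  next
    fix p q assume p: "p \<in> P" and q: "q \<in> P"
    have "(\<Sum>r\<in>residues N. w q r * m r p) = (\<Sum>r\<in>residues N. (\<lambda>p'. if p' = p then (if p = q then 1 else 0) else 0) (\<pi> r))"
      using \<sigma>(1) by (intro sum.cong) (auto simp: m_def w_def)
    also have "\<dots> = (\<Sum>p'\<in>P. if p' = p then (if p = q then 1 else 0) else 0)"
      by (rule sum.reindex_bij_betw[OF \<pi>])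
    also have "\<dots> = (if p = q then 1 else 0)" using finP p by simp
    finally show "(\<Sum>r\<in>residues N. w q r * m r p) = (if p = q then 1 else 0)" .
  qed
  have rs: "riesz_system ?S integer_lattice e"
  proof (rule riesz_system_cube_union[where R = "residues N" and \<rho> = "residue N" and \<kappa> = "h ^ CARD('n)"
      and g = g and m = m and w = w, OF P(1)])
    show "L2_inner ?Q (g k) (g l) = (if k = l then complex_of_real (h ^ CARD('n)) else 0)"
      if "k \<in> integer_lattice" "l \<in> integer_lattice" "residue N k = residue N l" for k l
      unfolding g_def by (rule L2_inner_class_shift[OF N h that])
    show "spans_densely ?Q {k\<in>integer_lattice. residue N k = r} g" if "r \<in> residues N" for r
      unfolding g_def by (rule spans_densely_class_shift[OF N h that])
    show "e k (p + y) = m (residue N k) p * g k y" if "p \<in> P" "y \<in> open_cube h" for k p y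
      by (rule eg[OF that])
  qed (use N h0 eL gL inv in \<open>auto simp: card_residues residue_in_residues\<close>)
  have "L2_inner ?S (e k) (e l) = (if k = l then 1 else 0)" if k: "k \<in> integer_lattice" and l: "l \<in> integer_lattice" for k l
  proof -
    have "L2_inner ?S (e k) (e l) = (\<Sum>p\<in>P. LINT y|?Q. e k (p + y) * cnj (e l (p + y)))"
      unfolding L2_inner_def by (rule integral_cube_union(2)[OF P(1) integrable_L2_inner[OF eL eL]])
    also have "\<dots> = (\<Sum>p\<in>P. m (residue N k) p * cnj (m (residue N l) p) * L2_inner ?Q (g k) (g l))"
    proof (rule sum.cong[OF refl])
      fix p assume "p \<in> P"
      then have "(LINT y|?Q. e k (p + y) * cnj (e l (p + y)))
          = (LINT y|?Q. (m (residue N k) p * cnj (m (residue N l) p)) * (g k y * cnj (g l y)))"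
        by (intro Bochner_Integration.integral_cong) (auto simp: eg)
      then show "(LINT y|?Q. e k (p + y) * cnj (e l (p + y)))
          = m (residue N k) p * cnj (m (residue N l) p) * L2_inner ?Q (g k) (g l)"
        by (simp add: L2_inner_def)
    qed
    also have "\<dots> = (\<Sum>p\<in>P. if p = \<pi> (residue N k) then (if k = l then 1 else 0) else 0)"
    proof (rule sum.cong[OF refl])
      fix p
      have res: "residue N k \<in> residues N" "residue N l \<in> residues N"
        using residue_in_residues[OF N] by auto
      show "m (residue N k) p * cnj (m (residue N l) p) * L2_inner ?Q (g k) (g l)
          = (if p = \<pi> (residue N k) then (if k = l then 1 else 0) else 0)"
      proof (cases "residue N k = residue N l")
        case True
        then show ?thesis
          using \<sigma> h0 L2_inner_class_shift[OF N h k l True, of "\<lambda>r. r"] by (simp add: m_def g_def)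
      next
        case False
        then have "\<pi> (residue N k) \<noteq> \<pi> (residue N l)"
          using \<pi> res by (auto simp: bij_betw_def dest: inj_onD)
        then show ?thesis using False by (auto simp: m_def)
      qed
    qed
    also have "\<dots> = (if k = l then 1 else 0)"
      using finP \<pi> residue_in_residues[OF N, of k] by (auto simp: bij_betw_def)
    finally show ?thesis .
  qed
  then have "orthonormal_basis ?S integer_lattice e"
    using rs unfolding orthonormal_basis_def riesz_system_def spans_densely_def by blast
  then show ?thesis using rs by (intro exI[of _ e] conjI)
qed

section \<open>Generic matrices of exponentials are invertible\<close>

text \<open>
  Subtracting a multiple of a translate annihilates one chosen exponential and multiplies the
  coefficient of another one by a nonzero number, so the number of terms can be reduced.
\<close>

lemma waves_independent_on_ball:
  fixes A :: "(real^'n) set" and c :: "real^'n \<Rightarrow> complex"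
  assumes "finite A" "\<eta> > 0" "\<And>t. dist x t < \<eta> \<Longrightarrow> (\<Sum>a\<in>A. c a * wave t a) = 0" "a \<in> A"
  shows "c a = 0"
  using assms
proof (induction A arbitrary: c \<eta> a rule: finite_induct)
  case (insert b A)
  have zero: "c a = 0" if a: "a \<in> A" for a
  proof -
    define u where "u = a - b"
    have u: "norm u > 0" using a insert.hyps by (auto simp: u_def)
    \<comment> \<open>The translation by \<open>s u\<close> must stay in the ball, and the phase difference \<open>s |u|\<^sup>2\<close> must lie strictly between \<open>0\<close> and \<open>2 \<pi>\<close>.\<close>
    define s where "s = min (\<eta> / (4 * norm u)) (1 / (norm u)\<^sup>2)"
    have s: "s > 0" "s * norm u < \<eta> / 2" "s * (norm u)\<^sup>2 \<le> 1"
    proof -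
      show "s > 0" using u insert.prems by (simp add: s_def)
      have "s * norm u \<le> \<eta> / (4 * norm u) * norm u"
        by (intro mult_right_mono) (auto simp: s_def)
      then show "s * norm u < \<eta> / 2" using u insert.prems by simp
      have "s * (norm u)\<^sup>2 \<le> 1 / (norm u)\<^sup>2 * (norm u)\<^sup>2"
        by (intro mult_right_mono) (auto simp: s_def)
      then show "s * (norm u)\<^sup>2 \<le> 1" using u by simp
    qed
    define d where "d a = c a * (wave (s *\<^sub>R u) a - wave (s *\<^sub>R u) b)" for a
    have "d a = 0"
    proof (rule insert.IH[where \<eta> = "\<eta> / 2"])
      fix t assume t: "dist x t < \<eta> / 2"
      have "dist x (t + s *\<^sub>R u) \<le> dist x t + dist t (t + s *\<^sub>R u)"
        by (rule dist_triangle)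
      also have "dist t (t + s *\<^sub>R u) = s * norm u"
        using s by (simp add: dist_norm)
      finally have 1: "(\<Sum>a\<in>insert b A. c a * wave (t + s *\<^sub>R u) a) = 0"
        using t s(2) by (intro insert.prems) auto
      have 2: "(\<Sum>a\<in>insert b A. c a * wave t a) = 0"
        using t insert.prems(1) by (intro insert.prems) auto
      have "(\<Sum>a\<in>A. d a * wave t a) = (\<Sum>a\<in>insert b A. d a * wave t a)"
        using insert.hyps by (simp add: d_def)
      also have "\<dots> = (\<Sum>a\<in>insert b A. c a * wave (t + s *\<^sub>R u) a - wave (s *\<^sub>R u) b * (c a * wave t a))"
        by (intro sum.cong refl) (simp add: d_def wave_add algebra_simps)
      also have "\<dots> = 0"
        unfolding sum_subtractf sum_distrib_left[symmetric] 1 2 by simp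
      finally show "(\<Sum>a\<in>A. d a * wave t a) = 0" .
    qed (use insert.prems a in auto)
    moreover have "wave (s *\<^sub>R u) a \<noteq> wave (s *\<^sub>R u) b"
    proof
      assume "wave (s *\<^sub>R u) a = wave (s *\<^sub>R u) b"
      then obtain n :: int where "\<i> * complex_of_real ((s *\<^sub>R u) \<bullet> a)
          = \<i> * complex_of_real ((s *\<^sub>R u) \<bullet> b) + (of_int (2 * n) * pi) * \<i>"
        unfolding wave_def exp_eq by blast
      then have "Im (\<i> * complex_of_real ((s *\<^sub>R u) \<bullet> a))
          = Im (\<i> * complex_of_real ((s *\<^sub>R u) \<bullet> b) + (of_int (2 * n) * pi) * \<i>)"
        by (rule arg_cong)
      then have "s * (u \<bullet> a) - s * (u \<bullet> b) = 2 * of_int n * pi"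
        by simp
      moreover have "s * (u \<bullet> a) - s * (u \<bullet> b) = s * (norm u)\<^sup>2"
        by (simp add: u_def power2_norm_eq_inner inner_diff_left inner_diff_right algebra_simps inner_commute)
      ultimately have n: "s * (norm u)\<^sup>2 = of_int n * (2 * pi)" by simp
      have "s * (norm u)\<^sup>2 > 0" using s u by simp
      then have "0 < real_of_int n" unfolding n using pi_gt_zero by (simp add: zero_less_mult_iff)
      then have "1 \<le> n" by simp
      then have "1 \<le> real_of_int n" by simp
      then have "1 * (2 * pi) \<le> of_int n * (2 * pi)" by (intro mult_right_mono) auto
      then show False using n s(3) pi_gt3 by linarith
    qed
    ultimately show ?thesis by (simp add: d_def)
  qed
  have "(\<Sum>a\<in>insert b A. c a * wave x a) = 0"
    using insert.prems(1) by (intro insert.prems) auto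
  then have "c b * wave x b = 0"
    using insert.hyps zero by simp
  moreover have "wave x b \<noteq> 0" by (simp add: wave_def)
  ultimately show ?case using zero insert.prems(3) by auto
qed simp

text \<open>
  The block formula for the inverse of a matrix bordered by one row \<open>m a\<close> and one column
  \<open>\<lambda>r. m r b\<close>, in which \<open>\<sigma>\<close> is the Schur complement of the smaller matrix.
\<close>

lemma inverse_matrices_border:
  fixes m :: "'r \<Rightarrow> 'p \<Rightarrow> complex"
  assumes fin: "finite R" "finite P" and new: "a \<notin> R" "b \<notin> P" and w: "inverse_matrices R P m w"
    and \<sigma>: "\<sigma> = m a b - (\<Sum>p\<in>P. m a p * (\<Sum>r\<in>R. w p r * m r b))" "\<sigma> \<noteq> 0"
  shows "\<exists>w'. inverse_matrices (insert a R) (insert b P) m w'"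
proof -
  define u where "u p = (\<Sum>r\<in>R. w p r * m r b)" for p
  define v where "v r = (\<Sum>p\<in>P. m a p * w p r)" for r
  have left: "(\<Sum>p\<in>P. m r p * w p s) = (if r = s then 1 else 0)" if "r \<in> R" "s \<in> R" for r s
    using w that by (simp add: inverse_matrices_def)
  have right: "(\<Sum>r\<in>R. w q r * m r p) = (if p = q then 1 else 0)" if "p \<in> P" "q \<in> P" for p q
    using w that by (simp add: inverse_matrices_def)
  have mu: "(\<Sum>p\<in>P. m r p * u p) = m r b" if r: "r \<in> R" for r
  proof -
    have "(\<Sum>p\<in>P. m r p * u p) = (\<Sum>s\<in>R. (\<Sum>p\<in>P. m r p * w p s) * m s b)"
      unfolding u_def sum_distrib_left sum_distrib_right by (subst sum.swap) (simp add: mult.assoc)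
    also have "\<dots> = (\<Sum>s\<in>R. if s = r then m s b else 0)"
      using r by (intro sum.cong refl) (simp add: left)
    finally show ?thesis using r fin by simp
  qed
  have vm: "(\<Sum>r\<in>R. v r * m r p) = m a p" if p: "p \<in> P" for p
  proof -
    have "(\<Sum>r\<in>R. v r * m r p) = (\<Sum>q\<in>P. m a q * (\<Sum>r\<in>R. w q r * m r p))"
      unfolding v_def sum_distrib_left sum_distrib_right by (subst sum.swap) (simp add: mult.assoc)
    also have "\<dots> = (\<Sum>q\<in>P. if q = p then m a q else 0)"
      using p by (intro sum.cong refl) (simp add: right)
    finally show ?thesis using p fin by simp
  qed
  have au: "(\<Sum>p\<in>P. m a p * u p) = m a b - \<sigma>"
    by (simp add: \<sigma>(1) u_def)
  have vb: "(\<Sum>r\<in>R. v r * m r b) = m a b - \<sigma>"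
    unfolding au[symmetric] u_def v_def sum_distrib_left sum_distrib_right
    by (subst sum.swap) (simp add: mult.assoc)
  define w' where "w' p r =
    (if p = b then (if r = a then 1 / \<sigma> else - v r / \<sigma>)
     else (if r = a then - u p / \<sigma> else w p r + u p * v r / \<sigma>))" for p r
  have row: "(\<Sum>p\<in>insert b P. x p * w' p s)
      = (if s = a then (x b - (\<Sum>p\<in>P. x p * u p)) / \<sigma>
         else (\<Sum>p\<in>P. x p * w p s) - (x b - (\<Sum>p\<in>P. x p * u p)) * v s / \<sigma>)" for x s
  proof -
    have "(\<Sum>p\<in>P. x p * w' p s) = (\<Sum>p\<in>P. if s = a then - (x p * u p) / \<sigma> else x p * w p s + x p * u p * v s / \<sigma>)"
      using new by (intro sum.cong refl) (auto simp: w'_def algebra_simps)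
    then show ?thesis
      using fin new by (simp add: w'_def sum.distrib sum_negf diff_divide_distrib left_diff_distrib
          flip: sum_divide_distrib sum_distrib_right)
  qed
  have column: "(\<Sum>r\<in>insert a R. w' q r * y r)
      = (if q = b then (y a - (\<Sum>r\<in>R. v r * y r)) / \<sigma>
         else (\<Sum>r\<in>R. w q r * y r) - u q * (y a - (\<Sum>r\<in>R. v r * y r)) / \<sigma>)" for q y
  proof -
    have "(\<Sum>r\<in>R. w' q r * y r) = (\<Sum>r\<in>R. if q = b then - (v r * y r) / \<sigma> else w q r * y r + u q * (v r * y r) / \<sigma>)"
      using new by (intro sum.cong refl) (auto simp: w'_def algebra_simps)
    then show ?thesis
      using fin new by (simp add: w'_def sum.distrib sum_negf diff_divide_distrib right_diff_distrib
          flip: sum_divide_distrib sum_distrib_left)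
  qed
  have "inverse_matrices (insert a R) (insert b P) m w'"
    unfolding inverse_matrices_def row column using \<sigma>(2) new
    by (auto simp: mu vm au vb left right simp flip: v_def u_def)
  then show ?thesis by blast
qed

text \<open>
  The matrix is bordered one row at a time. As a function of the frequency of the new row, the
  Schur complement is a combination of exponentials in which the new point has coefficient \<open>1\<close>;
  by independence it cannot vanish on a whole ball.
\<close>

lemma wave_matrix_invertible:
  fixes P :: "(real^'n) set" and x :: "'r \<Rightarrow> real^'n"
  assumes "\<eta> > 0" and fin: "finite R" "finite P" and card: "card R = card P"
  shows "\<exists>\<tau> w. (\<forall>r\<in>R. norm (\<tau> r - x r) < \<eta>) \<and> inverse_matrices R P (\<lambda>r. wave (\<tau> r)) w"
  using fin card
proof (induction R arbitrary: P rule: finite_induct)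
  case empty
  then show ?case by (simp add: inverse_matrices_def)
next
  case (insert a R)
  then have "P \<noteq> {}" by auto
  then obtain b where b: "b \<in> P" by blast
  define Q where "Q = P - {b}"
  have Q: "finite Q" "b \<notin> Q" "P = insert b Q" using insert.prems b by (auto simp: Q_def)
  then have "card R = card Q" using insert by simp
  then obtain \<tau> w where \<tau>: "\<forall>r\<in>R. norm (\<tau> r - x r) < \<eta>" and w: "inverse_matrices R Q (\<lambda>r. wave (\<tau> r)) w"
    using insert.IH[OF Q(1)] by blast
  define u where "u p = (\<Sum>r\<in>R. w p r * wave (\<tau> r) b)" for p
  have "\<exists>s. dist (x a) s < \<eta> \<and> wave s b - (\<Sum>p\<in>Q. wave s p * u p) \<noteq> 0"
  proof (rule ccontr)
    assume vanish: "\<not> ?thesis"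
    define c where "c p = (if p = b then 1 else - u p)" for p
    have "c b = 0"
    proof (rule waves_independent_on_ball[of P \<eta> "x a" c b])
      fix s assume "dist (x a) s < \<eta>"
      then have "wave s b - (\<Sum>p\<in>Q. wave s p * u p) = 0" using vanish by blast
      moreover have "(\<Sum>p\<in>Q. c p * wave s p) = (\<Sum>p\<in>Q. - (wave s p * u p))"
        using Q(2) by (intro sum.cong) (auto simp: c_def)
      ultimately show "(\<Sum>p\<in>P. c p * wave s p) = 0"
        using Q by (simp add: c_def sum_negf)
    qed (use insert.prems b \<open>\<eta> > 0\<close> in auto)
    then show False by (simp add: c_def)
  qed
  then obtain s where s: "dist (x a) s < \<eta>" "wave s b - (\<Sum>p\<in>Q. wave s p * u p) \<noteq> 0" by blast
  define \<tau>' where "\<tau>' = \<tau>(a := s)"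
  have \<tau>': "\<tau>' r = \<tau> r" if "r \<in> R" for r using that insert.hyps by (auto simp: \<tau>'_def)
  have "inverse_matrices R Q (\<lambda>r. wave (\<tau>' r)) w"
    using w by (simp add: inverse_matrices_def \<tau>')
  moreover have "wave (\<tau>' a) b - (\<Sum>p\<in>Q. wave (\<tau>' a) p * (\<Sum>r\<in>R. w p r * wave (\<tau>' r) b)) \<noteq> 0"
    using s(2) by (simp add: \<tau>' u_def) (simp add: \<tau>'_def)
  ultimately have "\<exists>w'. inverse_matrices (insert a R) (insert b Q) (\<lambda>r. wave (\<tau>' r)) w'"
    using insert.hyps Q by (intro inverse_matrices_border) auto
  moreover have "norm (\<tau>' r - x r) < \<eta>" if "r \<in> insert a R" for r
    using that s(1) \<tau> \<tau>' by (auto simp: \<tau>'_def dist_norm norm_minus_commute)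
  ultimately show ?case unfolding Q(3) by blast
qed

section \<open>Translations and subdivisions\<close>

lemma riesz_basis_reindex:
  assumes rb: "riesz_basis M K (\<lambda>k. v (\<phi> k))" and \<phi>: "bij_betw \<phi> K K'"
  shows "riesz_basis M K' v"
proof -
  obtain e T where e: "orthonormal_basis M K e" and T: "bounded_isomorphism M T"
    and v: "\<And>k. k \<in> K \<Longrightarrow> v (\<phi> k) \<in> L2 M" "\<And>k. k \<in> K \<Longrightarrow> AE x in M. v (\<phi> k) x = T (e k) x"
    using rb unfolding riesz_basis_def by blast
  have K': "K' = \<phi> ` K" and inj: "inj_on \<phi> K" using \<phi> by (auto simp: bij_betw_def)
  define e' where "e' k = e (inv_into K \<phi> k)" for k
  have e': "e' (\<phi> k) = e k" if "k \<in> K" for k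
    using that inj by (simp add: e'_def)
  have "spans_densely M K' e'"
    by (rule spans_densely_modulate[where u = "\<lambda>_. 1" and e = e and \<phi> = \<phi> and K = K])
      (use e \<phi> e' in \<open>auto simp: orthonormal_basis_def spans_densely_def\<close>)
  then have "orthonormal_basis M K' e'"
    using e e' inj unfolding orthonormal_basis_def spans_densely_def K'
    by (simp add: inj_on_eq_iff)
  then show ?thesis
    unfolding riesz_basis_def using T v e' by (intro conjI exI[of _ e'] exI[of _ T]) (auto simp: K')
qed

lemma L2_translate:
  fixes f :: "real^'n \<Rightarrow> complex"
  assumes T: "T \<in> sets lebesgue" and f: "f \<in> L2 (lebesgue_on ((+) x ` T))"
  shows "(\<lambda>y. f (x + y)) \<in> L2 (lebesgue_on T)"
    and "L2_norm (lebesgue_on T) (\<lambda>y. f (x + y)) = L2_norm (lebesgue_on ((+) x ` T)) f"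
proof -
  let ?S = "(+) x ` T"
  have S: "?S \<in> sets lebesgue" by (rule lebesgue_sets_translation[OF T])
  have ind: "indicator ?S (x + y) = (indicator T y :: real)" for y
    by (auto simp: indicator_def)
  have fm: "(\<lambda>y. indicator ?S y *\<^sub>R f y) \<in> borel_measurable lebesgue"
    using L2_measurable[OF f] borel_measurable_restrict_space_iff[of ?S lebesgue f] S by simp
  have fi: "integrable lebesgue (\<lambda>y. indicator ?S y *\<^sub>R (cmod (f y))\<^sup>2)"
    using L2_integrable[OF f] integrable_restrict_space[of ?S lebesgue "\<lambda>y. (cmod (f y))\<^sup>2"] S by simp
  have "(\<lambda>y. f (x + y)) \<in> borel_measurable (lebesgue_on T)"
    using integral_translation(1)[OF fm, of x] borel_measurable_restrict_space_iff[of T lebesgue "\<lambda>y. f (x + y)"] T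
    by (simp add: ind)
  moreover have "integrable (lebesgue_on T) (\<lambda>y. (cmod (f (x + y)))\<^sup>2)"
    using integral_translation(2)[of "\<lambda>y. indicator ?S y *\<^sub>R (cmod (f y))\<^sup>2" x] fi
      integrable_restrict_space[of T lebesgue "\<lambda>y. (cmod (f (x + y)))\<^sup>2"] T
    by (simp add: ind borel_measurable_integrable)
  ultimately show "(\<lambda>y. f (x + y)) \<in> L2 (lebesgue_on T)" by (simp add: L2_def)
  show "L2_norm (lebesgue_on T) (\<lambda>y. f (x + y)) = L2_norm (lebesgue_on ?S) f"
    using integral_translation(3)[of "\<lambda>y. indicator ?S y *\<^sub>R (cmod (f y))\<^sup>2" x] fi S T
    unfolding L2_norm_def by (simp add: integral_restrict_space ind borel_measurable_integrable)
qed

text \<open>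
  On the translated set each exponential is the translate of the original one times a
  constant of modulus \<open>1\<close>, which can be absorbed in the coefficients.
\<close>

lemma riesz_system_translate:
  fixes l :: "'k \<Rightarrow> real^'n"
  assumes T: "T \<in> lmeasurable" and v: "riesz_system (lebesgue_on T) K (\<lambda>k. exponential T (l k))"
  shows "riesz_system (lebesgue_on ((+) x ` T)) K (\<lambda>k. exponential ((+) x ` T) (l k))"
proof -
  let ?S = "(+) x ` T"
  have Ts: "T \<in> sets lebesgue" and S: "?S \<in> lmeasurable"
    using T by (auto intro: measurable_translation)
  have shift: "exponential ?S (l k) (x + y) = wave (l k) x * exponential T (l k) y" for k y
    by (auto simp: exponential_eq_wave wave_add_arg indicator_def)
  have L: "exponential ?S (l k) \<in> L2 (lebesgue_on ?S)" for k
    by (rule L2_exponential[OF S])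
  have sum: "(\<Sum>k\<in>F. c k * exponential ?S (l k) (x + y)) = (\<Sum>k\<in>F. (c k * wave (l k) x) * exponential T (l k) y)" for F c y
    by (simp add: shift mult.assoc)
  obtain A B where A: "A > 0" and bounds: "riesz_bounds (lebesgue_on T) K (\<lambda>k. exponential T (l k)) A B"
    using v by (auto simp: riesz_system_def)
  have "riesz_bounds (lebesgue_on ?S) K (\<lambda>k. exponential ?S (l k)) A B"
    unfolding riesz_bounds_def
  proof (intro allI impI)
    fix F c assume F: "finite F" "F \<subseteq> K"
    have "L2_norm (lebesgue_on ?S) (\<lambda>y. \<Sum>k\<in>F. c k * exponential ?S (l k) y)
        = L2_norm (lebesgue_on T) (\<lambda>y. \<Sum>k\<in>F. (c k * wave (l k) x) * exponential T (l k) y)"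
    proof -
      have "(\<lambda>y. \<Sum>k\<in>F. c k * exponential ?S (l k) y) \<in> L2 (lebesgue_on ?S)"
        by (intro L2_lincomb L)
      from L2_translate(2)[OF Ts this] show ?thesis by (simp only: sum)
    qed
    moreover have "coeff_norm F (\<lambda>k. c k * wave (l k) x) = coeff_norm F c"
      by (simp add: coeff_norm_def norm_mult)
    ultimately show "A * coeff_norm F c \<le> L2_norm (lebesgue_on ?S) (\<lambda>y. \<Sum>k\<in>F. c k * exponential ?S (l k) y) \<and>
        L2_norm (lebesgue_on ?S) (\<lambda>y. \<Sum>k\<in>F. c k * exponential ?S (l k) y) \<le> B * coeff_norm F c"
      using riesz_boundsD[OF bounds F, of "\<lambda>k. c k * wave (l k) x"] by simp
  qed
  moreover have "spans_densely (lebesgue_on ?S) K (\<lambda>k. exponential ?S (l k))"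
    unfolding spans_densely_def
  proof (intro ballI allI impI)
    fix f and \<delta> :: real assume f: "f \<in> L2 (lebesgue_on ?S)" and "\<delta> > 0"
    obtain F c where F: "finite F" "F \<subseteq> K"
      and lt: "L2_norm (lebesgue_on T) (\<lambda>y. f (x + y) - (\<Sum>k\<in>F. c k * exponential T (l k) y)) < \<delta>"
      using spans_denselyE[OF _ L2_translate(1)[OF Ts f] \<open>\<delta> > 0\<close>] v unfolding riesz_system_def by blast
    define d where "d k = c k * cnj (wave (l k) x)" for k
    have "d k * wave (l k) x = c k" for k
      by (simp add: d_def mult.assoc)
    then have "L2_norm (lebesgue_on T) (\<lambda>y. f (x + y) - (\<Sum>k\<in>F. d k * exponential ?S (l k) (x + y))) < \<delta>"
      unfolding sum using lt by simp
    moreover have "(\<lambda>y. f y - (\<Sum>k\<in>F. d k * exponential ?S (l k) y)) \<in> L2 (lebesgue_on ?S)"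
      by (intro L2_diff f L2_lincomb L)
    ultimately have "L2_norm (lebesgue_on ?S) (\<lambda>y. f y - (\<Sum>k\<in>F. d k * exponential ?S (l k) y)) < \<delta>"
      using L2_translate(2)[OF Ts, of "\<lambda>y. f y - (\<Sum>k\<in>F. d k * exponential ?S (l k) y)" x] by simp
    then show "\<exists>F c. finite F \<and> F \<subseteq> K \<and> L2_norm (lebesgue_on ?S) (\<lambda>y. f y - (\<Sum>k\<in>F. c k * exponential ?S (l k) y)) < \<delta>"
      using F by blast
  qed
  ultimately show ?thesis
    unfolding riesz_system_def using A L by blast
qed

definition side :: "nat \<Rightarrow> real" where
  "side k = 2 * pi / 2 ^ k"

definition lattice_cubes :: "nat \<Rightarrow> (real^'n) set \<Rightarrow> (real^'n) set" where
  "lattice_cubes k A = cube_union (side k) ((\<lambda>a. side k *\<^sub>R a) ` A)"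

text \<open>
  The number of cubes is chosen so that the union has measure \<open>(2 \<pi>)\<^sup>n\<close>, whatever the level; it
  is also the number of residue classes modulo \<open>2\<^sup>k\<close>.
\<close>

definition cube_family :: "nat \<Rightarrow> (real^'n) set set" where
  "cube_family k = {A. finite A \<and> A \<subseteq> integer_lattice \<and> card A = (2 ^ k) ^ CARD('n)}"

lemma side_pos [simp]: "side k > 0"
  by (simp add: side_def)

lemma mem_lattice_cubes:
  "x \<in> lattice_cubes k A \<longleftrightarrow> (\<exists>a\<in>A. \<forall>i. side k * a $ i \<le> x $ i \<and> x $ i \<le> side k * a $ i + side k)"
  by (simp add: lattice_cubes_def cube_union_def)

lemma cube_union_translate: "cube_union h ((\<lambda>p. x + p) ` P) = (+) x ` cube_union h P"
proof (intro set_eqI iffI)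
  fix y assume "y \<in> cube_union h ((\<lambda>p. x + p) ` P)"
  then have "y - x \<in> cube_union h P"
    by (auto simp: cube_union_def algebra_simps)
  then show "y \<in> (+) x ` cube_union h P"
    by (intro image_eqI[of _ _ "y - x"]) auto
next
  fix y assume "y \<in> (+) x ` cube_union h P"
  then obtain u p where "y = x + u" "p \<in> P" "\<forall>i. p $ i \<le> u $ i \<and> u $ i \<le> p $ i + h"
    by (auto simp: cube_union_def)
  then show "y \<in> cube_union h ((\<lambda>p. x + p) ` P)"
    by (auto simp: cube_union_def intro!: bexI[of _ p])
qed

lemma dyadic_cube_unions_eq:
  assumes "S \<in> (dyadic_cube_unions :: (real^'n) set set)"
  obtains x k A where "A \<in> cube_family k" "S = (+) x ` lattice_cubes k A"
proof -
  obtain x k and m :: "nat \<Rightarrow> real^'n" where m: "\<forall>j\<in>{1..2 ^ (k * CARD('n))}. m j \<in> integer_lattice"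
    "inj_on m {1..2 ^ (k * CARD('n))}"
    and S: "S = (\<lambda>y. x + (1 / 2 ^ k) *\<^sub>R y) `
           (\<Union>j\<in>{1..2 ^ (k * CARD('n))}.
              (\<lambda>y. y + (2 * pi) *\<^sub>R m j) ` {y. \<forall>i. 0 \<le> y $ i \<and> y $ i \<le> 2 * pi})"
    using assms unfolding dyadic_cube_unions_def by blast
  define A where "A = m ` {1..2 ^ (k * CARD('n))}"
  have "card A = 2 ^ (k * CARD('n))"
    unfolding A_def by (subst card_image[OF m(2)]) simp
  then have "A \<in> cube_family k"
    using m(1) by (auto simp: cube_family_def A_def power_mult)
  moreover have "S = (+) x ` lattice_cubes k A"
  proof (intro set_eqI iffI)
    fix z assume "z \<in> S"
    then obtain j y where j: "j \<in> {1..2 ^ (k * CARD('n))}" and yb: "y \<in> {y. \<forall>i. 0 \<le> y $ i \<and> y $ i \<le> 2 * pi}"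
      and z: "z = x + (1 / 2 ^ k) *\<^sub>R (y + (2 * pi) *\<^sub>R m j)"
      unfolding S by blast
    have y: "0 \<le> y $ i" "y $ i \<le> 2 * pi" for i using yb by auto
    have "(z - x) \<in> lattice_cubes k A"
      unfolding mem_lattice_cubes
    proof (intro bexI allI conjI)
      show "m j \<in> A" using j by (auto simp: A_def)
      fix i
      show "side k * m j $ i \<le> (z - x) $ i" "(z - x) $ i \<le> side k * m j $ i + side k"
        using y[of i] by (auto simp: z side_def field_simps)
    qed
    then show "z \<in> (+) x ` lattice_cubes k A"
      by (intro image_eqI[of _ _ "z - x"]) auto
  next
    fix z assume "z \<in> (+) x ` lattice_cubes k A"
    then obtain u j where z: "z = x + u" and j: "j \<in> {1..2 ^ (k * CARD('n))}"
      and u: "\<And>i. side k * m j $ i \<le> u $ i" "\<And>i. u $ i \<le> side k * m j $ i + side k"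
      by (auto simp: mem_lattice_cubes A_def)
    define y where "y = 2 ^ k *\<^sub>R u - (2 * pi) *\<^sub>R m j"
    have "0 \<le> y $ i \<and> y $ i \<le> 2 * pi" for i
      using u[of i] by (auto simp: y_def side_def field_simps)
    moreover have "z = x + (1 / 2 ^ k) *\<^sub>R (y + (2 * pi) *\<^sub>R m j)"
      by (simp add: z y_def)
    ultimately show "z \<in> S"
      unfolding S using j by blast
  qed
  ultimately show ?thesis using that by blast
qed

text \<open>
  Cutting each cube into \<open>2\<^bsup>(K - k) n\<^esup>\<close> smaller ones allows the level of \<open>S\<close> to be raised to the
  period of a given periodic map.
\<close>

lemma lattice_cubes_subdivide:
  fixes A :: "(real^'n) set"
  assumes A: "A \<in> cube_family k" and "k \<le> K"
  obtains B where "B \<in> cube_family K" "lattice_cubes K B = lattice_cubes k A"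
proof -
  define M :: nat where "M = 2 ^ (K - k)"
  have M: "M > 0" "(2::nat) ^ K = 2 ^ k * M"
    using \<open>k \<le> K\<close> by (auto simp: M_def power_add[symmetric])
  then have "(2::real) ^ K = 2 ^ k * real M"
    by (metis of_nat_mult of_nat_numeral of_nat_power)
  then have sideM: "side k = real M * side K"
    using M(1) by (simp add: side_def field_simps)
  define \<psi> where "\<psi> = (\<lambda>(a :: real^'n, b). b + real M *\<^sub>R a)"
  define B where "B = \<psi> ` (A \<times> residues M)"
  have Al: "a \<in> integer_lattice" if "a \<in> A" for a using A that by (auto simp: cube_family_def)
  have Rl: "b \<in> integer_lattice" if "b \<in> residues M" for b :: "real^'n" using that by (auto simp: residues_def)
  have "inj_on \<psi> (A \<times> residues M)"
  proof (rule inj_onI, clarify)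
    fix a b a' b' assume ab: "a \<in> A" "b \<in> residues M" "a' \<in> A" "b' \<in> residues M" and eq: "\<psi> (a, b) = \<psi> (a', b')"
    have "b = residue M (\<psi> (a, b))" "b' = residue M (\<psi> (a', b'))"
      using ab Al Rl by (simp_all add: \<psi>_def residue_add_multiple residue_of_residues)
    then have "b = b'" using eq by simp
    then show "a = a' \<and> b = b'" using eq M(1) by (simp add: \<psi>_def)
  qed
  then have "card B = card A * card (residues M :: (real^'n) set)"
    unfolding B_def by (simp add: card_image card_cartesian_product)
  then have "B \<in> cube_family K"
    using A Al Rl M(2) unfolding cube_family_def B_def
    by (auto simp: card_residues power_mult_distrib \<psi>_def integer_lattice_def)
  moreover have "lattice_cubes K B = lattice_cubes k A"
  proof (intro set_eqI iffI)
    fix x assume "x \<in> lattice_cubes K B"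
    then obtain a b where ab: "a \<in> A" "b \<in> residues M"
      and x: "\<And>i. side K * (b $ i + real M * a $ i) \<le> x $ i" "\<And>i. x $ i \<le> side K * (b $ i + real M * a $ i) + side K"
      by (auto simp: mem_lattice_cubes B_def \<psi>_def)
    have "side k * a $ i \<le> x $ i \<and> x $ i \<le> side k * a $ i + side k" for i
    proof -
      have "0 \<le> b $ i" "b $ i < real M" "b $ i \<in> \<int>"
        using ab by (auto simp: residues_def integer_lattice_def)
      then obtain c :: int where "b $ i = of_int c" "0 \<le> c" "c < int M" by (auto elim!: Ints_cases)
      then have b: "0 \<le> b $ i" "b $ i + 1 \<le> real M" by auto
      have "side K * 0 \<le> side K * b $ i" "side K * (b $ i + 1) \<le> side K * real M"
        using b by (intro mult_left_mono less_imp_le[OF side_pos]; simp)+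
      then show ?thesis using x[of i] by (simp add: sideM algebra_simps)
    qed
    then show "x \<in> lattice_cubes k A" using ab by (auto simp: mem_lattice_cubes)
  next
    fix x assume "x \<in> lattice_cubes k A"
    then obtain a where a: "a \<in> A" and x: "\<And>i. side k * a $ i \<le> x $ i" "\<And>i. x $ i \<le> side k * a $ i + side k"
      by (auto simp: mem_lattice_cubes)
    \<comment> \<open>The minimum puts the far face of the large cube into the last small cube.\<close>
    define c where "c i = min \<lfloor>(x $ i - side k * a $ i) / side K\<rfloor> (int M - 1)" for i
    define b :: "real^'n" where "b = (\<chi> i. of_int (c i))"
    have c: "0 \<le> c i" "c i < int M" "side K * of_int (c i) \<le> x $ i - side k * a $ i"
      "x $ i - side k * a $ i \<le> side K * of_int (c i) + side K" for i
    proof -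
      define t where "t = (x $ i - side k * a $ i) / side K"
      have t: "0 \<le> t" "t \<le> real M" "x $ i - side k * a $ i = side K * t"
        using x[of i] side_pos[of K] by (auto simp: t_def sideM divide_simps algebra_simps)
      have c: "c i = min \<lfloor>t\<rfloor> (int M - 1)" by (simp add: c_def t_def)
      show "0 \<le> c i" "c i < int M" using t M(1) by (auto simp: c)
      have "of_int (c i) \<le> t" unfolding c by linarith
      then show "side K * of_int (c i) \<le> x $ i - side k * a $ i"
        unfolding t(3) by (intro mult_left_mono less_imp_le[OF side_pos])
      have "t \<le> of_int (c i) + 1" unfolding c using t(2) by linarith
      then have "side K * t \<le> side K * (of_int (c i) + 1)" by (intro mult_left_mono less_imp_le[OF side_pos])
      then show "x $ i - side k * a $ i \<le> side K * of_int (c i) + side K"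
        unfolding t(3) by (simp add: algebra_simps)
    qed
    have "b \<in> residues M"
      using c(1,2) by (auto simp: residues_def integer_lattice_def b_def) (metis of_int_less_iff of_int_of_nat_eq)
    then have "\<psi> (a, b) \<in> B" using a by (auto simp: B_def)
    moreover have "side K * \<psi> (a, b) $ i \<le> x $ i \<and> x $ i \<le> side K * \<psi> (a, b) $ i + side K" for i
      using c(3,4)[of i] by (simp add: \<psi>_def b_def sideM algebra_simps)
    ultimately show "x \<in> lattice_cubes K B" by (auto simp: mem_lattice_cubes)
  qed
  ultimately show ?thesis using that by blast
qed

lemma lattice_cubes_tiles:
  fixes A :: "(real^'n) set"
  assumes "A \<in> cube_family k"
  shows "cube_tiles (side k) ((\<lambda>a. side k *\<^sub>R a) ` A)"
    and "finite ((\<lambda>a. side k *\<^sub>R a) ` A)"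
    and "card ((\<lambda>a. side k *\<^sub>R a) ` A) = (2 ^ k) ^ CARD('n)"
    and "lattice_cubes k A \<in> lmeasurable" and "bounded (lattice_cubes k A)"
proof -
  have A: "finite A" "A \<subseteq> integer_lattice" "card A = (2 ^ k) ^ CARD('n)"
    using assms by (auto simp: cube_family_def)
  show "cube_tiles (side k) ((\<lambda>a. side k *\<^sub>R a) ` A)"
    using cube_tiles_lattice[OF side_pos[of k] A(1,2), of 0] by simp
  show "finite ((\<lambda>a. side k *\<^sub>R a) ` A)" using A by simp
  then show "lattice_cubes k A \<in> lmeasurable" "bounded (lattice_cubes k A)"
    unfolding lattice_cubes_def by (rule lmeasurable_cube_union, rule bounded_cube_union)
  have "inj_on (\<lambda>a. side k *\<^sub>R a) A"
    using less_imp_neq[OF side_pos[of k]] by (intro inj_onI) simp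
  then show "card ((\<lambda>a. side k *\<^sub>R a) ` A) = (2 ^ k) ^ CARD('n)"
    using A(3) by (simp add: card_image)
qed

section \<open>A shift that serves all unions of cubes\<close>

definition periodic :: "nat \<Rightarrow> (real^'n \<Rightarrow> real^'n) \<Rightarrow> bool" where
  "periodic N \<delta> \<longleftrightarrow> (\<forall>z\<in>integer_lattice. \<delta> z = \<delta> (residue N z))"

lemma residue_residue_dvd:
  assumes "N dvd N'"
  shows "residue N (residue N' z) = residue N z"
proof -
  have "(\<lfloor>z $ i\<rfloor> mod int N') mod int N = \<lfloor>z $ i\<rfloor> mod int N" for i
    using assms by (intro mod_mod_cancel) simp
  then show ?thesis by (simp add: residue_def vec_eq_iff)
qed

lemma residue_integer_lattice: "residue N z \<in> integer_lattice"
  by (simp add: residue_def integer_lattice_def)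

lemma periodic_dvd:
  assumes "periodic N \<delta>" "N dvd N'"
  shows "periodic N' \<delta>"
  using assms unfolding periodic_def by (metis residue_integer_lattice residue_residue_dvd)

definition good_shift :: "(real^'n) set \<Rightarrow> (real^'n \<Rightarrow> real^'n) \<Rightarrow> bool" where
  "good_shift S \<delta> \<longleftrightarrow> riesz_system (lebesgue_on S) integer_lattice (\<lambda>z. exponential S (z + \<delta> z))"

lemma good_shift_open:
  assumes "bounded S" "good_shift S \<delta>"
  shows "\<exists>\<eta>>0. \<forall>\<delta>'. (\<forall>z\<in>integer_lattice. norm (\<delta>' z - \<delta> z) \<le> \<eta>) \<longrightarrow> good_shift S \<delta>'"
proof -
  obtain \<eta> where \<eta>: "\<eta> > 0" and stable: "\<And>l'. \<forall>z\<in>integer_lattice. norm (l' z - (z + \<delta> z)) \<le> \<eta> \<Longrightarrow>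
      riesz_system (lebesgue_on S) integer_lattice (\<lambda>z. exponential S (l' z))"
    using riesz_system_exponential_stable[OF assms(1) assms(2)[unfolded good_shift_def]] by blast
  have "good_shift S \<delta>'" if "\<forall>z\<in>integer_lattice. norm (\<delta>' z - \<delta> z) \<le> \<eta>" for \<delta>'
    unfolding good_shift_def using that by (intro stable) simp
  with \<eta> show ?thesis by blast
qed

text \<open>
  At a common level \<open>K\<close> of \<open>S\<close> and \<open>\<delta>\<close>, changing \<open>\<delta>\<close> amounts to moving the finitely many
  representatives \<open>r + \<delta> r\<close>, and a small move makes their matrix of exponentials invertible.
\<close>

lemma good_shift_dense:
  fixes \<delta> :: "real^'n \<Rightarrow> real^'n"
  assumes A: "A \<in> cube_family k" and \<delta>: "periodic (2 ^ L) \<delta>" and "\<eta> > 0"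
  shows "\<exists>\<delta>' K. periodic (2 ^ K) \<delta>' \<and> (\<forall>z\<in>integer_lattice. norm (\<delta>' z - \<delta> z) < \<eta>) \<and>
    good_shift (lattice_cubes k A) \<delta>'"
proof -
  define K where "K = max k L"
  define N :: nat where "N = 2 ^ K"
  have N: "N > 0" "side K = 2 * pi / real N" by (simp_all add: N_def side_def)
  obtain B where B: "B \<in> cube_family K" "lattice_cubes K B = lattice_cubes k A"
    using lattice_cubes_subdivide[OF A, of K] by (auto simp: K_def)
  define P where "P = (\<lambda>a. side K *\<^sub>R a) ` B"
  have Bl: "finite B" "B \<subseteq> integer_lattice" using B(1) by (auto simp: cube_family_def)
  note P = lattice_cubes_tiles[OF B(1), folded P_def N_def]
  have "card (residues N :: (real^'n) set) = card P"
    using P(3) by (simp add: card_residues)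
  from wave_matrix_invertible[OF \<open>\<eta> > 0\<close> card_residues(1) P(2) this, of "\<lambda>r. r + \<delta> r"]
  obtain \<tau> w where \<tau>: "\<forall>r\<in>residues N. norm (\<tau> r - (r + \<delta> r)) < \<eta>"
    and inv: "inverse_matrices (residues N) P (\<lambda>r. wave (\<tau> r)) w"
    by blast
  define \<delta>' where "\<delta>' z = \<tau> (residue N z) - residue N z" for z
  have shift: "class_shift N \<tau> z = z + \<delta>' z" for z
    by (simp add: class_shift_def \<delta>'_def)
  have "riesz_system (lebesgue_on (cube_union (side K) P)) integer_lattice
      (\<lambda>z. exponential (cube_union (side K) P) (class_shift N \<tau> z))"
    by (rule riesz_system_class_shift[OF N Bl P_def inv])
  moreover have "lattice_cubes k A = cube_union (side K) P"
    unfolding B(2)[symmetric] by (simp add: lattice_cubes_def P_def)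
  ultimately have "good_shift (lattice_cubes k A) \<delta>'"
    by (simp only: good_shift_def shift)
  moreover have "periodic (2 ^ K) \<delta>'"
    unfolding periodic_def \<delta>'_def N_def by (simp add: residue_residue_dvd)
  moreover have "norm (\<delta>' z - \<delta> z) < \<eta>" if "z \<in> integer_lattice" for z
  proof -
    have "periodic N \<delta>"
      using \<delta> by (rule periodic_dvd) (simp add: N_def K_def le_imp_power_dvd)
    then have "\<delta> z = \<delta> (residue N z)" using that by (simp add: periodic_def)
    then have "\<delta>' z - \<delta> z = \<tau> (residue N z) - (residue N z + \<delta> (residue N z))"
      by (simp add: \<delta>'_def)
    then show ?thesis using \<tau> residue_in_residues[OF N(1), of z] by simp
  qed
  ultimately show ?thesis by blast
qed

lemma countable_integer_lattice: "countable (integer_lattice :: (real^'n) set)"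
proof -
  have "integer_lattice \<subseteq> (\<lambda>f. (\<chi> i. of_int (f i)) :: real^'n) ` (UNIV :: ('n \<Rightarrow> int) set)"
  proof
    fix z :: "real^'n" assume "z \<in> integer_lattice"
    then have "z $ i = of_int \<lfloor>z $ i\<rfloor>" for i
      by (auto simp: integer_lattice_def elim!: allE[of _ i] Ints_cases)
    then have "z = (\<chi> i. of_int \<lfloor>z $ i\<rfloor>)" by (simp add: vec_eq_iff)
    then show "z \<in> (\<lambda>f. (\<chi> i. of_int (f i)) :: real^'n) ` (UNIV :: ('n \<Rightarrow> int) set)"
      by (intro image_eqI[of _ _ "\<lambda>i. \<lfloor>z $ i\<rfloor>"]) auto
  qed
  moreover have "countable (UNIV :: ('n \<Rightarrow> int) set)"
    by (rule countableI_type)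
  ultimately show ?thesis by (meson countable_image countable_subset)
qed

lemma countable_cube_family: "countable (cube_family k :: (real^'n) set set)"
proof -
  have "cube_family k \<subseteq> {A :: (real^'n) set. finite A \<and> A \<subseteq> integer_lattice}"
    by (auto simp: cube_family_def)
  then show ?thesis
    using countable_Collect_finite_subset[OF countable_integer_lattice]
    by (rule countable_subset)
qed

lemma residues_in_cube_family: "residues (2 ^ k) \<in> cube_family k"
proof -
  have "residues (2 ^ k) \<subseteq> integer_lattice" by (auto simp: residues_def)
  then show ?thesis by (simp add: cube_family_def card_residues)
qed

text \<open>
  Good maps are dense near periodic ones, so the argument of Baire's theorem is run with
  periodic centres: a nested sequence of balls is built such that the ball number \<open>n + 1\<close>
  consists of maps that are good for the set number \<open>n\<close>, and the centres converge to a map in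
  all the balls.
\<close>

lemma universal_good_shift:
  fixes \<epsilon> :: real
  assumes "\<epsilon> > 0"
  shows "\<exists>\<delta> :: real^'n \<Rightarrow> real^'n. (\<forall>z\<in>integer_lattice. norm (\<delta> z) \<le> \<epsilon>) \<and>
    (\<forall>k. \<forall>A\<in>cube_family k. good_shift (lattice_cubes k A) \<delta>)"
proof -
  define \<F> :: "(nat \<times> (real^'n) set) set" where "\<F> = (SIGMA k:UNIV. cube_family k)"
  have "countable \<F>" unfolding \<F>_def by (intro countable_SIGMA countable_cube_family) auto
  moreover have "(0, residues (2 ^ 0)) \<in> \<F>"
    unfolding \<F>_def using residues_in_cube_family[of 0] by simp
  then have ne: "\<F> \<noteq> {}" by blast
  ultimately have enum: "range (from_nat_into \<F>) = \<F>" by simp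
  define S where "S n = (\<lambda>(k, A). lattice_cubes k A) (from_nat_into \<F> n)" for n
  have S: "\<exists>k. \<exists>A\<in>cube_family k. S n = lattice_cubes k A" for n
  proof -
    obtain k A where kA: "from_nat_into \<F> n = (k, A)" by fastforce
    then have "A \<in> cube_family k" using from_nat_into[OF ne, of n] by (simp add: \<F>_def)
    then show ?thesis using kA by (intro exI[of _ k] bexI[of _ A]) (simp_all add: S_def)
  qed
  have S_all: "\<exists>n. lattice_cubes k A = S n" if "A \<in> cube_family k" for k A
  proof -
    have "(k, A) \<in> range (from_nat_into \<F>)" using that enum by (simp add: \<F>_def)
    then obtain n where "from_nat_into \<F> n = (k, A)" by auto
    then show ?thesis by (intro exI[of _ n]) (simp add: S_def)
  qed

  define near where "near \<delta> \<delta>' \<eta> \<longleftrightarrow> (\<forall>z\<in>integer_lattice. norm (\<delta>' z - \<delta> z) \<le> \<eta>)"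
    for \<delta> \<delta>' :: "real^'n \<Rightarrow> real^'n" and \<eta> :: real
  \<comment> \<open>A state is a ball in the uniform distance: the pair of its centre and its radius.\<close>
  define I where "I n s \<longleftrightarrow> (\<exists>K. periodic (2 ^ K) (fst s)) \<and> snd s > 0 \<and> (n = 0 \<longrightarrow> s = ((\<lambda>_. 0), \<epsilon>))"
    for n :: nat and s :: "(real^'n \<Rightarrow> real^'n) \<times> real"
  define J where "J n s s' \<longleftrightarrow> near (fst s) (fst s') (snd s / 2) \<and> snd s' \<le> snd s / 2 \<and>
      (\<forall>\<delta>. near (fst s') \<delta> (snd s') \<longrightarrow> good_shift (S n) \<delta>)"
    for n :: nat and s s' :: "(real^'n \<Rightarrow> real^'n) \<times> real"
  have "\<exists>f. \<forall>n. I n (f n) \<and> J n (f n) (f (Suc n))"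
  proof (rule dependent_nat_choice)
    show "\<exists>s. I 0 s"
      using \<open>\<epsilon> > 0\<close> by (intro exI[of _ "((\<lambda>_. 0), \<epsilon>)"]) (simp add: I_def periodic_def)
  next
    fix s n assume "I n s"
    then obtain L where L: "periodic (2 ^ L) (fst s)" and pos: "snd s / 2 > 0" by (auto simp: I_def)
    obtain k A where A: "A \<in> cube_family k" and Sn: "S n = lattice_cubes k A" using S by blast
    obtain \<delta>' K where \<delta>': "periodic (2 ^ K) \<delta>'" "\<And>z. z \<in> integer_lattice \<Longrightarrow> norm (\<delta>' z - fst s z) < snd s / 2"
      and good: "good_shift (S n) \<delta>'"
      using good_shift_dense[OF A L pos] unfolding Sn by blast
    have "bounded (S n)" unfolding Sn by (rule lattice_cubes_tiles(5)[OF A])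
    from good_shift_open[OF this good] obtain \<eta> where \<eta>: "\<eta> > 0"
      and ball: "\<And>\<delta>. near \<delta>' \<delta> \<eta> \<Longrightarrow> good_shift (S n) \<delta>"
      unfolding near_def by blast
    have "near \<delta>' \<delta> \<eta>" if "near \<delta>' \<delta> (min \<eta> (snd s / 2))" for \<delta>
      using that by (auto simp: near_def)
    then have "I (Suc n) (\<delta>', min \<eta> (snd s / 2)) \<and> J n s (\<delta>', min \<eta> (snd s / 2))"
      using \<delta>' \<eta> pos ball by (auto simp: I_def J_def near_def less_imp_le)
    then show "\<exists>s'. I (Suc n) s' \<and> J n s s'" by blast
  qed
  then obtain f where I: "\<And>n. I n (f n)" and J: "\<And>n. J n (f n) (f (Suc n))" by blast
  define d where "d n = fst (f n)" for n
  define \<eta> where "\<eta> n = snd (f n)" for n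
  have init: "d 0 = (\<lambda>_. 0)" "\<eta> 0 = \<epsilon>" using I[of 0] by (auto simp: I_def d_def \<eta>_def)
  have pos: "\<eta> n > 0" for n using I[of n] by (auto simp: I_def \<eta>_def)
  have step: "norm (d (Suc n) z - d n z) \<le> \<eta> n / 2" if "z \<in> integer_lattice" for n z
    using J[of n] that by (auto simp: J_def near_def d_def \<eta>_def)
  have half: "\<eta> (Suc n) \<le> \<eta> n / 2" for n using J[of n] by (auto simp: J_def \<eta>_def)
  have good: "good_shift (S n) \<delta>" if "near (d (Suc n)) \<delta> (\<eta> (Suc n))" for n \<delta>
    using J[of n] that by (auto simp: J_def d_def \<eta>_def)
  \<comment> \<open>The radii are halved at each step, so they control the tails of the sequence of centres.\<close>
  have tail: "norm (d (n + j) z - d n z) \<le> \<eta> n - \<eta> (n + j)" if z: "z \<in> integer_lattice" for n j z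
  proof (induction j)
    case (Suc j)
    have "norm (d (n + Suc j) z - d n z) \<le> norm (d (Suc (n + j)) z - d (n + j) z) + norm (d (n + j) z - d n z)"
      using norm_triangle_ineq[of "d (Suc (n + j)) z - d (n + j) z" "d (n + j) z - d n z"] by simp
    also have "\<dots> \<le> \<eta> (n + j) / 2 + (\<eta> n - \<eta> (n + j))"
      by (intro add_mono step Suc.IH z)
    also have "\<dots> \<le> \<eta> n - \<eta> (n + Suc j)"
      using half[of "n + j"] by simp
    finally show ?case .
  qed simp
  have tail': "norm (d m z - d n z) \<le> \<eta> n" if "z \<in> integer_lattice" "m \<ge> n" for n m z
    using tail[OF that(1), of n "m - n"] that(2) pos[of m] by simp
  have \<eta>_le: "\<eta> n \<le> \<epsilon> * (1 / 2) ^ n" for n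
  proof (induction n)
    case (Suc n)
    then show ?case using half[of n] by simp
  qed (simp add: init)
  have conv: "convergent (\<lambda>n. d n z)" if z: "z \<in> integer_lattice" for z
  proof (rule Cauchy_convergent, rule metric_CauchyI)
    fix e :: real assume "e > 0"
    have "(\<lambda>n. 2 * (\<epsilon> * (1 / 2) ^ n)) \<longlonglongrightarrow> 2 * (\<epsilon> * 0)"
      by (intro tendsto_intros LIMSEQ_realpow_zero) auto
    then have "\<forall>\<^sub>F n in sequentially. 2 * (\<epsilon> * (1 / 2) ^ n) < e"
      using \<open>e > 0\<close> by (intro order_tendstoD) auto
    then obtain M where M: "2 * (\<epsilon> * (1 / 2) ^ M) < e" by (auto simp: eventually_sequentially)
    have "dist (d m z) (d n z) < e" if "m \<ge> M" "n \<ge> M" for m n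
    proof -
      have "dist (d m z) (d n z) \<le> dist (d m z) (d M z) + dist (d n z) (d M z)"
        by (rule dist_triangle2)
      also have "\<dots> \<le> \<eta> M + \<eta> M"
        unfolding dist_norm using that z by (intro add_mono tail')
      finally show ?thesis using \<eta>_le[of M] M by simp
    qed
    then show "\<exists>M. \<forall>m\<ge>M. \<forall>n\<ge>M. dist (d m z) (d n z) < e" by blast
  qed
  define \<delta> where "\<delta> z = lim (\<lambda>n. d n z)" for z
  have near: "norm (\<delta> z - d n z) \<le> \<eta> n" if z: "z \<in> integer_lattice" for n z
  proof (rule LIMSEQ_le_const2)
    have "(\<lambda>m. d m z) \<longlonglongrightarrow> \<delta> z"
      using conv[OF z] by (simp add: \<delta>_def convergent_LIMSEQ_iff)
    then show "(\<lambda>m. norm (d m z - d n z)) \<longlonglongrightarrow> norm (\<delta> z - d n z)"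
      by (intro tendsto_intros)
    show "\<exists>M. \<forall>m\<ge>M. norm (d m z - d n z) \<le> \<eta> n"
      using tail'[OF z] by blast
  qed
  have "good_shift (S n) \<delta>" for n
    using near by (intro good) (simp add: near_def)
  then have "\<forall>k. \<forall>A\<in>cube_family k. good_shift (lattice_cubes k A) \<delta>"
    using S_all by metis
  moreover have "\<forall>z\<in>integer_lattice. norm (\<delta> z) \<le> \<epsilon>"
    using near[of _ 0] by (simp add: init)
  ultimately show ?thesis by blast
qed

text \<open>
  Distinct lattice points differ by at least \<open>1\<close> in some coordinate, while the shifts change the
  difference by at most \<open>1/2\<close>.
\<close>

lemma shifted_lattice_injective:
  assumes small: "\<And>z. z \<in> integer_lattice \<Longrightarrow> norm (\<delta> z) \<le> 1 / 4"
  shows "inj_on (\<lambda>z. z + \<delta> z) (integer_lattice :: (real^'n) set)"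
proof (rule inj_onI, rule ccontr)
  fix z w :: "real^'n"
  assume zw: "z \<in> integer_lattice" "w \<in> integer_lattice" and eq: "z + \<delta> z = w + \<delta> w" and "z \<noteq> w"
  then obtain i where i: "z $ i \<noteq> w $ i" by (auto simp: vec_eq_iff)
  have "z $ i - w $ i \<in> \<int>" using zw by (simp add: integer_lattice_def)
  then obtain m :: int where m: "z $ i - w $ i = of_int m" by (auto elim: Ints_cases)
  then have "m \<noteq> 0" using i by auto
  then have "1 \<le> \<bar>z $ i - w $ i\<bar>" unfolding m by linarith
  moreover have "z $ i - w $ i = \<delta> w $ i - \<delta> z $ i"
    using arg_cong[OF eq, of "\<lambda>v. v $ i"] by (simp add: algebra_simps)
  moreover have "\<bar>\<delta> w $ i\<bar> \<le> 1 / 4" "\<bar>\<delta> z $ i\<bar> \<le> 1 / 4"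
    using small zw component_le_norm_cart order_trans by blast+
  ultimately show False by linarith
qed

lemma perturbation_shifted_lattice:
  fixes \<delta> :: "real^'n \<Rightarrow> real^'n"
  assumes inj: "inj_on (\<lambda>z. z + \<delta> z) integer_lattice"
    and le: "\<And>z. z \<in> integer_lattice \<Longrightarrow> norm (\<delta> z) \<le> \<eta>" and "0 \<le> \<eta>" "\<eta> < \<epsilon>"
  shows "perturbation \<epsilon> integer_lattice ((\<lambda>z. z + \<delta> z) ` integer_lattice)"
proof -
  obtain g :: "real^'n \<Rightarrow> nat" where g: "inj_on g integer_lattice"
    using countable_integer_lattice by (rule countableE)
  define l where "l = inv_into integer_lattice g"
  have l: "bij_betw l (g ` integer_lattice) integer_lattice"
    unfolding l_def by (rule bij_betw_inv_into) (rule inj_on_imp_bij_betw[OF g])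
  have "bij_betw ((\<lambda>z. z + \<delta> z) \<circ> l) (g ` integer_lattice) ((\<lambda>z. z + \<delta> z) ` integer_lattice)"
    by (rule bij_betw_trans[OF l inj_on_imp_bij_betw[OF inj]])
  moreover have "(SUP k\<in>g ` integer_lattice. ennreal (norm (l k - ((\<lambda>z. z + \<delta> z) \<circ> l) k))) < ennreal \<epsilon>"
  proof (rule le_less_trans)
    show "(SUP k\<in>g ` integer_lattice. ennreal (norm (l k - ((\<lambda>z. z + \<delta> z) \<circ> l) k))) \<le> ennreal \<eta>"
    proof (rule SUP_least)
      fix k assume "k \<in> g ` (integer_lattice :: (real^'n) set)"
      then have "l k \<in> integer_lattice" using l by (auto simp: bij_betw_def)
      then show "ennreal (norm (l k - ((\<lambda>z. z + \<delta> z) \<circ> l) k)) \<le> ennreal \<eta>"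
        using le by (intro ennreal_leI) simp
    qed
    show "ennreal \<eta> < ennreal \<epsilon>" using assms(3,4) by (simp add: ennreal_lessI)
  qed
  ultimately show ?thesis
    unfolding perturbation_def using l by blast
qed

theorem theorem3p1:
  fixes \<epsilon> :: real
  assumes "\<epsilon> > 0"
  shows "\<exists>\<Lambda> :: (real^'n) set. perturbation \<epsilon> integer_lattice \<Lambda> \<and>
           (\<forall>S\<in>dyadic_cube_unions. riesz_basis (lebesgue_on S) \<Lambda> (exponential S))"
proof -
  \<comment> \<open>One half leaves room for the strict inequality of the supremum; one quarter keeps distinct lattice points distinct.\<close>
  define \<eta> where "\<eta> = min (\<epsilon> / 2) (1 / 4)"
  have \<eta>: "\<eta> > 0" "\<eta> < \<epsilon>" "\<eta> \<le> 1 / 4" using assms by (auto simp: \<eta>_def)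
  obtain \<delta> :: "real^'n \<Rightarrow> real^'n" where small: "\<And>z. z \<in> integer_lattice \<Longrightarrow> norm (\<delta> z) \<le> \<eta>"
    and good: "\<And>k A. A \<in> cube_family k \<Longrightarrow> good_shift (lattice_cubes k A) \<delta>"
    using universal_good_shift[OF \<eta>(1)] by blast
  let ?l = "\<lambda>z. z + \<delta> z"
  have inj: "inj_on ?l integer_lattice"
    by (rule shifted_lattice_injective) (use small \<eta>(3) order_trans in blast)
  define \<Lambda> where "\<Lambda> = ?l ` integer_lattice"
  have bij: "bij_betw ?l integer_lattice \<Lambda>"
    unfolding \<Lambda>_def by (rule inj_on_imp_bij_betw[OF inj])
  have "perturbation \<epsilon> integer_lattice \<Lambda>"
    unfolding \<Lambda>_def using small \<eta> by (intro perturbation_shifted_lattice[OF inj]) auto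
  moreover have "riesz_basis (lebesgue_on S) \<Lambda> (exponential S)" if S: "S \<in> dyadic_cube_unions" for S
  proof -
    obtain x k A where A: "A \<in> cube_family k" and S: "S = (+) x ` lattice_cubes k A"
      by (rule dyadic_cube_unions_eq[OF S])
    note tiles = lattice_cubes_tiles[OF A]
    have rs: "riesz_system (lebesgue_on S) integer_lattice (\<lambda>z. exponential S (?l z))"
      unfolding S using good[OF A] by (intro riesz_system_translate tiles(4)) (simp add: good_shift_def)
    define P where "P = (\<lambda>a. x + side k *\<^sub>R a) ` A"
    have P: "P = (\<lambda>p. x + p) ` ((\<lambda>a. side k *\<^sub>R a) ` A)" by (auto simp: P_def)
    have SP: "S = cube_union (side k) P"
      unfolding P cube_union_translate S lattice_cubes_def ..
    have "card P = (2 ^ k) ^ CARD('n)"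
      unfolding P using tiles(3) by (subst card_image) auto
    moreover have "cube_tiles (side k) P"
      unfolding P_def using A by (intro cube_tiles_lattice) (auto simp: cube_family_def)
    ultimately obtain e where e: "orthonormal_basis (lebesgue_on S) (integer_lattice :: (real^'n) set) e"
      "riesz_system (lebesgue_on S) (integer_lattice :: (real^'n) set) e"
      using orthonormal_basis_cube_union[of "2 ^ k" "side k" P] unfolding SP by (auto simp: side_def)
    show ?thesis
      by (rule riesz_basis_reindex[OF riesz_basis_if_riesz_system[OF e rs] bij])
  qed
  ultimately show ?thesis by blast
qed

end
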